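(* Let $\mathcal C$ be a monotone class of finite graphs. The following are equivalent: (1) for every interpretation scheme $\mathsf I$ of graphs in graphs, the class $\mathsf I(\mathcal C)$ is random-free; (2) for every basic interpretation scheme $\mathsf I$ of graphs in graphs with exponent $1$, the class $\mathsf I(\mathcal C)$ is random-free; (3) the class $\mathcal C$ is nowhere dense.
   Context: Graphs are structures with one symmetric irreflexive binary relation. An interpretation scheme of graphs in graphs with exponent $k$ is given by first-order graph formulas $E(\mathbf x,\mathbf y)$, $\theta_0(\mathbf x)$, $\theta_1(\mathbf x,\mathbf y)$ ($\mathbf x,\mathbf y$ $k$-tuples of variables) such that $E$ defines an equivalence relation on $k$-tuples and $\theta_0,\theta_1$ are invariant under replacing tuples by $E$-equivalent ones; $\mathsf I(G)$ has as vertices the $E$-classes of $k$-tuples satisfying $\theta_0$, two classes being adjacent iff their representatives satisfy $\theta_1$ (the scheme yielding graphs). A basic interpretation scheme with exponent $1$ is given by a single formula $\theta(x_1,x_2)$: $\mathsf I(G)$ has vertex set $V(G)$ and $u\sim v$ iff $G\models\theta(u,v)$. $\mathsf I(\mathcal C)=\{\mathsf I(G):G\in\mathcal C\}$. A graphon is a symmetric measurable $W:[0,1]^2\to[0,1]$; a sequence $(G_n)$ is L-convergent to $W$ if $\hom(F,G_n)/|G_n|^{|F|}\to\int\prod_{ij\in E(F)}W(x_i,x_j)\,\mathrm dx$ for every finite graph $F$; $W$ is random-free if $\{0,1\}$-valued a.e. A class is random-free if every L-limit (graphon) of a sequence of graphs in the class is random-free. A monotone class (closed under subgraphs) $\mathcal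 C$ is nowhere dense if for every $p$ there is $N$ such that the graph obtained from $K_N$ by subdividing each edge $p$ times is not in $\mathcal C$. *)

theory Defs
  imports "HOL-Probability.Probability"
begin

record 'a graph =
  verts :: "'a set"
  edges :: "('a \<times> 'a) set"

definition is_graph :: "'a graph \<Rightarrow> bool" where
  "is_graph G \<longleftrightarrow> finite (verts G) \<and> edges G \<subseteq> verts G \<times> verts G
     \<and> (\<forall>u v. (u, v) \<in> edges G \<longrightarrow> (v, u) \<in> edges G)
     \<and> (\<forall>u. (u, u) \<notin> edges G)"

definition graph_iso :: "'a graph \<Rightarrow> 'b graph \<Rightarrow> bool" where
  "graph_iso G H \<longleftrightarrow> (\<exists>f. bij_betw f (verts G) (verts H) \<and>
     (\<forall>u\<in>verts G. \<forall>v\<in>verts G. (u, v) \<in> edges G \<longleftrightarrow> (f u, f v) \<in> edges H))"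

definition subgraph :: "'a graph \<Rightarrow> 'a graph \<Rightarrow> bool" where
  "subgraph H G \<longleftrightarrow> verts H \<subseteq> verts G \<and> edges H \<subseteq> edges G"

definition monotone_class :: "nat graph set \<Rightarrow> bool" where
  "monotone_class C \<longleftrightarrow> (\<forall>G\<in>C. is_graph G) \<and>
     (\<forall>G\<in>C. \<forall>H :: nat graph. \<forall>G' :: nat graph.
        is_graph H \<and> is_graph G' \<and> subgraph G' G \<and> graph_iso H G' \<longrightarrow> H \<in> C)"

text \<open>The graph obtained from K_N by subdividing each edge p times.
  Branch vertex i is (i,i,0); the t-th subdivision vertex of edge {i,j}, i<j, is (i,j,t).\<close>
definition sd_pt :: "nat \<Rightarrow> nat \<Rightarrow> nat \<Rightarrow> nat \<Rightarrow> nat \<times> nat \<times> nat" where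
  "sd_pt p i j t = (if t = 0 then (i, i, 0) else if t = Suc p then (j, j, 0) else (i, j, t))"

definition subdivided_clique :: "nat \<Rightarrow> nat \<Rightarrow> (nat \<times> nat \<times> nat) graph" where
  "subdivided_clique p N =
     \<lparr> verts = {(i, i, 0) | i. i < N} \<union> {(i, j, t) | i j t. i < j \<and> j < N \<and> 1 \<le> t \<and> t \<le> p},
       edges = {(sd_pt p i j t, sd_pt p i j (Suc t)) | i j t. i < j \<and> j < N \<and> t \<le> p}
             \<union> {(sd_pt p i j (Suc t), sd_pt p i j t) | i j t. i < j \<and> j < N \<and> t \<le> p} \<rparr>"

definition nowhere_dense :: "nat graph set \<Rightarrow> bool" where
  "nowhere_dense C \<longleftrightarrow> (\<forall>p. \<exists>N. \<forall>G\<in>C. \<not> graph_iso (subdivided_clique p N) G)"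

datatype fo = Tru | Eq nat nat | Adj nat nat | Neg fo | Conj fo fo | Ex nat fo

fun fv :: "fo \<Rightarrow> nat set" where
  "fv Tru = {}"
| "fv (Eq x y) = {x, y}"
| "fv (Adj x y) = {x, y}"
| "fv (Neg \<phi>) = fv \<phi>"
| "fv (Conj \<phi> \<psi>) = fv \<phi> \<union> fv \<psi>"
| "fv (Ex x \<phi>) = fv \<phi> - {x}"

fun sat :: "'a graph \<Rightarrow> (nat \<Rightarrow> 'a) \<Rightarrow> fo \<Rightarrow> bool" where
  "sat G \<sigma> Tru = True"
| "sat G \<sigma> (Eq x y) = (\<sigma> x = \<sigma> y)"
| "sat G \<sigma> (Adj x y) = ((\<sigma> x, \<sigma> y) \<in> edges G)"
| "sat G \<sigma> (Neg \<phi>) = (\<not> sat G \<sigma> \<phi>)"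
| "sat G \<sigma> (Conj \<phi> \<psi>) = (sat G \<sigma> \<phi> \<and> sat G \<sigma> \<psi>)"
| "sat G \<sigma> (Ex x \<phi>) = (\<exists>v\<in>verts G. sat G (\<sigma>(x := v)) \<phi>)"

record scheme =
  sk :: nat
  s_eq :: fo    \<comment> \<open>E(x,y): x = variables 0..k-1, y = variables k..2k-1\<close>
  s_th0 :: fo
  s_th1 :: fo

definition tuples :: "nat \<Rightarrow> 'a set \<Rightarrow> 'a list set" where
  "tuples k A = {xs. length xs = k \<and> set xs \<subseteq> A}"

definition asg :: "nat \<Rightarrow> 'a list \<Rightarrow> 'a list \<Rightarrow> nat \<Rightarrow> 'a" where
  "asg k xs ys i = (if i < k then xs ! i else ys ! (i - k))"

definition satE :: "scheme \<Rightarrow> 'a graph \<Rightarrow> 'a list \<Rightarrow> 'a list \<Rightarrow> bool" where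
  "satE I G xs ys = sat G (asg (sk I) xs ys) (s_eq I)"

definition sat0 :: "scheme \<Rightarrow> 'a graph \<Rightarrow> 'a list \<Rightarrow> bool" where
  "sat0 I G xs = sat G (asg (sk I) xs xs) (s_th0 I)"

definition sat1 :: "scheme \<Rightarrow> 'a graph \<Rightarrow> 'a list \<Rightarrow> 'a list \<Rightarrow> bool" where
  "sat1 I G xs ys = sat G (asg (sk I) xs ys) (s_th1 I)"

definition interp_scheme :: "scheme \<Rightarrow> bool" where
  "interp_scheme I \<longleftrightarrow>
     fv (s_eq I) \<subseteq> {..<2 * sk I} \<and> fv (s_th0 I) \<subseteq> {..<sk I} \<and> fv (s_th1 I) \<subseteq> {..<2 * sk I} \<and>
     (\<forall>G :: nat graph. is_graph G \<longrightarrow>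
        (let T = tuples (sk I) (verts G) in
          (\<forall>xs\<in>T. satE I G xs xs) \<and>
          (\<forall>xs\<in>T. \<forall>ys\<in>T. satE I G xs ys \<longrightarrow> satE I G ys xs) \<and>
          (\<forall>xs\<in>T. \<forall>ys\<in>T. \<forall>zs\<in>T. satE I G xs ys \<and> satE I G ys zs \<longrightarrow> satE I G xs zs) \<and>
          (\<forall>xs\<in>T. \<forall>xs'\<in>T. satE I G xs xs' \<longrightarrow> (sat0 I G xs \<longleftrightarrow> sat0 I G xs')) \<and>
          (\<forall>xs\<in>T. \<forall>xs'\<in>T. \<forall>ys\<in>T. \<forall>ys'\<in>T. satE I G xs xs' \<and> satE I G ys ys' \<longrightarrow>
               (sat1 I G xs ys \<longleftrightarrow> sat1 I G xs' ys')) \<and>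
          (\<forall>xs\<in>T. \<forall>ys\<in>T. sat0 I G xs \<and> sat0 I G ys \<and> sat1 I G xs ys \<longrightarrow> sat1 I G ys xs) \<and>
          (\<forall>xs\<in>T. sat0 I G xs \<longrightarrow> \<not> sat1 I G xs xs)))"

definition eclass :: "scheme \<Rightarrow> 'a graph \<Rightarrow> 'a list \<Rightarrow> 'a list set" where
  "eclass I G xs = {ys \<in> tuples (sk I) (verts G). satE I G xs ys}"

definition interp :: "scheme \<Rightarrow> 'a graph \<Rightarrow> 'a list set graph" where
  "interp I G =
     \<lparr> verts = {eclass I G xs | xs. xs \<in> tuples (sk I) (verts G) \<and> sat0 I G xs},
       edges = {(eclass I G xs, eclass I G ys) | xs ys.
                  xs \<in> tuples (sk I) (verts G) \<and> ys \<in> tuples (sk I) (verts G) \<and>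
                  sat0 I G xs \<and> sat0 I G ys \<and> sat1 I G xs ys} \<rparr>"

definition interp_class :: "scheme \<Rightarrow> nat graph set \<Rightarrow> nat graph set" where
  "interp_class I C = {H. is_graph H \<and> (\<exists>G\<in>C. graph_iso H (interp I G))}"

text \<open>Basic interpretation schemes with exponent 1: a formula theta(x_1,x_2)
  (variables 0 and 1) defining a graph on V(G) for every finite graph G.\<close>
definition basic_scheme :: "fo \<Rightarrow> bool" where
  "basic_scheme \<theta> \<longleftrightarrow> fv \<theta> \<subseteq> {0, 1} \<and>
     (\<forall>G :: nat graph. is_graph G \<longrightarrow>
        (\<forall>u\<in>verts G. \<forall>v\<in>verts G. sat G ((\<lambda>_. u)(1 := v)) \<theta> \<longrightarrow> sat G ((\<lambda>_. v)(1 := u)) \<theta>) \<and>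
        (\<forall>u\<in>verts G. \<not> sat G (\<lambda>_. u) \<theta>))"

definition basic_interp :: "fo \<Rightarrow> 'a graph \<Rightarrow> 'a graph" where
  "basic_interp \<theta> G = \<lparr> verts = verts G,
     edges = {(u, v). u \<in> verts G \<and> v \<in> verts G \<and> sat G ((\<lambda>_. u)(1 := v)) \<theta>} \<rparr>"

definition basic_interp_class :: "fo \<Rightarrow> nat graph set \<Rightarrow> nat graph set" where
  "basic_interp_class \<theta> C = {H. is_graph H \<and> (\<exists>G\<in>C. graph_iso H (basic_interp \<theta> G))}"

definition M01 :: "real measure" where
  "M01 = restrict_space lborel {0..1}"

definition graphon :: "(real \<Rightarrow> real \<Rightarrow> real) \<Rightarrow> bool" where
  "graphon W \<longleftrightarrow> (\<lambda>z. W (fst z) (snd z)) \<in> borel_measurable (M01 \<Otimes>\<^sub>M M01) \<and>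
     (\<forall>x\<in>{0..1}. \<forall>y\<in>{0..1}. W x y = W y x \<and> 0 \<le> W x y \<and> W x y \<le> 1)"

definition random_free_graphon :: "(real \<Rightarrow> real \<Rightarrow> real) \<Rightarrow> bool" where
  "random_free_graphon W \<longleftrightarrow> (AE z in M01 \<Otimes>\<^sub>M M01. W (fst z) (snd z) \<in> {0, 1})"

definition hom :: "'a graph \<Rightarrow> 'b graph \<Rightarrow> nat" where
  "hom F G = card {f \<in> verts F \<rightarrow>\<^sub>E verts G. \<forall>(u, v)\<in>edges F. (f u, f v) \<in> edges G}"

definition hom_density :: "nat graph \<Rightarrow> (real \<Rightarrow> real \<Rightarrow> real) \<Rightarrow> real" where
  "hom_density F W = integral\<^sup>L (Pi\<^sub>M (verts F) (\<lambda>_. M01))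
     (\<lambda>x. \<Prod>e\<in>{(i, j) \<in> edges F. i < j}. W (x (fst e)) (x (snd e)))"

definition L_convergent :: "(nat \<Rightarrow> nat graph) \<Rightarrow> (real \<Rightarrow> real \<Rightarrow> real) \<Rightarrow> bool" where
  "L_convergent Gs W \<longleftrightarrow> (\<forall>F :: nat graph. is_graph F \<longrightarrow>
     (\<lambda>n. real (hom F (Gs n)) / real (card (verts (Gs n))) ^ card (verts F))
       \<longlonglongrightarrow> hom_density F W)"

definition random_free_class :: "nat graph set \<Rightarrow> bool" where
  "random_free_class C \<longleftrightarrow> (\<forall>Gs W. (\<forall>n. Gs n \<in> C) \<and> graphon W \<and> L_convergent Gs W
      \<longrightarrow> random_free_graphon W)"

end

theory Submission
  imports Defs "HOL-Library.Ramsey"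
begin

text \<open>
  If a graphon \<open>W\<close> is not random-free, then every bipartite pattern has positive density in \<open>W\<close>,
  so graphs converging to \<open>W\<close> shatter arbitrarily large sets of vertices. If this happened for
  interpretations of graphs in a nowhere dense class, an ultraproduct would produce an infinite
  graph that contains no large subdivided cliques, but in which a formula shatters an infinite
  sequence of tuples. A finite set \<open>S\<close> can be removed so that infinitely many of
  these tuples become pairwise far apart: a vertex joined to infinitely many tuples by a fan of short
  walks is a hub, many hubs would give a large subdivided clique, and outside a maximal set of hubs
  Ramsey's theorem applies. Tuples with far apart surroundings of the same type can be exchanged in an
  Ehrenfeucht-Fraisse game, so a parameter can only tell apart the few tuples that are near it,
  which contradicts shattering.

  Conversely, a class that is not nowhere dense contains all subgraphs of \<open>p\<close>-subdivided cliques. The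
  \<open>p\<close>-subdivision of the graph on \<open>2^d\<close> sets in which two sets are adjacent iff their intersection is
  odd, with many pendant vertices attached to each branch vertex, is a sparse graph in which
  being joined by a walk of length \<open>p + 3\<close> defines, up to a negligible number of pairs, a
  balanced blow-up of this quasirandom graph; the limit is the constant graphon \<open>1 / 2\<close>.
\<close>

section \<open>Hubs and scattered sequences\<close>

text \<open>The ultraproduct trades bounds for infinity. A bound on shattering must be uniform over
  the class, and a finite argument would carry quantitative forms of Ramsey's theorem and of the
  type counts; in one infinite graph "all but finitely many" does this work. Excluding one
  subdivided clique for each \<open>p\<close> and satisfying one formula both pass to ultraproducts.

  Bipartite patterns are controlled by one weight: \<open>min W (1 - W)\<close> bounds edge and
  non-edge factors alike, and a weight that is not a.e. zero has positive density on every complete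
  bipartite graph. Patterns with prescribed edges inside a side can have density zero.

  In the converse, a basic scheme of exponent \<open>1\<close> keeps all vertices, so subdivision
  vertices cannot be discarded; pendant vertices outnumber them instead. The length
  \<open>p + 3\<close> is a subdivided edge with \<open>p + 1\<close> edges and one pendant edge at
  each end. Parity of intersections is chosen because its signs factor over the points of the ground
  set, so the counts have a closed form.\<close>

lemma infinite_pairs_dichotomy:
  fixes R :: "'i \<Rightarrow> 'i \<Rightarrow> bool"
  assumes "infinite N" "\<And>i j. R i j \<Longrightarrow> R j i"
  obtains N' where "N' \<subseteq> N" "infinite N'"
    "(\<forall>i\<in>N'. \<forall>j\<in>N'. i \<noteq> j \<longrightarrow> R i j) \<or> (\<forall>i\<in>N'. \<forall>j\<in>N'. i \<noteq> j \<longrightarrow> \<not> R i j)"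
proof -
  define f where "f X = (if \<exists>i j. X = {i, j} \<and> R i j then 0 else 1::nat)" for X
  have f: "f {i, j} = 0 \<longleftrightarrow> R i j" for i j
    unfolding f_def using assms(2) by (auto simp: doubleton_eq_iff)
  have "\<exists>Y t. Y \<subseteq> N \<and> infinite Y \<and> t < 2 \<and> (\<forall>x\<in>Y. \<forall>y\<in>Y. x \<noteq> y \<longrightarrow> f {x, y} = t)"
    by (rule Ramsey2) (auto simp: assms f_def)
  then obtain Y t where Y: "Y \<subseteq> N" "infinite Y" "t < 2" "\<forall>x\<in>Y. \<forall>y\<in>Y. x \<noteq> y \<longrightarrow> f {x, y} = t"
    by blast
  show ?thesis
  proof (cases "t = 0")
    case True
    then show ?thesis using that[of Y] Y f by auto
  next
    case False
    then have "\<forall>i\<in>Y. \<forall>j\<in>Y. i \<noteq> j \<longrightarrow> \<not> R i j" using Y(4) f by force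
    then show ?thesis using that[of Y] Y by blast
  qed
qed

text \<open>Induction on the size bound. If Ramsey's theorem does not give a pairwise disjoint
  infinite subfamily, it gives a pairwise intersecting one; infinitely many of its sets then meet
  the finite set \<open>F i0\<close> in a common element \<open>x\<close>, and deleting
  \<open>x\<close> lowers the bound.\<close>

lemma delta_system:
  fixes F :: "'i \<Rightarrow> 'a set"
  assumes "infinite N" "\<And>i. i \<in> N \<Longrightarrow> finite (F i) \<and> card (F i) \<le> n"
  shows "\<exists>K N'. finite K \<and> infinite N' \<and> N' \<subseteq> N \<and> (\<forall>i\<in>N'. \<forall>j\<in>N'. i \<noteq> j \<longrightarrow> F i \<inter> F j \<subseteq> K)"
  using assms
proof (induction n arbitrary: N F)
  case 0
  then show ?case
    by (intro exI[of _ "{}"] exI[of _ N]) fastforce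
next
  case (Suc n)
  obtain N1 where N1: "N1 \<subseteq> N" "infinite N1"
    and dich: "(\<forall>i\<in>N1. \<forall>j\<in>N1. i \<noteq> j \<longrightarrow> F i \<inter> F j = {}) \<or> (\<forall>i\<in>N1. \<forall>j\<in>N1. i \<noteq> j \<longrightarrow> F i \<inter> F j \<noteq> {})"
    using infinite_pairs_dichotomy[OF Suc.prems(1), of "\<lambda>i j. F i \<inter> F j = {}"] by blast
  show ?case
  proof (cases "\<forall>i\<in>N1. \<forall>j\<in>N1. i \<noteq> j \<longrightarrow> F i \<inter> F j = {}")
    case True
    then show ?thesis using N1 by (intro exI[of _ "{}"] exI[of _ N1]) auto
  next
    case False
    obtain i0 where i0: "i0 \<in> N1" using N1(2) by fastforce
    have "\<forall>j\<in>N1 - {i0}. \<exists>x\<in>F i0. x \<in> F j"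
      using False dich i0 by blast
    moreover have "finite (F i0)" "infinite (N1 - {i0})"
      using i0 N1 Suc.prems(2) by auto
    ultimately obtain x where x: "infinite {j \<in> N1 - {i0}. x \<in> F j}"
      using pigeonhole_infinite_rel[of "N1 - {i0}" "F i0" "\<lambda>j x. x \<in> F j"] by blast
    let ?N2 = "{j \<in> N1 - {i0}. x \<in> F j}"
    have small: "finite (F j - {x}) \<and> card (F j - {x}) \<le> n" if "j \<in> ?N2" for j
    proof -
      have "j \<in> N" using that N1(1) by blast
      from Suc.prems(2)[OF this] that show ?thesis by (auto simp: card_Diff_singleton)
    qed
    have "\<exists>K N'. finite K \<and> infinite N' \<and> N' \<subseteq> ?N2 \<and>
        (\<forall>i\<in>N'. \<forall>j\<in>N'. i \<noteq> j \<longrightarrow> (F i - {x}) \<inter> (F j - {x}) \<subseteq> K)"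
      by (rule Suc.IH[OF x]) (rule small)
    then obtain K N' where
      K: "finite K" "infinite N'" "N' \<subseteq> ?N2"
      "\<forall>i\<in>N'. \<forall>j\<in>N'. i \<noteq> j \<longrightarrow> (F i - {x}) \<inter> (F j - {x}) \<subseteq> K"
      by (elim exE conjE)
    have "F i \<inter> F j \<subseteq> insert x K" if "i \<in> N'" "j \<in> N'" "i \<noteq> j" for i j
      using K(4)[rule_format, OF that] by blast
    moreover have "N' \<subseteq> N" using K(3) N1(1) by blast
    ultimately show ?thesis using K(1,2) by (metis finite_insert)
  qed
qed

section \<open>Walks as lists of vertices, and walks that avoid a set\<close>

definition walk :: "('a \<times> 'a) set \<Rightarrow> 'a \<Rightarrow> 'a \<Rightarrow> 'a list \<Rightarrow> bool" where
  "walk E x y xs \<longleftrightarrow> xs \<noteq> [] \<and> hd xs = x \<and> last xs = y \<and> successively (\<lambda>u v. (u, v) \<in> E) xs"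

lemma walk_mono: "walk E x y xs \<Longrightarrow> E \<subseteq> E' \<Longrightarrow> walk E' x y xs"
  unfolding walk_def by (auto elim: successively_mono)

lemma walk_rev:
  assumes "walk E x y xs" "sym E"
  shows "walk E y x (rev xs)"
  using assms unfolding walk_def
  by (auto simp: hd_rev last_rev dest: symD intro: successively_mono)

lemma walk_append:
  assumes "walk E x y xs" "walk E y z ys"
  shows "walk E x z (xs @ tl ys)"
proof (cases ys)
  case Nil
  then show ?thesis using assms unfolding walk_def by auto
next
  case (Cons v vs)
  then show ?thesis using assms unfolding walk_def
    by (cases vs) (auto simp: successively_append_iff)
qed

lemma walk_distinct:
  assumes "walk E x y xs"
  shows "\<exists>ys. walk E x y ys \<and> distinct ys \<and> set ys \<subseteq> set xs \<and> length ys \<le> length xs"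
  using assms
proof (induction "length xs" arbitrary: xs rule: less_induct)
  case less
  show ?case
  proof (cases "distinct xs")
    case True
    then show ?thesis using less.prems by blast
  next
    case False
    \<comment> \<open>The walk returns to \<open>z\<close>; cutting out the closed part shortens it
      and adds no vertex.\<close>
    then obtain as z bs cs where xs: "xs = as @ [z] @ bs @ [z] @ cs"
      using not_distinct_decomp by blast
    have "walk E x y (as @ [z] @ cs)"
      using less.prems unfolding xs walk_def
      by (auto simp: successively_append_iff hd_append successively_Cons split: if_splits)
    from less.hyps[OF _ this] show ?thesis unfolding xs by auto
  qed
qed

lemma relpow_walk:
  assumes "(x, y) \<in> R ^^ m"
  shows "\<exists>xs. walk R x y xs \<and> length xs = Suc m"
  using assms
proof (induction m arbitrary: y)
  case 0
  then show ?case by (intro exI[of _ "[x]"]) (auto simp: walk_def)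
next
  case (Suc m)
  then obtain z where "(x, z) \<in> R ^^ m" "(z, y) \<in> R" by auto
  with Suc.IH obtain xs where "walk R x z xs" "length xs = Suc m" by blast
  with \<open>(z, y) \<in> R\<close> show ?case
    by (intro exI[of _ "xs @ [y]"]) (auto simp: walk_def successively_append_iff)
qed

text \<open>Vertices of \<open>X\<close> are isolated rather than deleted, so the zero-step relation
  still relates them to themselves. This is why statements about \<open>avoid E X ^^ m\<close> ask
  separately that the start lie outside \<open>X\<close>.\<close>

definition avoid :: "('a \<times> 'a) set \<Rightarrow> 'a set \<Rightarrow> ('a \<times> 'a) set" where
  "avoid E X = {(u, v) \<in> E. u \<notin> X \<and> v \<notin> X}"

lemma sym_relpow: "sym R \<Longrightarrow> sym (R ^^ m)"
proof (induction m)
  case (Suc m)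
  then have "(R ^^ Suc m)\<inverse> = R ^^ Suc m"
    by (metis converse_relcomp relpow.simps(2) relpow_commute sym_conv_converse_eq)
  then show ?case by (simp add: sym_conv_converse_eq)
qed (auto simp: sym_def)

lemma sym_avoid: "sym E \<Longrightarrow> sym (avoid E X)"
  by (auto simp: avoid_def sym_def)

lemma walk_avoid:
  assumes "walk (avoid E X) x y xs" "x \<notin> X"
  shows "set xs \<inter> X = {}"
  using assms
proof (induction xs arbitrary: x)
  case (Cons u us)
  then show ?case
    by (cases us) (auto simp: walk_def avoid_def)
qed (auto simp: walk_def)

text \<open>At most \<open>r\<close> edges means at most \<open>Suc r\<close> vertices in the list.
  Distinct walks share at most \<open>c\<close>, so a finite set not containing \<open>c\<close>
  meets only finitely many of them; this is what makes hubs easy to connect.\<close>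

definition hub :: "('a \<times> 'a) set \<Rightarrow> nat \<Rightarrow> ('i \<Rightarrow> 'a) \<Rightarrow> 'i set \<Rightarrow> 'a \<Rightarrow> bool" where
  "hub E r g N c \<longleftrightarrow> (\<exists>f. (\<forall>i\<in>N. walk E c (g i) (f i) \<and> length (f i) \<le> Suc r) \<and>
     (\<forall>i\<in>N. \<forall>j\<in>N. i \<noteq> j \<longrightarrow> set (f i) \<inter> set (f j) \<subseteq> {c}))"

lemma hub_mono:
  assumes "hub E r g N c" "E \<subseteq> E'" "N' \<subseteq> N"
  shows "hub E' r g N' c"
proof -
  obtain f where f: "\<forall>i\<in>N. walk E c (g i) (f i) \<and> length (f i) \<le> Suc r"
    "\<forall>i\<in>N. \<forall>j\<in>N. i \<noteq> j \<longrightarrow> set (f i) \<inter> set (f j) \<subseteq> {c}"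
    using assms(1) unfolding hub_def by (elim exE conjE)
  have "\<forall>i\<in>N'. walk E' c (g i) (f i) \<and> length (f i) \<le> Suc r"
    using f(1) assms(2,3) walk_mono by (metis subsetD)
  moreover have "\<forall>i\<in>N'. \<forall>j\<in>N'. i \<noteq> j \<longrightarrow> set (f i) \<inter> set (f j) \<subseteq> {c}"
    using f(2) assms(3) by (metis subsetD)
  ultimately show ?thesis unfolding hub_def by (intro exI[of _ f] conjI)
qed

text \<open>A delta system confines all intersections of the walks to a finite set \<open>K\<close>.
  Each walk is cut at its last vertex in \<open>K\<close>; infinitely many are cut at the same
  vertex \<open>c\<close>, and their remainders meet nowhere else. That \<open>c\<close> lies on a
  given walk is recorded in order to show later that it is outside the removed set.\<close>

lemma hub_from_walks:
  assumes N: "infinite N"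
    and w: "\<And>j. j \<in> N \<Longrightarrow> walk E x (g j) (w j) \<and> length (w j) \<le> Suc r"
  shows "\<exists>c N'. infinite N' \<and> N' \<subseteq> N \<and> hub E r g N' c \<and> (\<exists>j\<in>N. c \<in> set (w j))"
proof -
  define F where "F j = set (w j)" for j
  have "finite (F j) \<and> card (F j) \<le> Suc r" if "j \<in> N" for j
    using w[OF that] card_length[of "w j"] by (auto simp: F_def)
  from delta_system[of N F, OF N this] obtain K N1 where K: "finite K" and N1: "infinite N1" "N1 \<subseteq> N"
    and "\<forall>i\<in>N1. \<forall>j\<in>N1. i \<noteq> j \<longrightarrow> F i \<inter> F j \<subseteq> K"
    by auto
  then have disj: "\<forall>i\<in>N1. \<forall>j\<in>N1. i \<noteq> j \<longrightarrow> set (w i) \<inter> set (w j) \<subseteq> K"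
    by (simp add: F_def)
  have x_in: "x \<in> set (w j)" if "j \<in> N" for j
    using w[OF that] by (auto simp: walk_def)
  \<comment> \<open>The start \<open>x\<close> is on all walks, so it lies in the intersection of
    two of them; hence every walk has a vertex in \<open>K\<close>.\<close>
  have "x \<in> K"
  proof -
    obtain i where i: "i \<in> N1" using N1(1) by fastforce
    obtain j where j: "j \<in> N1" "j \<noteq> i"
      using N1(1) by (metis finite.emptyI finite_insert finite_subset insertI1 subsetI)
    show ?thesis using disj i j x_in N1(2) by blast
  qed
  have "\<exists>c\<in>K. \<exists>pre suf. w j = pre @ c # suf \<and> (\<forall>y\<in>set suf. y \<notin> K)" if "j \<in> N1" for j
    using split_list_last_prop[of "w j" "\<lambda>c. c \<in> K"] x_in N1(2) that \<open>x \<in> K\<close> by blast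
  then have "\<forall>j\<in>N1. \<exists>c\<in>K. \<exists>pre suf. w j = pre @ c # suf \<and> (\<forall>y\<in>set suf. y \<notin> K)" by blast
  from pigeonhole_infinite_rel[OF N1(1) K this] obtain c where "c \<in> K"
    and inf: "infinite {j \<in> N1. \<exists>pre suf. w j = pre @ c # suf \<and> (\<forall>y\<in>set suf. y \<notin> K)}"
    by (elim bexE)
  define N2 where "N2 = {j \<in> N1. \<exists>pre suf. w j = pre @ c # suf \<and> (\<forall>y\<in>set suf. y \<notin> K)}"
  have inf: "infinite N2" and N21: "N2 \<subseteq> N1" using inf by (auto simp: N2_def)
  have "\<forall>j\<in>N2. \<exists>suf. (\<exists>pre. w j = pre @ c # suf) \<and> (\<forall>y\<in>set suf. y \<notin> K)"
    unfolding N2_def by blast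
  from bchoice[OF this] obtain suf
    where "\<forall>j\<in>N2. (\<exists>pre. w j = pre @ c # suf j) \<and> (\<forall>y\<in>set (suf j). y \<notin> K)" ..
  then have suf: "(\<exists>pre. w j = pre @ c # suf j) \<and> (\<forall>y\<in>set (suf j). y \<notin> K)" if "j \<in> N2" for j
    using that by (rule bspec)
  have "hub E r g N2 c"
    unfolding hub_def
  proof (intro exI[of _ "\<lambda>j. c # suf j"] conjI ballI impI)
    fix j assume j: "j \<in> N2"
    then obtain pre where pre: "w j = pre @ c # suf j" using suf by blast
    have "walk E x (g j) (w j)" "length (w j) \<le> Suc r" using w j N1 N21 by auto
    then show "walk E c (g j) (c # suf j)" "length (c # suf j) \<le> Suc r"
      unfolding pre walk_def by (auto simp: successively_append_iff)
  next
    fix i j assume ij: "i \<in> N2" "j \<in> N2" "i \<noteq> j"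
    have "set (suf i) \<subseteq> set (w i)" "set (suf j) \<subseteq> set (w j)"
      using suf[OF ij(1)] suf[OF ij(2)] by auto
    then have "set (suf i) \<inter> set (suf j) \<subseteq> K" using disj ij N21 by blast
    then show "set (c # suf i) \<inter> set (c # suf j) \<subseteq> {c}"
      using suf[OF ij(1)] suf[OF ij(2)] \<open>c \<in> K\<close> by auto
  qed
  moreover have "\<exists>j\<in>N. c \<in> set (w j)"
  proof -
    have "N2 \<noteq> {}" using inf by (metis finite.emptyI)
    then obtain j where j: "j \<in> N2" by auto
    then have "c \<in> set (w j)" using suf[OF j] by auto
    then show ?thesis using j N1(2) N21 by auto
  qed
  moreover have "N2 \<subseteq> N" using N1(2) N21 by simp
  ultimately show ?thesis using inf by (intro exI[of _ c] exI[of _ N2] conjI)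
qed

text \<open>The pairs are joined one at a time. Everything used so far is finite, so for some fresh
  index \<open>b\<close> the walks from \<open>c\<close> and from \<open>d\<close> to
  \<open>g b\<close> avoid it, and they are glued at \<open>g b\<close>. This vertex is counted
  once, which gives the bound \<open>2 * r + 1\<close>.\<close>

lemma connect_hubs:
  assumes E: "sym E" and N: "infinite N" and Y: "finite Y" "\<And>c. c \<in> Y \<Longrightarrow> hub E r g N c"
    and Q: "finite Q" "Q \<subseteq> Y \<times> Y"
  shows "\<exists>W. \<forall>q\<in>Q. walk E (fst q) (snd q) (W q) \<and> length (W q) \<le> 2 * r + 1 \<and>
     set (W q) \<inter> Y \<subseteq> {fst q, snd q} \<and> (\<forall>q'\<in>Q. q \<noteq> q' \<longrightarrow> set (W q) \<inter> set (W q') \<subseteq> Y)"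
proof -
  have "\<forall>c\<in>Y. \<exists>f. (\<forall>i\<in>N. walk E c (g i) (f i) \<and> length (f i) \<le> Suc r) \<and>
     (\<forall>i\<in>N. \<forall>j\<in>N. i \<noteq> j \<longrightarrow> set (f i) \<inter> set (f j) \<subseteq> {c})"
    using Y(2) unfolding hub_def by (rule ballI)
  from bchoice[OF this] obtain f where ff: "\<forall>c\<in>Y. (\<forall>i\<in>N. walk E c (g i) (f c i) \<and> length (f c i) \<le> Suc r) \<and>
     (\<forall>i\<in>N. \<forall>j\<in>N. i \<noteq> j \<longrightarrow> set (f c i) \<inter> set (f c j) \<subseteq> {c})" ..
  have f: "walk E c (g i) (f c i) \<and> length (f c i) \<le> Suc r" if "c \<in> Y" "i \<in> N" for c i
    using ff[rule_format, OF that(1)] that(2) by simp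
  have fd: "set (f c i) \<inter> set (f c j) \<subseteq> {c}" if "c \<in> Y" "i \<in> N" "j \<in> N" "i \<noteq> j" for c i j
    using ff[rule_format, OF that(1)] that by simp
  \<comment> \<open>A vertex other than \<open>c\<close> lies on at most one walk of the fan of
    \<open>c\<close>, so a finite set spoils only finitely many indices.\<close>
  have bad: "finite {b \<in> N. \<not> set (f c b) \<inter> U \<subseteq> {c}}" if "c \<in> Y" "finite U" for c U
  proof -
    have "finite {b \<in> N. u \<in> set (f c b)}" if "u \<noteq> c" for u
    proof (cases "{b \<in> N. u \<in> set (f c b)} = {}")
      case False
      then obtain b where "b \<in> N" "u \<in> set (f c b)" by blast
      then have "{b \<in> N. u \<in> set (f c b)} \<subseteq> {b}" using fd[OF \<open>c \<in> Y\<close>] that by blast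
      then show ?thesis using finite_subset by blast
    next
      case True
      then show ?thesis by (simp only: finite.emptyI)
    qed
    then have "finite (\<Union>u\<in>U - {c}. {b \<in> N. u \<in> set (f c b)})" using \<open>finite U\<close> by auto
    then show ?thesis by (rule rev_finite_subset) auto
  qed
  show ?thesis using Q
  proof (induction Q rule: finite_induct)
    case empty
    then show ?case by simp
  next
    case (insert q Q)
    then obtain W where W: "\<forall>q\<in>Q. walk E (fst q) (snd q) (W q) \<and> length (W q) \<le> 2 * r + 1 \<and>
     set (W q) \<inter> Y \<subseteq> {fst q, snd q} \<and> (\<forall>q'\<in>Q. q \<noteq> q' \<longrightarrow> set (W q) \<inter> set (W q') \<subseteq> Y)"
      by blast
    obtain c d where q: "q = (c, d)" "c \<in> Y" "d \<in> Y" using insert.prems by auto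
    let ?U = "Y \<union> (\<Union>q\<in>Q. set (W q))"
    have U: "finite ?U" using Y insert.hyps by auto
    have "\<not> N \<subseteq> {b \<in> N. \<not> set (f c b) \<inter> ?U \<subseteq> {c}} \<union> {b \<in> N. \<not> set (f d b) \<inter> ?U \<subseteq> {d}}"
      using N bad[OF q(2) U] bad[OF q(3) U] finite_subset by blast
    then obtain b where b: "b \<in> N" "set (f c b) \<inter> ?U \<subseteq> {c}" "set (f d b) \<inter> ?U \<subseteq> {d}"
      by blast
    define w where "w = f c b @ tl (rev (f d b))"
    have "walk E c d w"
      unfolding w_def using f[OF q(2) b(1)] f[OF q(3) b(1)] E by (auto intro: walk_append walk_rev)
    moreover have "length w \<le> 2 * r + 1"
      unfolding w_def using f[OF q(2) b(1)] f[OF q(3) b(1)] by (auto simp: walk_def)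
    moreover have "set w \<subseteq> set (f c b) \<union> set (f d b)"
      unfolding w_def by (cases "rev (f d b)") (auto simp flip: set_rev[of "f d b"])
    with b have wU: "set w \<inter> ?U \<subseteq> {c, d}" by blast
    moreover have "set w \<inter> Y \<subseteq> {c, d}" using wU by blast
    moreover have "\<forall>q'\<in>Q. set w \<inter> set (W q') \<subseteq> Y" using wU q by blast
    ultimately show ?case
      using W insert.hyps(2) q
      by (intro exI[of _ "W(q := w)"]) (auto simp: Int_commute)
  qed
qed

text \<open>Containment as a subgraph that need not be induced, matching what monotone classes are
  closed under. Only the edge relation occurs, so the notion also applies to the
  ultraproduct.\<close>

definition sd_embeds :: "nat \<Rightarrow> nat \<Rightarrow> ('a \<times> 'a) set \<Rightarrow> bool" where
  "sd_embeds p N E \<longleftrightarrow> (\<exists>h. inj_on h (verts (subdivided_clique p N)) \<and>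
     (\<forall>(u, v)\<in>edges (subdivided_clique p N). (h u, h v) \<in> E))"

lemma sd_embeds_le:
  assumes "sd_embeds p N' E" "N \<le> N'"
  shows "sd_embeds p N E"
proof -
  have "verts (subdivided_clique p N) \<subseteq> verts (subdivided_clique p N')"
    using assms(2) by (auto simp: subdivided_clique_def)
  moreover have "edges (subdivided_clique p N) \<subseteq> edges (subdivided_clique p N')"
    using assms(2) by (fastforce simp: subdivided_clique_def)
  ultimately show ?thesis using assms(1) unfolding sd_embeds_def by (meson inj_on_subset subset_iff)
qed

text \<open>Position \<open>t\<close> of the path \<open>W i j\<close> hosts the \<open>t\<close>-th
  subdivision vertex, whence the length \<open>p + 2\<close>. Inner vertices avoid \<open>Y\<close>
  and distinct paths meet only in \<open>Y\<close>, so no inner vertex is used twice.\<close>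

lemma sd_embeds_paths:
  assumes E: "sym E" and c: "inj_on c {..<N}" "c ` {..<N} \<subseteq> Y"
    and W: "\<And>i j. i < j \<Longrightarrow> j < N \<Longrightarrow> walk E (c i) (c j) (W i j) \<and> distinct (W i j) \<and> length (W i j) = p + 2
       \<and> set (W i j) \<inter> Y \<subseteq> {c i, c j}"
    and disj: "\<And>i j i' j'. i < j \<Longrightarrow> j < N \<Longrightarrow> i' < j' \<Longrightarrow> j' < N \<Longrightarrow> (i, j) \<noteq> (i', j') \<Longrightarrow>
       set (W i j) \<inter> set (W i' j') \<subseteq> Y"
  shows "sd_embeds p N E"
proof -
  define h where "h = (\<lambda>(i, j, t). if t = 0 then c i else W i j ! t)"
  have nth0: "W i j ! 0 = c i" and nthl: "W i j ! Suc p = c j" if "i < j" "j < N" for i j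
    using W[OF that] by (auto simp: walk_def hd_conv_nth last_conv_nth)
  have inner: "W i j ! t \<notin> Y" if "i < j" "j < N" "1 \<le> t" "t \<le> p" for i j t
  proof
    assume "W i j ! t \<in> Y"
    then have "W i j ! t \<in> {c i, c j}" using W[OF that(1,2)] that(4)
      by (metis (no_types, lifting) IntI add_2_eq_Suc' le_imp_less_Suc less_SucI nth_mem subset_iff)
    then have "W i j ! t = W i j ! 0 \<or> W i j ! t = W i j ! Suc p"
      using nth0[OF that(1,2)] nthl[OF that(1,2)] by auto
    then show False using W[OF that(1,2)] that(3,4) by (auto simp: nth_eq_iff_index_eq)
  qed
  have hsd: "h (sd_pt p i j t) = W i j ! t" if "i < j" "j < N" "t \<le> Suc p" for i j t
    using nth0[OF that(1,2)] nthl[OF that(1,2)] by (auto simp: h_def sd_pt_def)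
  have "inj_on h (verts (subdivided_clique p N))"
  proof (rule inj_onI)
    fix x y assume xy: "x \<in> verts (subdivided_clique p N)" "y \<in> verts (subdivided_clique p N)" "h x = h y"
    obtain i j t i' j' t' where x: "x = (i, j, t)" and y: "y = (i', j', t')" by (metis prod_cases3)
    have cY: "c i \<in> Y" if "i < N" for i using c that by auto
    consider "t = 0" "t' = 0" | "t = 0" "t' > 0" | "t > 0" "t' = 0" | "t > 0" "t' > 0" by blast
    then show "x = y"
    proof cases
      case 1
      then show ?thesis using xy c(1) unfolding x y by (auto simp: h_def subdivided_clique_def inj_on_def)
    next
      case 2
      then show ?thesis using xy cY[of i] inner[of i' j' t'] unfolding x y by (auto simp: h_def subdivided_clique_def)
    next
      case 3
      then show ?thesis using xy cY[of i'] inner[of i j t] unfolding x y by (auto simp: h_def subdivided_clique_def)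
    next
      case 4
      then have ij: "i < j" "j < N" "t \<le> p" "i' < j'" "j' < N" "t' \<le> p"
        using xy unfolding x y by (auto simp: subdivided_clique_def)
      have eq: "W i j ! t = W i' j' ! t'" using xy(3) 4 by (auto simp: h_def x y)
      have mem: "W i j ! t \<in> set (W i j)" "W i' j' ! t' \<in> set (W i' j')"
        using W ij by (auto intro!: nth_mem)
      have "(i, j) = (i', j')"
        using disj[OF ij(1,2,4,5)] mem eq inner[OF ij(1,2) _ ij(3)] 4 by fastforce
      then show ?thesis using eq W[OF ij(1,2)] ij by (auto simp: x y nth_eq_iff_index_eq)
    qed
  qed
  moreover have "(h (sd_pt p i j t), h (sd_pt p i j (Suc t))) \<in> E" if "i < j" "j < N" "t \<le> p" for i j t
  proof -
    have "successively (\<lambda>u v. (u, v) \<in> E) (W i j)" "length (W i j) = p + 2"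
      using W that by (auto simp: walk_def)
    then have "(W i j ! t, W i j ! Suc t) \<in> E" using that(3) by (auto simp: successively_conv_nth)
    then show ?thesis using hsd that by auto
  qed
  then have "\<forall>(u, v)\<in>edges (subdivided_clique p N). (h u, h v) \<in> E"
    using symD[OF E] by (fastforce simp: subdivided_clique_def)
  ultimately show ?thesis unfolding sd_embeds_def by blast
qed

text \<open>The walks connecting hubs may have different lengths. Shortened to paths they have at
  most \<open>2 * r\<close> inner vertices, and Ramsey's theorem, with this number as the colour,
  selects \<open>n\<close> hubs for which it is constant. \<open>M\<close> is chosen before the
  sequence \<open>g\<close>.\<close>

lemma many_hubs:
  assumes "sym E"
  shows "\<exists>M. \<forall>(g :: 'i \<Rightarrow> 'a) N Y. infinite N \<longrightarrow> finite Y \<longrightarrow> card Y \<ge> M \<longrightarrow> (\<forall>c\<in>Y. hub E r g N c)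
     \<longrightarrow> (\<exists>p\<le>2*r. sd_embeds p n E)"
proof -
  obtain M :: nat where M: "partn_lst {..<M} (replicate (Suc (2 * r)) n) 2"
    using ramsey_full[of "replicate (Suc (2 * r)) n" 2] by blast
  have "\<exists>p\<le>2*r. sd_embeds p n E"
    if *: "infinite N" "finite Y" "card Y \<ge> M" "\<forall>c\<in>Y. hub E r g N c" for g :: "'i \<Rightarrow> 'a" and N Y
  proof -
    obtain Y0 where Y0: "Y0 \<subseteq> Y" "card Y0 = M" using *(3) by (meson obtain_subset_with_card_n)
    have finY0: "finite Y0" using Y0 *(2) finite_subset by blast
    then obtain e where e: "bij_betw e {..<M} Y0"
      using Y0 by (metis ex_bij_betw_nat_finite atLeast0LessThan)
    define Q where "Q = (\<lambda>(i, j). (e i, e j)) ` {(i, j). i < j \<and> j < M}"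
    have "finite {(i, j). i < j \<and> j < M}" by (rule finite_subset[of _ "{..<M} \<times> {..<M}"]) auto
    then have "finite Q" unfolding Q_def by auto
    moreover have "Q \<subseteq> Y0 \<times> Y0" using e by (auto simp: Q_def bij_betw_def)
    ultimately obtain W where W: "\<forall>q\<in>Q. walk E (fst q) (snd q) (W q) \<and> length (W q) \<le> 2 * r + 1 \<and>
     set (W q) \<inter> Y0 \<subseteq> {fst q, snd q} \<and> (\<forall>q'\<in>Q. q \<noteq> q' \<longrightarrow> set (W q) \<inter> set (W q') \<subseteq> Y0)"
      using connect_hubs[OF assms *(1) finY0, of r g Q] *(4) Y0(1) by blast
    \<comment> \<open>Passing to paths keeps the walks disjoint outside the hubs, because vertex
      sets only shrink.\<close>
    have "\<forall>q\<in>Q. \<exists>ys. walk E (fst q) (snd q) ys \<and> distinct ys \<and> set ys \<subseteq> set (W q) \<and> length ys \<le> length (W q)"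
      using W walk_distinct by metis
    then obtain P where P: "\<And>q. q \<in> Q \<Longrightarrow> walk E (fst q) (snd q) (P q) \<and> distinct (P q) \<and> set (P q) \<subseteq> set (W q) \<and> length (P q) \<le> length (W q)"
      by metis
    define V where "V i j = P (e i, e j)" for i j
    have inQ: "(e i, e j) \<in> Q" if "i < j" "j < M" for i j using that by (auto simp: Q_def)
    have Vlen: "length (V i j) \<ge> 2" "length (V i j) \<le> 2 * r + 2" if "i < j" "j < M" for i j
    proof -
      have "e i \<noteq> e j" using e that by (auto simp: bij_betw_def inj_on_def)
      moreover have "walk E (e i) (e j) (V i j)" using P[OF inQ[OF that]] by (auto simp: V_def)
      ultimately show "length (V i j) \<ge> 2"
        unfolding walk_def by (cases "V i j"; cases "tl (V i j)") auto
      show "length (V i j) \<le> 2 * r + 2" using P[OF inQ[OF that]] W inQ[OF that] by (fastforce simp: V_def)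
    qed
    define col where "col X = length (V (Min X) (Max X)) - 2" for X
    have "col \<in> nsets {..<M} 2 \<rightarrow> {..<Suc (2 * r)}"
    proof
      fix X assume "X \<in> nsets {..<M} 2"
      then obtain i j where X: "X = {i, j}" "i < M" "j < M" "i \<noteq> j" by (auto elim: nsets2_E)
      then have "Min X < Max X" "Max X < M" by auto
      from Vlen[OF this] show "col X \<in> {..<Suc (2 * r)}" by (auto simp: col_def)
    qed
    then obtain p H where p: "p < Suc (2 * r)" "H \<in> nsets {..<M} n" "col ` nsets H 2 \<subseteq> {p}"
      using partn_lstE[OF M] by (metis length_replicate nth_replicate)
    have H: "finite H" "card H = n" "H \<subseteq> {..<M}" using p(2) by (auto simp: nsets_def)
    then obtain s where s: "bij_betw s {0..<n} H" "strict_mono_on {0..<n} s"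
      using ex_bij_betw_strict_mono_card[of H] by (metis atLeast0LessThan)
    have sl: "s i < s j" "s j < M" if "i < j" "j < n" for i j
      using s that H(3) by (auto simp: strict_mono_on_def bij_betw_def image_subset_iff)
    have "sd_embeds p n E"
    proof (rule sd_embeds_paths[where c = "e \<circ> s" and W = "\<lambda>i j. V (s i) (s j)" and Y = Y0])
      show "sym E" by fact
      have s': "inj_on s {..<n}" "s ` {..<n} = H" using s(1) by (auto simp: bij_betw_def atLeast0LessThan)
      show "inj_on (e \<circ> s) {..<n}"
        using s' e H(3) by (auto simp: bij_betw_def intro!: comp_inj_on intro: inj_on_subset)
      show "(e \<circ> s) ` {..<n} \<subseteq> Y0"
        using s' e H(3) by (auto simp: bij_betw_def)
      fix i j assume ij: "i < j" "j < n"
      note sij = sl[OF ij]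
      have "{s i, s j} \<in> nsets H 2" using s' ij sij by auto
      then have "col {s i, s j} = p" using p(3) by blast
      then have "length (V (s i) (s j)) = p + 2"
        using sij Vlen[OF sij] by (auto simp: col_def)
      then show "walk E ((e \<circ> s) i) ((e \<circ> s) j) (V (s i) (s j)) \<and> distinct (V (s i) (s j)) \<and>
        length (V (s i) (s j)) = p + 2 \<and> set (V (s i) (s j)) \<inter> Y0 \<subseteq> {(e \<circ> s) i, (e \<circ> s) j}"
        using P[OF inQ[OF sij]] W inQ[OF sij] by (fastforce simp: V_def)
      fix i' j' assume ij': "i' < j'" "j' < n" "(i, j) \<noteq> (i', j')"
      note sij' = sl[OF ij'(1,2)]
      have "(e (s i), e (s j)) \<noteq> (e (s i'), e (s j'))"
        using ij ij' s' e sij sij' H(3) by (auto simp: bij_betw_def inj_on_def)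
      then show "set (V (s i) (s j)) \<inter> set (V (s i') (s j')) \<subseteq> Y0"
        using P[OF inQ[OF sij]] P[OF inQ[OF sij']] W inQ[OF sij] inQ[OF sij'] unfolding V_def by blast
    qed
    then show ?thesis using p(1) by (metis less_Suc_eq_le)
  qed
  then show ?thesis by blast
qed

text \<open>A set \<open>X\<close> of hubs of maximal size is removed; sizes are bounded because
  each coordinate \<open>l < k\<close> has fewer than \<open>M\<close> hubs. If infinitely many
  tuples were still pairwise close, short walks from one entry of a fixed tuple would reach a fixed
  coordinate of infinitely many others, and these walks would yield a further hub outside
  \<open>X\<close>.\<close>

theorem quasi_wide:
  fixes E :: "('a \<times> 'a) set" and a :: "nat \<Rightarrow> nat \<Rightarrow> 'a"
  assumes E: "sym E" and nd: "\<And>p. \<exists>N. \<not> sd_embeds p N E" and I: "infinite I"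
  shows "\<exists>X I'. finite X \<and> infinite I' \<and> I' \<subseteq> I \<and>
    (\<forall>i\<in>I'. \<forall>j\<in>I'. \<forall>l<k. \<forall>l'<k. \<forall>m\<le>r. i \<noteq> j \<longrightarrow> a i l \<notin> X \<longrightarrow> a j l' \<notin> X \<longrightarrow> (a i l, a j l') \<notin> (avoid E X) ^^ m)"
proof -
  obtain n where n: "\<And>p. \<not> sd_embeds p (n p) E" using nd by metis
  \<comment> \<open>Connecting hubs only produces values of \<open>p\<close> up to
    \<open>2 * r\<close>, so finitely many exclusions matter and one bound serves them all.\<close>
  define n0 where "n0 = Max (n ` {..2 * r})"
  have n0: "\<not> sd_embeds p n0 E" if "p \<le> 2 * r" for p
    using n[of p] sd_embeds_le[of p n0 E "n p"] that by (auto simp: n0_def)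
  obtain M where M: "\<And>(g :: nat \<Rightarrow> 'a) N Y. infinite N \<Longrightarrow> finite Y \<Longrightarrow> \<forall>c\<in>Y. hub E r g N c \<Longrightarrow> card Y < M"
    using many_hubs[OF E, where 'i = nat, of r n0] n0 by (meson not_le)
  \<comment> \<open>One infinite set \<open>N\<close> must serve all members of \<open>X\<close>,
    but each may be a hub for a coordinate of its own. An infinite subset of \<open>N\<close> serves
    as well, so a new hub found for a subsequence can be added.\<close>
  define good where "good X \<longleftrightarrow> finite X \<and> (\<exists>N. infinite N \<and> N \<subseteq> I \<and> (\<forall>c\<in>X. \<exists>l<k. hub E r (\<lambda>i. a i l) N c))" for X
  have bound: "card X \<le> k * M" if "good X" for X
  proof -
    obtain N where N: "infinite N" "N \<subseteq> I" "\<forall>c\<in>X. \<exists>l<k. hub E r (\<lambda>i. a i l) N c" and finX: "finite X"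
      using \<open>good X\<close> unfolding good_def by blast
    have "X \<subseteq> (\<Union>l<k. {c \<in> X. hub E r (\<lambda>i. a i l) N c})" using N(3) by blast
    then have "card X \<le> card (\<Union>l<k. {c \<in> X. hub E r (\<lambda>i. a i l) N c})"
      using finX by (intro card_mono) auto
    also have "\<dots> \<le> (\<Sum>l<k. card {c \<in> X. hub E r (\<lambda>i. a i l) N c})"
      by (rule card_UN_le) auto
    also have "\<dots> \<le> (\<Sum>l<k. M)"
      using finX N(1) by (intro sum_mono less_imp_le M) auto
    finally show ?thesis by simp
  qed
  have "good {}" using I unfolding good_def by auto
  then obtain X where X: "good X" "\<And>Y. good Y \<Longrightarrow> card Y \<le> card X"
    using ex_has_greatest_nat[of good "{}" card "Suc (k * M)"] bound by (metis le_imp_less_Suc)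
  obtain N where N: "infinite N" "N \<subseteq> I" "\<forall>c\<in>X. \<exists>l<k. hub E r (\<lambda>i. a i l) N c" and finX: "finite X"
    using X(1) unfolding good_def by blast
  let ?E = "avoid E X"
  define near where "near l l' i j \<longleftrightarrow> (\<exists>m\<le>r. a i l \<notin> X \<and> a j l' \<notin> X \<and> (a i l, a j l') \<in> ?E ^^ m)" for l l' i j
  define close where "close i j \<longleftrightarrow> (\<exists>l<k. \<exists>l'<k. near l l' i j)" for i j
  have close_sym: "close j i" if "close i j" for i j
    using that    unfolding close_def near_def using sym_relpow[OF sym_avoid[OF E]] by (meson symD)
  obtain N1 where N1: "N1 \<subseteq> N" "infinite N1"
    "(\<forall>i\<in>N1. \<forall>j\<in>N1. i \<noteq> j \<longrightarrow> close i j) \<or> (\<forall>i\<in>N1. \<forall>j\<in>N1. i \<noteq> j \<longrightarrow> \<not> close i j)"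
    by (rule infinite_pairs_dichotomy[of N close, OF N(1) close_sym])
  show ?thesis
  proof (cases "\<forall>i\<in>N1. \<forall>j\<in>N1. i \<noteq> j \<longrightarrow> \<not> close i j")
    case True
    then show ?thesis
    proof (intro exI conjI ballI allI impI)
      show "finite X" "infinite N1" "N1 \<subseteq> I" using finX N1 N(2) by auto
      fix i j l l' m
      assume *: "i \<in> N1" "j \<in> N1" "l < k" "l' < k" "m \<le> r" "i \<noteq> j" "a i l \<notin> X" "a j l' \<notin> X"
      with True have "\<not> close i j" by blast
      with * show "(a i l, a j l') \<notin> ?E ^^ m" unfolding close_def near_def by blast
    qed
  next
    case False
    have cl: "\<forall>i\<in>N1. \<forall>j\<in>N1. i \<noteq> j \<longrightarrow> close i j"
      by (rule disjE[OF N1(3)]) (assumption, rule notE[OF False])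
    define i0 where "i0 = (SOME i. i \<in> N1)"
    have "N1 \<noteq> {}" using N1(2) by auto
    then have i0: "i0 \<in> N1" unfolding i0_def by (simp add: some_in_eq)
    have "\<exists>l<k. \<exists>l'<k. near l l' i0 j" if "j \<in> N1 - {i0}" for j
    proof -
      have "j \<in> N1" "i0 \<noteq> j" using that by auto
      from cl[rule_format, OF i0 this] show ?thesis unfolding close_def .
    qed
    then have "\<forall>j\<in>N1 - {i0}. \<exists>l\<in>{..<k}. \<exists>l'<k. near l l' i0 j" by (metis lessThan_iff)
    from pigeonhole_infinite_rel[OF _ finite_lessThan this] N1(2)
    obtain l where "l \<in> {..<k}" and l_inf: "infinite {j \<in> N1 - {i0}. \<exists>l'<k. near l l' i0 j}"
      by (auto elim!: bexE)
    then have l: "l < k" by simp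
    have "\<forall>j\<in>{j \<in> N1 - {i0}. \<exists>l'<k. near l l' i0 j}. \<exists>l'\<in>{..<k}. near l l' i0 j" by auto
    from pigeonhole_infinite_rel[OF l_inf finite_lessThan this]
    obtain l' where "l' \<in> {..<k}"
      and l'_inf: "infinite {j \<in> {j \<in> N1 - {i0}. \<exists>l'<k. near l l' i0 j}. near l l' i0 j}"
      by (elim bexE)
    then have ll: "l < k" "l' < k" using l by auto
    define N2 where "N2 = {j \<in> N1 - {i0}. near l l' i0 j}"
    have inf: "infinite N2" by (rule infinite_super[OF _ l'_inf]) (auto simp: N2_def)
    have P: "\<exists>m\<le>r. a i0 l \<notin> X \<and> a j l' \<notin> X \<and> (a i0 l, a j l') \<in> ?E ^^ m" if "j \<in> N2" for j
      using that unfolding N2_def near_def by simp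
    have "\<exists>w. walk ?E (a i0 l) (a j l') w \<and> length w \<le> Suc r" if "j \<in> N2" for j
    proof -
      obtain m where m: "m \<le> r" "(a i0 l, a j l') \<in> ?E ^^ m" using P[OF \<open>j \<in> N2\<close>] by blast
      from relpow_walk[OF m(2)] m(1) show ?thesis by auto
    qed
    then obtain w where w: "\<And>j. j \<in> N2 \<Longrightarrow> walk ?E (a i0 l) (a j l') (w j) \<and> length (w j) \<le> Suc r"
      by metis
    obtain c N3 where c: "infinite N3" "N3 \<subseteq> N2" "hub ?E r (\<lambda>j. a j l') N3 c" "\<exists>j\<in>N2. c \<in> set (w j)"
      using hub_from_walks[where g = "\<lambda>j. a j l'" and w = w, OF inf w] by blast
    \<comment> \<open>The walks run in the graph without \<open>X\<close> and start outside
      \<open>X\<close>.\<close>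
    have "c \<notin> X"
    proof -
      obtain j where j: "j \<in> N2" "c \<in> set (w j)" using c(4) by blast
      from P[OF j(1)] have "a i0 l \<notin> X" by blast
      from walk_avoid[OF _ this] w[OF j(1)] j(2) show ?thesis by blast
    qed
    have "N3 \<subseteq> N" using subset_trans[OF c(2)] N1(1) by (auto simp: N2_def)
    moreover have "?E \<subseteq> E" by (auto simp: avoid_def)
    ultimately have "hub E r (\<lambda>j. a j l') N3 c" "\<forall>c\<in>X. \<exists>l<k. hub E r (\<lambda>i. a i l) N3 c"
      using hub_mono[OF c(3), of E N3] N(3) hub_mono[of E r _ N _ E N3] by blast+
    then have "\<forall>c\<in>insert c X. \<exists>l<k. hub E r (\<lambda>i. a i l) N3 c" using ll(2) by blast
    then have "good (insert c X)"
      unfolding good_def using finX c(1) N(2) \<open>N3 \<subseteq> N\<close> by blast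
    from X(2)[OF this] show ?thesis using \<open>c \<notin> X\<close> finX by simp
  qed
qed

section \<open>A swapping game\<close>

fun qr :: "fo \<Rightarrow> nat" where
  "qr Tru = 0"
| "qr (Eq x y) = 0"
| "qr (Adj x y) = 0"
| "qr (Neg \<phi>) = qr \<phi>"
| "qr (Conj \<phi> \<psi>) = max (qr \<phi>) (qr \<psi>)"
| "qr (Ex x \<phi>) = Suc (qr \<phi>)"

text \<open>\<open>a i\<close> is the \<open>i\<close>-th tuple with entries \<open>l < k\<close>,
  \<open>S\<close> the finite removed set, and \<open>R\<close> the radius up to which the game
  looks. Vertices of \<open>S\<close> are never moved, so only adjacency to them has to be
  remembered.\<close>

locale swap_game =
  fixes G :: "'a graph" and S :: "'a set" and a :: "nat \<Rightarrow> nat \<Rightarrow> 'a" and k R :: nat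
  assumes sym_E: "sym (edges G)" and finite_S: "finite S"
begin

definition reach :: "nat \<Rightarrow> nat \<Rightarrow> 'a \<Rightarrow> bool" where
  "reach i m v \<longleftrightarrow> (\<exists>l<k. \<exists>m'\<le>m. a i l \<notin> S \<and> (a i l, v) \<in> avoid (edges G) S ^^ m')"

definition near :: "nat \<Rightarrow> 'a set" where
  "near i = {v \<in> verts G. v \<notin> S \<and> reach i R v}"

text \<open>Reachability is recorded only up to \<open>R\<close> and adjacency only to the finite
  set \<open>S\<close>, so there are finitely many labels.\<close>

definition lab :: "nat \<Rightarrow> 'a \<Rightarrow> nat set \<times> 'a set" where
  "lab i v = ({m. m \<le> R \<and> reach i m v}, {s \<in> S. (v, s) \<in> edges G})"

text \<open>The requirement on two assignments \<open>u -> v\<close> and \<open>u' -> v'\<close> to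
  belong to one partial isomorphism.\<close>

definition compat :: "'a \<Rightarrow> 'a \<Rightarrow> 'a \<Rightarrow> 'a \<Rightarrow> bool" where
  "compat u v u' v' \<longleftrightarrow> (u = u' \<longleftrightarrow> v = v') \<and> ((u, u') \<in> edges G \<longleftrightarrow> (v, v') \<in> edges G)"

text \<open>The duplicator can play \<open>j\<close> further rounds between the surroundings of
  tuples \<open>i\<close> and \<open>i'\<close>, with all moves inside \<open>near i\<close> and
  \<open>near i'\<close>. The conjunct of rank \<open>j\<close> makes the relation decrease with the
  rank.\<close>

primrec eqv :: "nat \<Rightarrow> nat \<Rightarrow> 'a list \<Rightarrow> nat \<Rightarrow> 'a list \<Rightarrow> bool" where
  "eqv 0 i us i' vs \<longleftrightarrow> length us = length vs \<and> (\<forall>m<length us. lab i (us ! m) = lab i' (vs ! m)) \<and>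
     (\<forall>m<length us. \<forall>m'<length us. compat (us ! m) (vs ! m) (us ! m') (vs ! m'))"
| "eqv (Suc j) i us i' vs \<longleftrightarrow> eqv j i us i' vs \<and>
     (\<forall>c\<in>near i. \<exists>c'\<in>near i'. eqv j i (us @ [c]) i' (vs @ [c'])) \<and>
     (\<forall>c'\<in>near i'. \<exists>c\<in>near i. eqv j i (us @ [c]) i' (vs @ [c']))"

lemma compat_commute: "compat u v u' v' \<longleftrightarrow> compat u' v' u v"
  unfolding compat_def using symD[OF sym_E] by metis

lemma compat_swap: "compat u v u' v' \<longleftrightarrow> compat v u v' u'"
  unfolding compat_def by metis

lemma eqv_sym: "eqv j i us i' vs \<Longrightarrow> eqv j i' vs i us"
proof (induction j arbitrary: us vs)
  case 0
  then show ?case by (auto simp: compat_swap)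
next
  case (Suc j)
  from Suc.prems have 1: "eqv j i' vs i us" by (auto intro: Suc.IH)
  have 2: "\<exists>c'\<in>near i. eqv j i' (vs @ [c]) i (us @ [c'])" if "c \<in> near i'" for c
    using Suc.prems that Suc.IH by fastforce
  have 3: "\<exists>c\<in>near i'. eqv j i' (vs @ [c]) i (us @ [c'])" if "c' \<in> near i" for c'
    using Suc.prems that Suc.IH by fastforce
  show ?case using 1 2 3 by simp
qed

lemma eqv_0: "eqv j i us i' vs \<Longrightarrow> eqv 0 i us i' vs"
  by (induction j arbitrary: us vs) simp_all

text \<open>A type of rank \<open>Suc j\<close> is determined by the type of rank \<open>j\<close>
  and the set of rank \<open>j\<close> types of extensions by one point, both from finite ranges.
  Types are coded by natural numbers so that the induction stays within one HOL type.\<close>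

lemma eqv_finite_index:
  "\<exists>f :: nat \<Rightarrow> 'a list \<Rightarrow> nat. finite (case_prod f ` {(i, us). length us = n}) \<and>
     (\<forall>i us i' vs. length us = n \<longrightarrow> length vs = n \<longrightarrow> f i us = f i' vs \<longrightarrow> eqv j i us i' vs)"
proof (induction j arbitrary: n)
  case 0
  define h where "h i us = (map (lab i) us, {(m, m'). m < n \<and> m' < n \<and> us ! m = us ! m'},
    {(m, m'). m < n \<and> m' < n \<and> (us ! m, us ! m') \<in> edges G})" for i us
  define T where "T = {xs. set xs \<subseteq> Pow {..R} \<times> Pow S \<and> length xs = n} \<times>
    Pow ({..<n} \<times> {..<n}) \<times> Pow ({..<n} \<times> {..<n})"
  have "finite {xs. set xs \<subseteq> Pow {..R} \<times> Pow S \<and> length xs = n}"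
    by (rule finite_lists_length_eq) (simp add: finite_S)
  then have "finite T" unfolding T_def by (intro finite_cartesian_product) auto
  then obtain e :: "_ \<Rightarrow> nat" where e: "inj_on e T"
    using finite_imp_inj_to_nat_seg by blast
  have hT: "h i us \<in> T" if "length us = n" for i us
    using that unfolding h_def T_def lab_def by auto
  show ?case
  proof (intro exI[of _ "\<lambda>i us. e (h i us)"] conjI allI impI)
    show "finite ((\<lambda>(i, us). e (h i us)) ` {(i, us). length us = n})"
      by (rule finite_subset[of _ "e ` T"]) (use hT \<open>finite T\<close> in auto)
    fix i us i' vs
    assume len: "length us = n" "length vs = n" and "e (h i us) = e (h i' vs)"
    then have "h i us = h i' vs" using e hT by (auto dest: inj_onD)
    then have 1: "map (lab i) us = map (lab i') vs"
      and 2: "{(m, m'). m < n \<and> m' < n \<and> us ! m = us ! m'} = {(m, m'). m < n \<and> m' < n \<and> vs ! m = vs ! m'}"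
      and 3: "{(m, m'). m < n \<and> m' < n \<and> (us ! m, us ! m') \<in> edges G} = {(m, m'). m < n \<and> m' < n \<and> (vs ! m, vs ! m') \<in> edges G}"
      unfolding h_def by simp_all
    have "lab i (us ! m) = lab i' (vs ! m)" if "m < n" for m
      using 1 len that by (metis nth_map)
    moreover have "compat (us ! m) (vs ! m) (us ! m') (vs ! m')" if "m < n" "m' < n" for m m'
      using eqset_imp_iff[OF 2, of "(m, m')"] eqset_imp_iff[OF 3, of "(m, m')"] that by (simp add: compat_def)
    ultimately show "eqv 0 i us i' vs" using len by simp
  qed
next
  case (Suc j)
  obtain f1 :: "nat \<Rightarrow> 'a list \<Rightarrow> nat" where f1: "finite (case_prod f1 ` {(i, us). length us = n})"
    and e1: "\<And>i us i' vs. length us = n \<Longrightarrow> length vs = n \<Longrightarrow> f1 i us = f1 i' vs \<Longrightarrow> eqv j i us i' vs"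
    using Suc.IH[of n] by (elim exE conjE) simp
  obtain f2 :: "nat \<Rightarrow> 'a list \<Rightarrow> nat" where f2: "finite (case_prod f2 ` {(i, us). length us = Suc n})"
    and e2: "\<And>i us i' vs. length us = Suc n \<Longrightarrow> length vs = Suc n \<Longrightarrow> f2 i us = f2 i' vs \<Longrightarrow> eqv j i us i' vs"
    using Suc.IH[of "Suc n"] by (elim exE conjE) simp
  define F1 where "F1 = case_prod f1 ` {(i, us). length us = n}"
  define F2 where "F2 = case_prod f2 ` {(i, us). length us = Suc n}"
  define g where "g i us = (\<lambda>c. f2 i (us @ [c])) ` near i" for i us
  define f where "f i us = prod_encode (f1 i us, set_encode (g i us))" for i us
  have gF: "g i us \<subseteq> F2" if "length us = n" for i us
    using that unfolding g_def F2_def by force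
  have fin: "finite F1" "finite F2" using f1 f2 by (simp_all add: F1_def F2_def)
  show ?case
  proof (intro exI[of _ f] conjI allI impI)
    have "f i us \<in> prod_encode ` (F1 \<times> set_encode ` Pow F2)" if "length us = n" for i us
      using gF[OF that, of i] that unfolding f_def F1_def by (intro imageI) force
    then have "case_prod f ` {(i, us). length us = n} \<subseteq> prod_encode ` (F1 \<times> set_encode ` Pow F2)"
      by auto
    then show "finite (case_prod f ` {(i, us). length us = n})"
      by (rule finite_subset) (use fin in auto)
    fix i us i' vs
    assume len: "length us = n" "length vs = n" and "f i us = f i' vs"
    then have eq: "f1 i us = f1 i' vs" "set_encode (g i us) = set_encode (g i' vs)"
      by (auto simp: f_def)
    have "finite (g i us)" "finite (g i' vs)" using gF len fin(2) finite_subset by blast+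
    then have g: "g i us = g i' vs" using eq(2) by (metis set_encode_inverse)
    have "\<exists>c'\<in>near i'. eqv j i (us @ [c]) i' (vs @ [c'])" if "c \<in> near i" for c
    proof -
      have "f2 i (us @ [c]) \<in> g i' vs" using that g by (auto simp: g_def)
      then obtain c' where "c' \<in> near i'" "f2 i (us @ [c]) = f2 i' (vs @ [c'])"
        by (auto simp: g_def)
      then show ?thesis using e2[of "us @ [c]" "vs @ [c']"] len by auto
    qed
    moreover have "\<exists>c\<in>near i. eqv j i (us @ [c]) i' (vs @ [c'])" if "c' \<in> near i'" for c'
    proof -
      have "f2 i' (vs @ [c']) \<in> g i us" using that g by (auto simp: g_def)
      then obtain c where "c \<in> near i" "f2 i (us @ [c]) = f2 i' (vs @ [c'])"
        by (auto simp: g_def)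
      then show ?thesis using e2[of "us @ [c]" "vs @ [c']"] len by auto
    qed
    ultimately show "eqv (Suc j) i us i' vs" using e1[OF len eq(1)] by simp
  qed
qed

lemma reach_mono: "reach i m v \<Longrightarrow> m \<le> m' \<Longrightarrow> reach i m' v"
  unfolding reach_def by (meson le_trans)

lemma reach_step:
  assumes "reach i m u" "(u, v) \<in> edges G" "u \<notin> S" "v \<notin> S"
  shows "reach i (Suc m) v"
proof -
  obtain l m' where l: "l < k" "m' \<le> m" "a i l \<notin> S" "(a i l, u) \<in> avoid (edges G) S ^^ m'"
    using assms(1) unfolding reach_def by auto
  moreover have "(u, v) \<in> avoid (edges G) S" using assms by (auto simp: avoid_def)
  ultimately have "(a i l, v) \<in> avoid (edges G) S ^^ Suc m'" by auto
  then show ?thesis using l unfolding reach_def by (intro exI[of _ l] conjI exI[of _ "Suc m'"]) auto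
qed

text \<open>The bound \<open>2 * R + 1\<close> makes the balls of radius \<open>R\<close> around the
  two tuples disjoint and leaves no edge between them.\<close>

definition far :: "nat \<Rightarrow> nat \<Rightarrow> bool" where
  "far i i' \<longleftrightarrow> (\<forall>l<k. \<forall>l'<k. \<forall>m\<le>2 * R + 1. a i l \<notin> S \<longrightarrow> a i' l' \<notin> S \<longrightarrow>
     (a i l, a i' l') \<notin> avoid (edges G) S ^^ m)"

lemma far_reach:
  assumes "far i i'" "reach i m u" "reach i' m' u" "m + m' \<le> 2 * R + 1"
  shows False
proof -
  let ?E = "avoid (edges G) S"
  obtain l n where l: "l < k" "n \<le> m" "a i l \<notin> S" "(a i l, u) \<in> ?E ^^ n"
    using assms(2) unfolding reach_def by auto
  obtain l' n' where l': "l' < k" "n' \<le> m'" "a i' l' \<notin> S" "(a i' l', u) \<in> ?E ^^ n'"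
    using assms(3) unfolding reach_def by auto
  have "(u, a i' l') \<in> ?E ^^ n'"
    using sym_relpow[OF sym_avoid[OF sym_E]] l'(4) by (rule symD)
  then have "(a i l, a i' l') \<in> ?E ^^ (n + n')"
    using l(4) by (auto simp: relpow_add)
  moreover have "n + n' \<le> 2 * R + 1" using l(2) l'(2) assms(4) by auto
  ultimately show False using assms(1) l l' unfolding far_def by blast
qed

lemma eqv_label:
  assumes "eqv 0 i us i' vs" "m < length us"
  shows "n \<le> R \<Longrightarrow> reach i n (us ! m) \<longleftrightarrow> reach i' n (vs ! m)"
    and "s \<in> S \<Longrightarrow> (us ! m, s) \<in> edges G \<longleftrightarrow> (vs ! m, s) \<in> edges G"
proof -
  have "lab i (us ! m) = lab i' (vs ! m)" using assms by simp
  then have "{n. n \<le> R \<and> reach i n (us ! m)} = {n. n \<le> R \<and> reach i' n (vs ! m)}"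
    "{s \<in> S. (us ! m, s) \<in> edges G} = {s \<in> S. (vs ! m, s) \<in> edges G}"
    unfolding lab_def by simp_all
  then show "n \<le> R \<Longrightarrow> reach i n (us ! m) \<longleftrightarrow> reach i' n (vs ! m)"
    "s \<in> S \<Longrightarrow> (us ! m, s) \<in> edges G \<longleftrightarrow> (vs ! m, s) \<in> edges G"
    by (metis (mono_tags, lifting) mem_Collect_eq)+
qed

definition fixed :: "nat \<Rightarrow> nat \<Rightarrow> nat \<Rightarrow> 'a \<Rightarrow> bool" where
  "fixed hi i i' w \<longleftrightarrow> w \<in> S \<or> \<not> reach i hi w \<and> \<not> reach i' hi w"

text \<open>A moved vertex is within \<open>lo\<close>, a fixed one outside \<open>S\<close> is not
  within \<open>hi\<close>; an edge would bring the latter within \<open>lo + 1\<close>, which is at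
  most \<open>hi\<close>. Adjacency to \<open>S\<close> is part of the label.\<close>

lemma compat_moved_fixed:
  assumes "eqv 0 i us i' vs" "m < length us" "reach i lo (us ! m)" "us ! m \<notin> S" "vs ! m \<notin> S"
    and "lo < hi" "hi \<le> R" "fixed hi i i' w"
  shows "compat (us ! m) (vs ! m) w w"
proof (cases "w \<in> S")
  case True
  then show ?thesis using assms eqv_label[OF assms(1,2)] by (auto simp: compat_def)
next
  case False
  have 1: "reach i' lo (vs ! m)" using eqv_label(1)[OF assms(1,2), of lo] assms(3,6,7) by simp
  have w: "\<not> reach i hi w" "\<not> reach i' hi w" using assms(8) False by (auto simp: fixed_def)
  have "us ! m \<noteq> w" "vs ! m \<noteq> w"
    using w 1 assms(3,6) reach_mono by (meson less_imp_le)+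
  moreover have "(us ! m, w) \<notin> edges G" "(vs ! m, w) \<notin> edges G"
    using w reach_step[OF assms(3) _ assms(4) False] reach_step[OF 1 _ assms(5) False] assms(6) reach_mono
    by (meson Suc_leI)+
  ultimately show ?thesis by (simp add: compat_def)
qed

text \<open>\<open>u\<close> moves from tuple \<open>i\<close> to \<open>i'\<close> and
  \<open>u'\<close> the other way. Before and after, the two vertices lie around different tuples,
  hence are distinct and not adjacent.\<close>

lemma compat_moved_moved:
  assumes "far i i'" "reach i R u" "reach i' R v" "reach i' R u'" "reach i R v'"
    and "u \<notin> S" "v \<notin> S" "u' \<notin> S" "v' \<notin> S"
  shows "compat u v u' v'"
proof -
  have "u \<noteq> u'" using far_reach[OF assms(1,2), of R] assms(4) by auto
  moreover have "v \<noteq> v'" using far_reach[OF assms(1,5), of R] assms(3) by auto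
  moreover have "(u, u') \<notin> edges G"
    using far_reach[OF assms(1) reach_step[OF assms(2)], of u' R] assms by auto
  moreover have "(v, v') \<notin> edges G"
    using far_reach[OF assms(1) reach_step[OF assms(5)], of v R] assms symD[OF sym_E] by auto
  ultimately show ?thesis by (simp add: compat_def)
qed

text \<open>The duplicator swaps the surroundings of the tuples \<open>i\<close> and \<open>i'\<close> and fixes everything
  else; the gap between \<open>lo\<close> and \<open>hi\<close> halves in each round.\<close>
definition Inv where
  "Inv j lo hi i i' us vs us' vs' X \<sigma> \<tau> \<longleftrightarrow> lo + 2 ^ j \<le> hi \<and> hi \<le> R \<and>
     eqv j i us i' vs \<and> eqv j i' us' i vs' \<and>
     (\<forall>u\<in>set us. reach i lo u) \<and> (\<forall>u\<in>set us'. reach i' lo u) \<and>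
     (set us \<union> set vs \<union> set us' \<union> set vs') \<inter> S = {} \<and>
     (\<forall>x\<in>X. (\<exists>m<length us. \<sigma> x = us ! m \<and> \<tau> x = vs ! m) \<or>
        (\<exists>m<length us'. \<sigma> x = us' ! m \<and> \<tau> x = vs' ! m) \<or>
        \<sigma> x = \<tau> x \<and> fixed hi i i' (\<sigma> x))"

lemma eqv_reach_all:
  assumes "eqv j i us i' vs" "\<forall>u\<in>set us. reach i lo u" "lo \<le> R"
  shows "length us = length vs" "\<forall>v\<in>set vs. reach i' lo v"
proof -
  have 0: "eqv 0 i us i' vs" using assms(1) by (rule eqv_0)
  then show len: "length us = length vs" by simp
  show "\<forall>v\<in>set vs. reach i' lo v"
  proof
    fix v assume "v \<in> set vs"
    then obtain m where "m < length us" "v = vs ! m" using len by (metis in_set_conv_nth)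
    then show "reach i' lo v" using eqv_label(1)[OF 0, of m lo] assms(2,3) by auto
  qed
qed

lemma fixed_commute: "fixed hi i i' w = fixed hi i' i w"
  by (auto simp: fixed_def)

text \<open>Reduces moves around \<open>i'\<close> to moves around \<open>i\<close>.\<close>

lemma Inv_roles:
  assumes "Inv j lo hi i i' us vs us' vs' X \<sigma> \<tau>"
  shows "Inv j lo hi i' i us' vs' us vs X \<sigma> \<tau>"
proof -
  have "(set us \<union> set vs \<union> set us' \<union> set vs') \<inter> S = (set us' \<union> set vs' \<union> set us \<union> set vs) \<inter> S" by blast
  then show ?thesis using assms unfolding Inv_def fixed_commute[of hi i] by metis
qed

text \<open>The inverse of a partial swap is a partial swap, so moves of the spoiler on the other
  side need no separate strategy.\<close>

lemma Inv_flip: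
  assumes "Inv j lo hi i i' us vs us' vs' X \<sigma> \<tau>"
  shows "Inv j lo hi i i' vs' us' vs us X \<tau> \<sigma>"
proof -
  have I: "lo + 2 ^ j \<le> hi" "hi \<le> R" "eqv j i us i' vs" "eqv j i' us' i vs'"
     "\<forall>u\<in>set us. reach i lo u" "\<forall>u\<in>set us'. reach i' lo u"
     "(set us \<union> set vs \<union> set us' \<union> set vs') \<inter> S = {}"
     and X: "\<forall>x\<in>X. (\<exists>m<length us. \<sigma> x = us ! m \<and> \<tau> x = vs ! m) \<or>
        (\<exists>m<length us'. \<sigma> x = us' ! m \<and> \<tau> x = vs' ! m) \<or>
        \<sigma> x = \<tau> x \<and> fixed hi i i' (\<sigma> x)"
    using assms unfolding Inv_def by auto
  have "lo \<le> R" using I(1,2) by linarith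
  note r = eqv_reach_all[OF I(3,5) this] eqv_reach_all[OF I(4,6) this]
  have X': "(\<exists>m<length vs'. \<tau> x = vs' ! m \<and> \<sigma> x = us' ! m) \<or>
        (\<exists>m<length vs. \<tau> x = vs ! m \<and> \<sigma> x = us ! m) \<or>
        \<tau> x = \<sigma> x \<and> fixed hi i i' (\<tau> x)" if "x \<in> X" for x
    using X[rule_format, OF that] r(1,3) by metis
  have "(set vs' \<union> set us' \<union> set vs \<union> set us) \<inter> S = {}" using I(7) by blast
  then show ?thesis
    unfolding Inv_def using I r eqv_sym X' by metis
qed

lemma Inv_compat:
  assumes I: "Inv j lo hi i i' us vs us' vs' X \<sigma> \<tau>" and far: "far i i'" and x: "x \<in> X" "y \<in> X"
  shows "compat (\<sigma> x) (\<tau> x) (\<sigma> y) (\<tau> y)"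
proof -
  have I': "lo + 2 ^ j \<le> hi" "hi \<le> R" "eqv j i us i' vs" "eqv j i' us' i vs'"
     "\<forall>u\<in>set us. reach i lo u" "\<forall>u\<in>set us'. reach i' lo u"
     "(set us \<union> set vs \<union> set us' \<union> set vs') \<inter> S = {}"
     and X: "\<And>x. x \<in> X \<Longrightarrow> (\<exists>m<length us. \<sigma> x = us ! m \<and> \<tau> x = vs ! m) \<or>
        (\<exists>m<length us'. \<sigma> x = us' ! m \<and> \<tau> x = vs' ! m) \<or>
        \<sigma> x = \<tau> x \<and> fixed hi i i' (\<sigma> x)"
    using I unfolding Inv_def by auto
  have "0 < (2::nat) ^ j" by simp
  then have lo: "lo < hi" "lo \<le> R" using I'(1,2) by linarith+
  note r = eqv_reach_all[OF I'(3,5) lo(2)] eqv_reach_all[OF I'(4,6) lo(2)]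
  note e = eqv_0[OF I'(3)] eqv_0[OF I'(4)]
  have S: "us ! m \<notin> S" "vs ! m \<notin> S" "reach i lo (us ! m)" "reach i' lo (vs ! m)" if "m < length us" for m
  proof -
    have "us ! m \<in> set us" "vs ! m \<in> set vs" using that r(1) by simp_all
    then show "us ! m \<notin> S" "vs ! m \<notin> S" "reach i lo (us ! m)" "reach i' lo (vs ! m)"
      using I'(5,7) r(2) by blast+
  qed
  have S': "us' ! m \<notin> S" "vs' ! m \<notin> S" "reach i' lo (us' ! m)" "reach i lo (vs' ! m)" if "m < length us'" for m
  proof -
    have "us' ! m \<in> set us'" "vs' ! m \<in> set vs'" using that r(3) by simp_all
    then show "us' ! m \<notin> S" "vs' ! m \<notin> S" "reach i' lo (us' ! m)" "reach i lo (vs' ! m)"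
      using I'(6,7) r(4) by blast+
  qed
  have LL: "compat (us ! m) (vs ! m) (us ! n) (vs ! n)" if "m < length us" "n < length us" for m n
    using e(1) that by simp
  have LL': "compat (us' ! m) (vs' ! m) (us' ! n) (vs' ! n)" if "m < length us'" "n < length us'" for m n
    using e(2) that by simp
  have LB: "compat (us ! m) (vs ! m) w w" if "m < length us" "fixed hi i i' w" for m w
    using compat_moved_fixed[OF e(1) that(1) S(3)[OF that(1)] S(1,2)[OF that(1)] lo(1) I'(2) that(2)] .
  have LB': "compat (us' ! m) (vs' ! m) w w" if "m < length us'" "fixed hi i i' w" for m w
    using compat_moved_fixed[OF e(2) that(1) S'(3)[OF that(1)] S'(1,2)[OF that(1)] lo(1) I'(2)] that(2)
    by (simp add: fixed_commute)
  have M: "compat (us ! m) (vs ! m) (us' ! n) (vs' ! n)" if "m < length us" "n < length us'" for m n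
    using compat_moved_moved[OF far] S[OF that(1)] S'[OF that(2)] reach_mono[OF _ lo(2)] by metis
  have BB: "compat w w w' w'" for w w' by (simp add: compat_def)
  from X[OF x(1)] X[OF x(2)] show ?thesis
    using LL LL' LB LB' M BB compat_commute by metis
qed

text \<open>The gap is at least \<open>2 ^ Suc j\<close>, and the threshold
  \<open>lo + 2 ^ j\<close> leaves half of that on either side. A move below it is answered by the
  local strategy in \<open>eqv\<close>, and \<open>lo\<close> rises to the threshold.\<close>

lemma Inv_extend:
  assumes I: "Inv (Suc j) lo hi i i' us vs us' vs' X \<sigma> \<tau>" and c: "c \<in> verts G" "c \<notin> S" "reach i (lo + 2 ^ j) c"
  shows "\<exists>c'\<in>verts G. Inv j (lo + 2 ^ j) hi i i' (us @ [c]) (vs @ [c']) us' vs' (insert x X) (\<sigma>(x := c)) (\<tau>(x := c'))"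
proof -
  have I': "lo + 2 ^ Suc j \<le> hi" "hi \<le> R" "eqv (Suc j) i us i' vs" "eqv (Suc j) i' us' i vs'"
     "\<forall>u\<in>set us. reach i lo u" "\<forall>u\<in>set us'. reach i' lo u"
     "(set us \<union> set vs \<union> set us' \<union> set vs') \<inter> S = {}"
     and X: "\<And>x. x \<in> X \<Longrightarrow> (\<exists>m<length us. \<sigma> x = us ! m \<and> \<tau> x = vs ! m) \<or>
        (\<exists>m<length us'. \<sigma> x = us' ! m \<and> \<tau> x = vs' ! m) \<or>
        \<sigma> x = \<tau> x \<and> fixed hi i i' (\<sigma> x)"
    using I unfolding Inv_def by auto
  have le: "lo + 2 ^ j + 2 ^ j \<le> hi" "lo + 2 ^ j \<le> R" using I'(1,2) by simp_all
  have "c \<in> near i" using c reach_mono[OF c(3) le(2)] by (simp add: near_def)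
  then obtain c' where c': "c' \<in> near i'" "eqv j i (us @ [c]) i' (vs @ [c'])"
    using I'(3) by auto
  have len: "length us = length vs" using eqv_0[OF I'(3)] by simp
  have "(\<exists>m<length (us @ [c]). (\<sigma>(x := c)) y = (us @ [c]) ! m \<and> (\<tau>(x := c')) y = (vs @ [c']) ! m) \<or>
        (\<exists>m<length us'. (\<sigma>(x := c)) y = us' ! m \<and> (\<tau>(x := c')) y = vs' ! m) \<or>
        (\<sigma>(x := c)) y = (\<tau>(x := c')) y \<and> fixed hi i i' ((\<sigma>(x := c)) y)" if "y \<in> insert x X" for y
  proof (cases "y = x")
    case True
    then show ?thesis using len by (intro disjI1 exI[of _ "length us"]) (auto simp: nth_append)
  next
    case False
    then have "y \<in> X" using that by simp
    from X[OF this] show ?thesis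
    proof (elim disjE)
      assume "\<exists>m<length us. \<sigma> y = us ! m \<and> \<tau> y = vs ! m"
      then obtain m where "m < length us" "\<sigma> y = us ! m" "\<tau> y = vs ! m" by blast
      then show ?thesis using False len by (intro disjI1 exI[of _ m]) (auto simp: nth_append)
    qed (use False in auto)
  qed
  moreover have "eqv j i' us' i vs'" using I'(4) by simp
  moreover have "\<forall>u\<in>set (us @ [c]). reach i (lo + 2 ^ j) u" "\<forall>u\<in>set us'. reach i' (lo + 2 ^ j) u"
    using I'(5,6) c(3) reach_mono by auto
  moreover have "(set (us @ [c]) \<union> set (vs @ [c']) \<union> set us' \<union> set vs') \<inter> S = {}" "c' \<in> verts G"
    using I'(7) c(2) c'(1) by (auto simp: near_def)
  ultimately show ?thesis
    unfolding Inv_def using le(1) I'(2) c'(2) by (intro bexI[of _ c'] conjI) (assumption | rule ballI)+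
qed

text \<open>A move in \<open>S\<close>, or beyond the threshold from both tuples, is answered by
  itself, and \<open>hi\<close> drops to the threshold. Vertices fixed before stay fixed because the
  excluded balls shrink.\<close>

lemma Inv_fix:
  assumes I: "Inv (Suc j) lo hi i i' us vs us' vs' X \<sigma> \<tau>"
    and c: "c \<in> S \<or> \<not> reach i (lo + 2 ^ j) c \<and> \<not> reach i' (lo + 2 ^ j) c"
  shows "Inv j lo (lo + 2 ^ j) i i' us vs us' vs' (insert x X) (\<sigma>(x := c)) (\<tau>(x := c))"
proof -
  have le: "lo + 2 ^ j \<le> hi" using I unfolding Inv_def by simp
  have fx: "fixed (lo + 2 ^ j) i i' w" if "fixed hi i i' w" for w
    using that reach_mono[OF _ le] unfolding fixed_def by blast
  have X: "\<And>x. x \<in> X \<Longrightarrow> (\<exists>m<length us. \<sigma> x = us ! m \<and> \<tau> x = vs ! m) \<or>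
        (\<exists>m<length us'. \<sigma> x = us' ! m \<and> \<tau> x = vs' ! m) \<or>
        \<sigma> x = \<tau> x \<and> fixed hi i i' (\<sigma> x)"
    using I unfolding Inv_def by auto
  have "(\<exists>m<length us. (\<sigma>(x := c)) y = us ! m \<and> (\<tau>(x := c)) y = vs ! m) \<or>
        (\<exists>m<length us'. (\<sigma>(x := c)) y = us' ! m \<and> (\<tau>(x := c)) y = vs' ! m) \<or>
        (\<sigma>(x := c)) y = (\<tau>(x := c)) y \<and> fixed (lo + 2 ^ j) i i' ((\<sigma>(x := c)) y)" if "y \<in> insert x X" for y
  proof (cases "y = x")
    case True
    then show ?thesis using c by (simp add: fixed_def)
  next
    case False
    then have "y \<in> X" using that by simp
    from X[OF this] show ?thesis using False fx by auto
  qed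
  then show ?thesis using I le unfolding Inv_def by auto
qed

lemma Inv_forth:
  assumes I: "Inv (Suc j) lo hi i i' us vs us' vs' X \<sigma> \<tau>" and c: "c \<in> verts G"
  shows "\<exists>c'\<in>verts G. \<exists>lo hi us vs us' vs'. Inv j lo hi i i' us vs us' vs' (insert x X) (\<sigma>(x := c)) (\<tau>(x := c'))"
proof -
  consider "c \<in> S \<or> \<not> reach i (lo + 2 ^ j) c \<and> \<not> reach i' (lo + 2 ^ j) c"
    | "c \<notin> S" "reach i (lo + 2 ^ j) c" | "c \<notin> S" "reach i' (lo + 2 ^ j) c" by blast
  then show ?thesis
  proof cases
    case 1
    from Inv_fix[OF I this] c show ?thesis by blast
  next
    case 2
    from Inv_extend[OF I c this] show ?thesis by blast
  next
    case 3
    from Inv_extend[OF Inv_roles[OF I] c this] obtain c' where "c' \<in> verts G"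
      "Inv j (lo + 2 ^ j) hi i' i (us' @ [c]) (vs' @ [c']) us vs (insert x X) (\<sigma>(x := c)) (\<tau>(x := c'))" by blast
    with Inv_roles[OF this(2)] show ?thesis by blast
  qed
qed

lemma Inv_sat:
  assumes "Inv j lo hi i i' us vs us' vs' X \<sigma> \<tau>" "far i i'" "qr \<phi> \<le> j" "fv \<phi> \<subseteq> X"
  shows "sat G \<sigma> \<phi> \<longleftrightarrow> sat G \<tau> \<phi>"
  using assms
proof (induction \<phi> arbitrary: j lo hi us vs us' vs' X \<sigma> \<tau>)
  case (Eq x y)
  then show ?case using Inv_compat[OF Eq.prems(1,2), of x y] by (simp add: compat_def)
next
  case (Adj x y)
  then show ?case using Inv_compat[OF Adj.prems(1,2), of x y] by (simp add: compat_def)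
next
  case (Neg \<phi>)
  then show ?case by simp
next
  case (Conj \<phi> \<psi>)
  then show ?case by simp
next
  case (Ex x \<phi>)
  from Ex.prems(3) obtain j' where j: "j = Suc j'" "qr \<phi> \<le> j'" by (cases j) auto
  have fv: "fv \<phi> \<subseteq> insert x X" using Ex.prems(4) by auto
  have step: "\<exists>v\<in>verts G. sat G (\<tau>(x := v)) \<phi>"
    if inv: "Inv j lo hi i i' us vs us' vs' X \<sigma> \<tau>" and ex: "\<exists>v\<in>verts G. sat G (\<sigma>(x := v)) \<phi>"
    for us vs us' vs' \<sigma> \<tau>
  proof -
    obtain c where c: "c \<in> verts G" "sat G (\<sigma>(x := c)) \<phi>" using ex by blast
    obtain c' lo hi us vs us' vs' where "c' \<in> verts G"
      "Inv j' lo hi i i' us vs us' vs' (insert x X) (\<sigma>(x := c)) (\<tau>(x := c'))"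
      using Inv_forth[OF inv[unfolded j(1)] c(1), of x] by blast
    then show ?thesis using Ex.IH[OF _ Ex.prems(2) j(2) fv] c(2) by blast
  qed
  show ?case
    using step[OF Ex.prems(1)] step[OF Inv_flip[OF Ex.prems(1)]] by auto
qed simp_all

end

section \<open>Shattered sequences in sparse graphs\<close>

theorem no_shattered_sequence:
  fixes G :: "'a graph" and a :: "nat \<Rightarrow> nat \<Rightarrow> 'a"
  assumes E: "sym (edges G)" and nd: "\<And>p. \<exists>N. \<not> sd_embeds p N (edges G)"
    and fv: "fv \<phi> \<subseteq> {..<2 * k}"
    and shatter: "\<And>m X. X \<subseteq> {..<m} \<Longrightarrow>
      \<exists>b. \<forall>i<m. sat G (\<lambda>x. if x < k then a i x else b (x - k)) \<phi> \<longleftrightarrow> i \<in> X"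
  shows False
proof -
  \<comment> \<open>The gap that \<open>qr \<phi>\<close> rounds consume when the game starts with
    \<open>lo = 0\<close> and \<open>hi = R\<close>.\<close>
  define R where "R = (2::nat) ^ qr \<phi>"
  obtain S I1 where S: "finite S" and I1: "infinite I1" and
    scat: "\<forall>i\<in>I1. \<forall>j\<in>I1. \<forall>l<k. \<forall>l'<k. \<forall>m\<le>2 * R + 1. i \<noteq> j \<longrightarrow> a i l \<notin> S \<longrightarrow> a j l' \<notin> S \<longrightarrow>
      (a i l, a j l') \<notin> (avoid (edges G) S) ^^ m"
    using quasi_wide[OF E nd infinite_UNIV_nat, of k "2 * R + 1" a] by (elim exE conjE)
  interpret swap_game G S a k R by unfold_locales (use E S in auto)
  \<comment> \<open>Entries in \<open>S\<close> cannot be swapped, so the sequence is thinned until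
    they agree; they then count as fixed. Only the remaining positions, listed in \<open>ls\<close>,
    take part in the swap.\<close>
  define pat where "pat i = map (\<lambda>l. if a i l \<in> S then Some (a i l) else None) [0..<k]" for i
  have "finite {xs. set xs \<subseteq> insert None (Some ` S) \<and> length xs = k}"
    by (rule finite_lists_length_eq) (simp add: S)
  moreover have "pat ` I1 \<subseteq> {xs. set xs \<subseteq> insert None (Some ` S) \<and> length xs = k}"
    by (auto simp: pat_def)
  ultimately have "finite (pat ` I1)" using finite_subset by blast
  from pigeonhole_infinite[OF I1 this] obtain i0 where i0: "i0 \<in> I1"
    and inf2: "infinite {i \<in> I1. pat i = pat i0}" by (elim bexE)
  define I2 where "I2 = {i \<in> I1. pat i = pat i0}"
  define ls where "ls = filter (\<lambda>l. a i0 l \<notin> S) [0..<k]"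
  have pat: "(a i l \<in> S \<longleftrightarrow> a i0 l \<in> S) \<and> (a i l \<in> S \<longrightarrow> a i l = a i0 l)" if "i \<in> I2" "l < k" for i l
  proof -
    have "pat i ! l = pat i0 ! l" using that by (simp add: I2_def)
    then show ?thesis using that(2) by (auto simp: pat_def split: if_splits)
  qed
  obtain f :: "nat \<Rightarrow> 'a list \<Rightarrow> nat" where f: "finite (case_prod f ` {(i, us). length us = length ls})"
    and eqvI: "\<And>i us i' vs. length us = length ls \<Longrightarrow> length vs = length ls \<Longrightarrow> f i us = f i' vs \<Longrightarrow> eqv (qr \<phi>) i us i' vs"
    using eqv_finite_index[of "length ls" "qr \<phi>"] by (elim exE conjE) simp
  define tup where "tup i = map (a i) ls" for i
  have "(\<lambda>i. f i (tup i)) ` I2 \<subseteq> case_prod f ` {(i, us). length us = length ls}"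
    by (force simp: tup_def)
  then have fin2: "finite ((\<lambda>i. f i (tup i)) ` I2)" using f finite_subset by blast
  have "infinite I2" using inf2 by (simp add: I2_def)
  from pigeonhole_infinite[OF this fin2] obtain i1 where inf3: "infinite {i \<in> I2. f i (tup i) = f i1 (tup i1)}"
    by (elim bexE)
  define I3 where "I3 = {i \<in> I2. f i (tup i) = f i1 (tup i1)}"
  have I3: "I3 \<subseteq> I2" "I3 \<subseteq> I1" by (auto simp: I3_def I2_def)
  have eqv3: "eqv (qr \<phi>) i (tup i) i' (tup i')" if "i \<in> I3" "i' \<in> I3" for i i'
    by (rule eqvI) (use that in \<open>auto simp: tup_def I3_def\<close>)
  have far3: "far i i'" if "i \<in> I3" "i' \<in> I3" "i \<noteq> i'" for i i'
  proof -
    have "i \<in> I1" "i' \<in> I1" using that I3 by auto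
    then show ?thesis using scat that(3) unfolding far_def by simp
  qed
  \<comment> \<open>Each of the \<open>k\<close> parameters is within \<open>R\<close> of at most
    one of the far apart tuples, so at most \<open>k\<close> indices are bad. With
    \<open>k + 1\<close> indices inside and \<open>k + 1\<close> outside the set to be cut out, a
    good index remains on either side.\<close>
  obtain J where J: "finite J" "card J = 2 * k + 2" "J \<subseteq> I3"
    using infinite_arbitrarily_large[of I3 "2 * k + 2"] inf3 by (auto simp: I3_def)
  obtain J1 where J1: "J1 \<subseteq> J" "card J1 = k + 1"
    by (rule obtain_subset_with_card_n[of "k + 1" J]) (use J(2) in auto)
  obtain b where b: "\<And>i. i < Suc (Max J) \<Longrightarrow> sat G (\<lambda>x. if x < k then a i x else b (x - k)) \<phi> \<longleftrightarrow> i \<in> J1"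
    using shatter[of J1 "Suc (Max J)"] J1 J(1) by (meson Max_ge finite_subset in_mono le_imp_less_Suc lessThan_iff subsetI)
  have bJ: "sat G (\<lambda>x. if x < k then a i x else b (x - k)) \<phi> \<longleftrightarrow> i \<in> J1" if "i \<in> J" for i
    using b[of i] that J(1) by (simp add: le_imp_less_Suc)
  define bad where "bad = {i \<in> J. \<exists>l<k. reach i R (b l)}"
  have one: "card {i \<in> J. reach i R (b l)} \<le> 1" for l
  proof -
    have "i = i'" if "i \<in> J" "i' \<in> J" "reach i R (b l)" "reach i' R (b l)" for i i'
      using far_reach[OF far3 that(3,4)] that(1,2) J(3) by force
    then show ?thesis using J(1) by (auto simp: card_le_Suc0_iff_eq)
  qed
  have "card bad \<le> (\<Sum>l<k. card {i \<in> J. reach i R (b l)})"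
  proof -
    have "bad = (\<Union>l<k. {i \<in> J. reach i R (b l)})" by (auto simp: bad_def)
    then show ?thesis using card_UN_le[of "{..<k}" "\<lambda>l. {i \<in> J. reach i R (b l)}"] by simp
  qed
  also have "\<dots> \<le> (\<Sum>l<k. 1)" using one by (intro sum_mono) auto
  finally have bad: "card bad \<le> k" by simp
  have finb: "finite bad" using J(1) by (simp add: bad_def)
  have "\<not> J1 \<subseteq> bad" using card_mono[OF finb, of J1] bad J1(2) by auto
  then obtain i where i: "i \<in> J1" "i \<notin> bad" by auto
  have "card (J - J1) = k + 1" using J J1 by (simp add: card_Diff_subset finite_subset)
  then have "\<not> J - J1 \<subseteq> bad" using card_mono[OF finb, of "J - J1"] bad by auto
  then obtain i' where i': "i' \<in> J" "i' \<notin> J1" "i' \<notin> bad" by auto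
  have iJ: "i \<in> J" "i \<noteq> i'" using i(1) i'(2) J1(1) by auto
  have i3: "i \<in> I3" "i' \<in> I3" and i2: "i \<in> I2" "i' \<in> I2" using iJ(1) i'(1) J(3) I3(1) by auto
  have far: "far i i'" by (rule far3[OF i3 iJ(2)])
  have tupS: "set (tup i) \<inter> S = {}" if "i \<in> I2" for i
    using pat[OF that] by (auto simp: tup_def ls_def)
  have tup_reach: "\<forall>u\<in>set (tup i). reach i 0 u" if "i \<in> I2" for i
    using pat[OF that] by (auto simp: tup_def ls_def reach_def)
  define \<sigma> where "\<sigma> = (\<lambda>x. if x < k then a i x else b (x - k))"
  define \<tau> where "\<tau> = (\<lambda>x. if x < k then a i' x else b (x - k))"
  have vars: "(\<exists>m<length (tup i). \<sigma> x = tup i ! m \<and> \<tau> x = tup i' ! m) \<or>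
      (\<exists>m<length (tup i'). \<sigma> x = tup i' ! m \<and> \<tau> x = tup i ! m) \<or>
      \<sigma> x = \<tau> x \<and> fixed R i i' (\<sigma> x)"
    if x: "x < 2 * k" for x
  proof (cases "x < k")
    case True
    then have \<sigma>\<tau>: "\<sigma> x = a i x" "\<tau> x = a i' x" by (simp_all add: \<sigma>_def \<tau>_def)
    show ?thesis
    proof (cases "a i0 x \<in> S")
      case S: True
      then have "a i x \<in> S" "a i x = a i0 x" "a i' x = a i0 x"
        using pat[OF i2(1) True] pat[OF i2(2) True] by blast+
      then show ?thesis unfolding \<sigma>\<tau> by (intro disjI2 conjI) (simp_all add: fixed_def)
    next
      case False
      then have "x \<in> set ls" using True by (simp add: ls_def)
      then obtain m where "m < length ls" "ls ! m = x" by (auto simp: in_set_conv_nth)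
      then show ?thesis unfolding \<sigma>\<tau> by (intro disjI1 exI[of _ m]) (simp add: tup_def)
    qed
  next
    case False
    then have \<sigma>\<tau>: "\<sigma> x = b (x - k)" "\<tau> x = b (x - k)" by (simp_all add: \<sigma>_def \<tau>_def)
    have "x - k < k" using x False by auto
    then have "\<not> reach i R (b (x - k))" "\<not> reach i' R (b (x - k))"
      using i(2) i'(3) iJ(1) i'(1) by (auto simp: bad_def)
    then show ?thesis unfolding \<sigma>\<tau> by (intro disjI2 conjI) (simp_all add: fixed_def)
  qed
  have "Inv (qr \<phi>) 0 R i i' (tup i) (tup i') (tup i') (tup i) {..<2 * k} \<sigma> \<tau>"
    unfolding Inv_def
  proof (intro conjI ballI)
    show "(set (tup i) \<union> set (tup i') \<union> set (tup i') \<union> set (tup i)) \<inter> S = {}"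
      using tupS[OF i2(1)] tupS[OF i2(2)] by blast
    show "reach i 0 u" if "u \<in> set (tup i)" for u using tup_reach[OF i2(1)] that by blast
    show "reach i' 0 u" if "u \<in> set (tup i')" for u using tup_reach[OF i2(2)] that by blast
  qed (use eqv3[OF i3] eqv3[OF i3(2,1)] vars in \<open>simp_all add: R_def\<close>)
  from Inv_sat[OF this far order_refl fv] show False
    using bJ[OF iJ(1)] bJ[OF i'(1)] i(1) i'(2) unfolding \<sigma>_def \<tau>_def by blast
qed

section \<open>Ultraproducts\<close>

text \<open>An ultrafilter as an operator on predicates, so that its clauses match the connectives
  in the proof of \<open>Los\<close>; \<open>big_cofinite\<close> makes it non-principal.\<close>

locale free_ultrafilter =
  fixes big :: "(nat \<Rightarrow> bool) \<Rightarrow> bool"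
  assumes big_not: "\<And>P. big (\<lambda>n. \<not> P n) \<longleftrightarrow> \<not> big P"
    and big_conj: "\<And>P Q. big (\<lambda>n. P n \<and> Q n) \<longleftrightarrow> big P \<and> big Q"
    and big_cofinite: "\<And>P m. (\<And>n. n \<ge> m \<Longrightarrow> P n) \<Longrightarrow> big P"

text \<open>Zorn's lemma is applied to families whose finite intersections are infinite rather than
  merely non-empty. Every such family is compatible with the cofinite sets, so a maximal one
  contains them.\<close>

lemma free_ultrafilter_exists: "\<exists>big. free_ultrafilter big"
proof -
  define fip where "fip A \<longleftrightarrow> (\<forall>X\<subseteq>A. finite X \<longrightarrow> infinite (\<Inter>X))" for A :: "nat set set"
  have "\<exists>M\<in>{A. fip A}. \<forall>X\<in>{A. fip A}. M \<subseteq> X \<longrightarrow> X = M"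
  proof (rule subset_Zorn_nonempty)
    have "fip {}" by (auto simp: fip_def)
    then show "{A. fip A} \<noteq> {}" by auto
    fix \<C> assume ch: "\<C> \<noteq> {}" "subset.chain {A. fip A} \<C>"
    have "infinite (\<Inter>X)" if X: "X \<subseteq> \<Union>\<C>" "finite X" for X
    proof -
      obtain A where "A \<in> \<C>" "X \<subseteq> A"
        using finite_subset_Union_chain[OF X(2,1) ch] by metis
      moreover have "fip A" using \<open>A \<in> \<C>\<close> ch(2) by (auto simp: subset.chain_def)
      ultimately show ?thesis using X(2) by (simp add: fip_def)
    qed
    then show "\<Union>\<C> \<in> {A. fip A}" by (simp add: fip_def)
  qed
  then obtain M where M: "fip M" and max: "\<And>X. fip X \<Longrightarrow> M \<subseteq> X \<Longrightarrow> X = M" by auto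
  have ex: "\<exists>X\<subseteq>M. finite X \<and> finite (\<Inter>X \<inter> P)" if "P \<notin> M" for P
  proof -
    have "\<not> fip (insert P M)" using max[of "insert P M"] that by auto
    then obtain Y where Y: "Y \<subseteq> insert P M" "finite Y" "finite (\<Inter>Y)" by (auto simp: fip_def)
    have "\<Inter>(Y - {P}) \<inter> P \<subseteq> \<Inter>Y" by auto
    then have "finite (\<Inter>(Y - {P}) \<inter> P)" using Y(3) finite_subset by blast
    then show ?thesis using Y by (intro exI[of _ "Y - {P}"]) auto
  qed
  \<comment> \<open>A maximal family contains every set that includes one of its finite
    intersections up to finitely many points. Upward closure, closure under intersection and, with
    \<open>X = {}\<close>, the cofinite sets are instances.\<close>
  have meet: "P \<in> M" if "X \<subseteq> M" "finite X" "finite (\<Inter>X - P)" for X P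
  proof (rule ccontr)
    assume "P \<notin> M"
    then obtain Y where Y: "Y \<subseteq> M" "finite Y" "finite (\<Inter>Y \<inter> P)" using ex by blast
    have "\<Inter>(X \<union> Y) \<subseteq> (\<Inter>X - P) \<union> (\<Inter>Y \<inter> P)" by auto
    then have "finite (\<Inter>(X \<union> Y))" using that(3) Y(3) finite_subset by blast
    moreover have "infinite (\<Inter>(X \<union> Y))"
      using M that(1,2) Y(1,2) unfolding fip_def by (meson Un_least finite_UnI)
    ultimately show False by simp
  qed
  have up: "Q \<in> M" if "P \<in> M" "P \<subseteq> Q" for P Q
    using meet[of "{P}" Q] that by (simp add: Diff_eq_empty_iff[THEN iffD2])
  have int: "P \<inter> Q \<in> M" if "P \<in> M" "Q \<in> M" for P Q
    using meet[of "{P, Q}" "P \<inter> Q"] that by simp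
  have compl: "- P \<in> M \<longleftrightarrow> P \<notin> M" for P
  proof
    assume "- P \<in> M"
    show "P \<notin> M"
    proof
      assume "P \<in> M"
      with \<open>- P \<in> M\<close> have "{P, - P} \<subseteq> M" "finite {P, - P}" by auto
      then have "infinite (\<Inter>{P, - P})" using M unfolding fip_def by blast
      then show False by simp
    qed
  next
    assume "P \<notin> M"
    then obtain X where "X \<subseteq> M" "finite X" "finite (\<Inter>X \<inter> P)" using ex by blast
    then show "- P \<in> M" using meet[of X "- P"] by (simp add: Diff_eq)
  qed
  show ?thesis
  proof (rule exI[of _ "\<lambda>P. {n. P n} \<in> M"], rule free_ultrafilter.intro)
    fix P show "{n. \<not> P n} \<in> M \<longleftrightarrow> {n. P n} \<notin> M"
      using compl[of "{n. P n}"] by (simp add: Collect_neg_eq)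
    fix Q show "{n. P n \<and> Q n} \<in> M \<longleftrightarrow> {n. P n} \<in> M \<and> {n. Q n} \<in> M"
    proof
      assume "{n. P n \<and> Q n} \<in> M"
      from up[OF this, of "{n. P n}"] up[OF this, of "{n. Q n}"]
      show "{n. P n} \<in> M \<and> {n. Q n} \<in> M" by blast
    next
      assume "{n. P n} \<in> M \<and> {n. Q n} \<in> M"
      with int[of "{n. P n}" "{n. Q n}"] show "{n. P n \<and> Q n} \<in> M" by (simp add: Collect_conj_eq)
    qed
  next
    fix P :: "nat \<Rightarrow> bool" and m assume "\<And>n. n \<ge> m \<Longrightarrow> P n"
    then have "- {n. P n} \<subseteq> {..<m}" by (auto simp: not_le[symmetric])
    then have "finite (- {n. P n})" using finite_subset by blast
    then show "{n. P n} \<in> M" using meet[of "{}" "{n. P n}"] by (simp add: Compl_eq_Diff_UNIV)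
  qed
qed

locale ultraproduct =
  free_ultrafilter big for big +
  fixes G :: "nat \<Rightarrow> 'v graph"
begin

lemma big_mono:
  assumes "big P" "\<And>n. P n \<Longrightarrow> Q n"
  shows "big Q"
proof -
  have "(\<lambda>n. P n \<and> Q n) = P" using assms(2) by auto
  then show ?thesis using big_conj[of P Q] assms(1) by simp
qed

lemma big_ex: "big P \<Longrightarrow> \<exists>n. P n"
  using big_not[of P] big_cofinite[of 0 "\<lambda>n. \<not> P n"] by blast

lemma big_ball: "finite A \<Longrightarrow> (\<And>x. x \<in> A \<Longrightarrow> big (P x)) \<Longrightarrow> big (\<lambda>n. \<forall>x\<in>A. P x n)"
  by (induction A rule: finite_induct) (auto simp: big_conj intro: big_cofinite)

text \<open>Vertices of the ultraproduct are chosen representatives instead of classes, which keeps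
  them in the type \<open>nat => 'v\<close>. Equivalent sequences get the same representative
  because they give the same predicate under \<open>SOME\<close>.\<close>

definition rep :: "(nat \<Rightarrow> 'v) \<Rightarrow> nat \<Rightarrow> 'v" where
  "rep v = (SOME w. big (\<lambda>n. w n = v n))"

lemma big_rep: "big (\<lambda>n. rep v n = v n)"
  unfolding rep_def by (rule someI[of _ v]) (auto intro: big_cofinite)

lemma rep_eq_iff: "rep v = rep w \<longleftrightarrow> big (\<lambda>n. v n = w n)"
proof
  assume "rep v = rep w"
  then have "big (\<lambda>n. rep v n = v n \<and> rep v n = w n)"
    using big_rep[of v] big_rep[of w] by (simp add: big_conj)
  then show "big (\<lambda>n. v n = w n)" by (rule big_mono) auto
next
  assume vw: "big (\<lambda>n. v n = w n)"
  have "big (\<lambda>n. u n = v n) \<longleftrightarrow> big (\<lambda>n. u n = w n)" for u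
  proof
    assume "big (\<lambda>n. u n = v n)"
    with vw have "big (\<lambda>n. u n = v n \<and> v n = w n)" by (simp add: big_conj)
    then show "big (\<lambda>n. u n = w n)" by (rule big_mono) auto
  next
    assume "big (\<lambda>n. u n = w n)"
    with vw have "big (\<lambda>n. u n = w n \<and> v n = w n)" by (simp add: big_conj)
    then show "big (\<lambda>n. u n = v n)" by (rule big_mono) auto
  qed
  then show "rep v = rep w" unfolding rep_def by simp
qed

lemma rep_rep: "rep (rep v) = rep v"
  by (simp add: rep_eq_iff big_rep)

definition uprod :: "(nat \<Rightarrow> 'v) graph" where
  "uprod = \<lparr> verts = rep ` {v. big (\<lambda>n. v n \<in> verts (G n))},
     edges = {(rep v, rep w) | v w. big (\<lambda>n. (v n, w n) \<in> edges (G n))} \<rparr>"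

lemma edges_uprod: "(rep v, rep w) \<in> edges uprod \<longleftrightarrow> big (\<lambda>n. (v n, w n) \<in> edges (G n))"
proof
  assume "(rep v, rep w) \<in> edges uprod"
  then obtain v' w' where "rep v = rep v'" "rep w = rep w'" "big (\<lambda>n. (v' n, w' n) \<in> edges (G n))"
    by (auto simp: uprod_def)
  then have "big (\<lambda>n. v n = v' n \<and> w n = w' n \<and> (v' n, w' n) \<in> edges (G n))"
    by (simp add: rep_eq_iff big_conj)
  then show "big (\<lambda>n. (v n, w n) \<in> edges (G n))" by (rule big_mono) auto
qed (auto simp: uprod_def)

theorem Los: "sat uprod (\<lambda>x. rep (\<sigma> x)) \<phi> \<longleftrightarrow> big (\<lambda>n. sat (G n) (\<lambda>x. \<sigma> x n) \<phi>)"
proof (induction \<phi> arbitrary: \<sigma>)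
  case Tru
  then show ?case by (auto intro: big_cofinite)
next
  case (Eq x y)
  then show ?case by (simp add: rep_eq_iff)
next
  case (Adj x y)
  then show ?case by (simp add: edges_uprod)
next
  case (Neg \<phi>)
  then show ?case by (simp add: big_not)
next
  case (Conj \<phi> \<psi>)
  then show ?case by (simp add: big_conj)
next
  case (Ex x \<phi>)
  have upd: "(\<lambda>y. rep (\<sigma> y))(x := rep v) = (\<lambda>y. rep ((\<sigma>(x := v)) y))" for v by auto
  have upd': "(\<lambda>y. (\<sigma>(x := v)) y n) = (\<lambda>y. \<sigma> y n)(x := v n)" for v n by auto
  have "sat uprod (\<lambda>x. rep (\<sigma> x)) (Ex x \<phi>) \<longleftrightarrow>
      (\<exists>v. big (\<lambda>n. v n \<in> verts (G n)) \<and> sat uprod ((\<lambda>y. rep (\<sigma> y))(x := rep v)) \<phi>)"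
    by (auto simp: uprod_def)
  also have "\<dots> \<longleftrightarrow> (\<exists>v. big (\<lambda>n. v n \<in> verts (G n) \<and> sat (G n) ((\<lambda>y. \<sigma> y n)(x := v n)) \<phi>))"
    unfolding upd Ex.IH upd' big_conj ..
  also have "\<dots> \<longleftrightarrow> big (\<lambda>n. \<exists>u\<in>verts (G n). sat (G n) ((\<lambda>y. \<sigma> y n)(x := u)) \<phi>)"
  proof
    \<comment> \<open>Witnesses are chosen at each index separately; where none exists the value is
      arbitrary.\<close>
    assume "big (\<lambda>n. \<exists>u\<in>verts (G n). sat (G n) ((\<lambda>y. \<sigma> y n)(x := u)) \<phi>)"
    then show "\<exists>v. big (\<lambda>n. v n \<in> verts (G n) \<and> sat (G n) ((\<lambda>y. \<sigma> y n)(x := v n)) \<phi>)"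
      by (intro exI[of _ "\<lambda>n. SOME u. u \<in> verts (G n) \<and> sat (G n) ((\<lambda>y. \<sigma> y n)(x := u)) \<phi>"])
        (erule big_mono, metis (mono_tags, lifting) someI)
  qed (auto elim: big_mono)
  finally show ?case by simp
qed

end

section \<open>Subdivided cliques inside members of a class\<close>

lemma sd_edges_verts: "edges (subdivided_clique p N) \<subseteq> verts (subdivided_clique p N) \<times> verts (subdivided_clique p N)"
  by (auto simp: subdivided_clique_def sd_pt_def)

lemma sd_edges_sym: "(u, v) \<in> edges (subdivided_clique p N) \<Longrightarrow> (v, u) \<in> edges (subdivided_clique p N)"
  by (auto simp: subdivided_clique_def)

lemma finite_sd_verts: "finite (verts (subdivided_clique p N))"
proof (rule finite_subset)
  show "verts (subdivided_clique p N) \<subseteq> {..<N} \<times> {..<N} \<times> {..p}"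
    by (auto simp: subdivided_clique_def)
qed auto

text \<open>\<open>sd_embeds\<close> constrains images only along edges; as no vertex is isolated,
  all images are vertices of the target.\<close>

lemma sd_vertex_edge:
  assumes "N \<ge> 2" "u \<in> verts (subdivided_clique p N)"
  shows "\<exists>v. (u, v) \<in> edges (subdivided_clique p N)"
proof -
  have e: "(sd_pt p i j t, sd_pt p i j (Suc t)) \<in> edges (subdivided_clique p N)"
      "(sd_pt p i j (Suc t), sd_pt p i j t) \<in> edges (subdivided_clique p N)"
    if "i < j" "j < N" "t \<le> p" for i j t
    using that by (auto simp: subdivided_clique_def)
  from assms(2) consider i where "u = (i, i, 0)" "i < N"
    | i j t where "u = (i, j, t)" "i < j" "j < N" "1 \<le> t" "t \<le> p"
    by (auto simp: subdivided_clique_def)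
  then show ?thesis
  proof cases
    case (1 i)
    show ?thesis
    proof (cases "i = 0")
      case True
      then have "u = sd_pt p 0 1 0" using 1 by (simp add: sd_pt_def)
      then show ?thesis by (intro exI[of _ "sd_pt p 0 1 (Suc 0)"]) (use e(1)[of 0 1 0] assms(1) in simp)
    next
      case False
      then have "u = sd_pt p 0 i (Suc p)" using 1 by (simp add: sd_pt_def)
      then show ?thesis by (intro exI[of _ "sd_pt p 0 i p"]) (use e(2)[of 0 i p] False 1 in simp)
    qed
  next
    case (2 i j t)
    then have "u = sd_pt p i j t" by (simp add: sd_pt_def)
    then show ?thesis by (intro exI[of _ "sd_pt p i j (Suc t)"]) (use e(1)[of i j t] 2 in simp)
  qed
qed

text \<open>By monotonicity the image of an embedded subdivided clique is itself in the class, so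
  excluding isomorphic members excludes embeddings. The shift to \<open>N + 2\<close> ensures that
  no vertex is isolated.\<close>

lemma nowhere_dense_sd:
  assumes C: "monotone_class C" and nd: "nowhere_dense C"
  shows "\<exists>N\<ge>2. \<forall>G\<in>C. \<not> sd_embeds p N (edges G)"
proof -
  obtain N where N: "\<And>G. G \<in> C \<Longrightarrow> \<not> graph_iso (subdivided_clique p N) G"
    using nd unfolding nowhere_dense_def by blast
  have iso: "\<exists>G'\<in>C. graph_iso (subdivided_clique p M) G'"
    if G: "G \<in> C" and emb: "sd_embeds p M' (edges G)" and "M' \<ge> 2" "M \<le> M'" for G M M'
  proof -
    obtain h where h': "inj_on h (verts (subdivided_clique p M'))"
      and e': "\<forall>(u, v)\<in>edges (subdivided_clique p M'). (h u, h v) \<in> edges G"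
      using emb unfolding sd_embeds_def by blast
    have sub: "verts (subdivided_clique p M) \<subseteq> verts (subdivided_clique p M')"
      "edges (subdivided_clique p M) \<subseteq> edges (subdivided_clique p M')"
      using \<open>M \<le> M'\<close> by (fastforce simp: subdivided_clique_def)+
    have gG: "is_graph G" using C G unfolding monotone_class_def by blast
    have hG: "h u \<in> verts G" if u: "u \<in> verts (subdivided_clique p M)" for u
    proof -
      obtain v where "(u, v) \<in> edges (subdivided_clique p M')"
        using sd_vertex_edge[OF \<open>M' \<ge> 2\<close>, of u p] u sub(1) by blast
      then have "(h u, h v) \<in> edges G" using e' by auto
      then show ?thesis using gG by (auto simp: is_graph_def)
    qed
    define G' where "G' = \<lparr> verts = h ` verts (subdivided_clique p M), edges = map_prod h h ` edges (subdivided_clique p M) \<rparr>"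
    have eG: "edges G' \<subseteq> edges G" using e' sub(2) by (auto simp: G'_def)
    have "is_graph G'"
      unfolding is_graph_def
    proof (intro conjI allI impI)
      show "finite (verts G')" by (simp add: G'_def finite_sd_verts)
      show "edges G' \<subseteq> verts G' \<times> verts G'" using sd_edges_verts[of p M] by (auto simp: G'_def)
      fix u v assume "(u, v) \<in> edges G'"
      then obtain x y where "u = h x" "v = h y" "(x, y) \<in> edges (subdivided_clique p M)" by (auto simp: G'_def)
      then show "(v, u) \<in> edges G'" using sd_edges_sym[of x y p M] by (force simp: G'_def)
    next
      fix u show "(u, u) \<notin> edges G'" using eG gG by (auto simp: is_graph_def)
    qed
    moreover have "subgraph G' G" using eG hG by (auto simp: subgraph_def G'_def)
    moreover have "graph_iso G' G'" unfolding graph_iso_def by (intro exI[of _ id]) auto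
    ultimately have "G' \<in> C" using C G unfolding monotone_class_def by blast
    moreover have "graph_iso (subdivided_clique p M) G'"
      unfolding graph_iso_def
    proof (intro exI[of _ h] conjI ballI)
      have inj: "inj_on h (verts (subdivided_clique p M))" using h' sub(1) by (rule inj_on_subset)
      then show "bij_betw h (verts (subdivided_clique p M)) (verts G')" by (simp add: bij_betw_def G'_def)
      fix u v assume uv: "u \<in> verts (subdivided_clique p M)" "v \<in> verts (subdivided_clique p M)"
      show "(u, v) \<in> edges (subdivided_clique p M) \<longleftrightarrow> (h u, h v) \<in> edges G'"
      proof
        assume "(h u, h v) \<in> edges G'"
        then obtain x y where xy: "h u = h x" "h v = h y" "(x, y) \<in> edges (subdivided_clique p M)" by (auto simp: G'_def)
        then have "x \<in> verts (subdivided_clique p M)" "y \<in> verts (subdivided_clique p M)" using sd_edges_verts by auto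
        then show "(u, v) \<in> edges (subdivided_clique p M)" using xy uv inj by (metis inj_onD)
      qed (force simp: G'_def)
    qed
    ultimately show ?thesis by blast
  qed
  have "\<not> sd_embeds p (N + 2) (edges G)" if "G \<in> C" for G
    using iso[OF that, of "N + 2" N] N by auto
  then show ?thesis by (intro exI[of _ "N + 2"]) auto
qed

text \<open>Graphs \<open>G n\<close> shattering \<open>n\<close> tuples would give an infinite
  shattered sequence in their ultraproduct: for \<open>X\<close> below \<open>m\<close>, every
  \<open>G n\<close> with \<open>n \<ge> m\<close> provides a parameter. A subdivided clique is a
  finite configuration, so one in the ultraproduct would already occur in some
  \<open>G n\<close>.\<close>

theorem nowhere_dense_bounded_shattering:
  assumes C: "monotone_class C" and nd: "nowhere_dense C" and fv: "fv \<phi> \<subseteq> {..<2 * k}"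
  shows "\<exists>d::nat. \<forall>G\<in>C. \<forall>a b. \<exists>i<d. \<exists>X\<subseteq>{..<d}.
    \<not> (sat G (\<lambda>x. if x < k then a i x else b X (x - k)) \<phi> \<longleftrightarrow> i \<in> X)"
proof (rule ccontr)
  assume "\<not> ?thesis"
  then have "\<forall>d::nat. \<exists>G. G \<in> C \<and> (\<exists>a b. \<forall>i<d. \<forall>X\<subseteq>{..<d}.
    sat G (\<lambda>x. if x < k then a i x else b X (x - k)) \<phi> \<longleftrightarrow> i \<in> X)"
    by (simp add: Bex_def)
  from choice[OF this] obtain G where G: "\<forall>d::nat. G d \<in> C \<and> (\<exists>a b. \<forall>i<d. \<forall>X\<subseteq>{..<d}.
    sat (G d) (\<lambda>x. if x < k then a i x else b X (x - k)) \<phi> \<longleftrightarrow> i \<in> X)" ..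
  then have "\<forall>d::nat. \<exists>a b. \<forall>i<d. \<forall>X\<subseteq>{..<d}.
    sat (G d) (\<lambda>x. if x < k then a i x else b X (x - k)) \<phi> \<longleftrightarrow> i \<in> X" by simp
  from choice[OF this] obtain a where "\<forall>d::nat. \<exists>b. \<forall>i<d. \<forall>X\<subseteq>{..<d}.
    sat (G d) (\<lambda>x. if x < k then a d i x else b X (x - k)) \<phi> \<longleftrightarrow> i \<in> X" ..
  from choice[OF this] obtain b where b: "\<forall>d::nat. \<forall>i<d. \<forall>X\<subseteq>{..<d}.
    sat (G d) (\<lambda>x. if x < k then a d i x else b d X (x - k)) \<phi> \<longleftrightarrow> i \<in> X" ..
  have GC: "G d \<in> C" for d using G by simp
  have ab: "sat (G d) (\<lambda>x. if x < k then a d i x else b d X (x - k)) \<phi> \<longleftrightarrow> i \<in> X"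
    if "i < d" "X \<subseteq> {..<d}" for d i X
    using b that by simp
  obtain big where "free_ultrafilter big" using free_ultrafilter_exists ..
  then interpret ultraproduct big G by (rule ultraproduct.intro)
  have graph: "is_graph (G n)" for n using C GC unfolding monotone_class_def by blast
  show False
  proof (rule no_shattered_sequence[where G = uprod and \<phi> = \<phi> and k = k and a = "\<lambda>i l. rep (\<lambda>n. a n i l)"])
    show "sym (edges uprod)"
    proof (rule symI)
      fix u v assume "(u, v) \<in> edges uprod"
      then obtain v' w' where vw: "u = rep v'" "v = rep w'" "big (\<lambda>n. (v' n, w' n) \<in> edges (G n))"
        by (auto simp: uprod_def)
      from vw(3) have "big (\<lambda>n. (w' n, v' n) \<in> edges (G n))"
        by (rule big_mono) (use graph in \<open>auto simp: is_graph_def\<close>)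
      then show "(v, u) \<in> edges uprod" by (simp add: vw(1,2) edges_uprod)
    qed
    show "fv \<phi> \<subseteq> {..<2 * k}" by (rule fv)
    show "\<exists>N. \<not> sd_embeds p N (edges uprod)" for p
    proof -
      obtain N where N: "N \<ge> 2" "\<And>n. \<not> sd_embeds p N (edges (G n))"
        using nowhere_dense_sd[OF C nd, of p] GC by blast
      have "\<not> sd_embeds p N (edges uprod)"
      proof
        let ?K = "subdivided_clique p N"
        assume "sd_embeds p N (edges uprod)"
        then obtain h where h: "inj_on h (verts ?K)" "\<forall>(u, v)\<in>edges ?K. (h u, h v) \<in> edges uprod"
          unfolding sd_embeds_def by blast
        have hrep: "rep (h u) = h u" if u: "u \<in> verts ?K" for u
        proof -
          obtain v where "(h u, h v) \<in> edges uprod" using sd_vertex_edge[OF N(1) u] h(2) by auto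
          then show ?thesis by (auto simp: uprod_def rep_rep)
        qed
        have sep: "big (\<lambda>n. h u n \<noteq> h v n)" if "u \<in> verts ?K" "v \<in> verts ?K" "u \<noteq> v" for u v
        proof -
          have "rep (h u) \<noteq> rep (h v)" using hrep that h(1) by (metis inj_onD)
          then show ?thesis by (simp add: rep_eq_iff big_not)
        qed
        \<comment> \<open>Injectivity becomes finitely many inequations, each true at a big set of
          indices.\<close>
        define D where "D = {x \<in> verts ?K \<times> verts ?K. fst x \<noteq> snd x}"
        have "finite D" by (simp add: D_def finite_sd_verts)
        then have "big (\<lambda>n. \<forall>x\<in>D. h (fst x) n \<noteq> h (snd x) n)"
          by (rule big_ball) (rule sep, auto simp: D_def)
        moreover have "big (\<lambda>n. (h (fst x) n, h (snd x) n) \<in> edges (G n))" if "x \<in> edges ?K" for x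
        proof -
          have "fst x \<in> verts ?K" "snd x \<in> verts ?K" using sd_edges_verts[of p N] that by auto
          then show ?thesis using edges_uprod[of "h (fst x)" "h (snd x)"] h(2) hrep that by auto
        qed
        then have "big (\<lambda>n. \<forall>x\<in>edges ?K. (h (fst x) n, h (snd x) n) \<in> edges (G n))"
          by (intro big_ball finite_subset[OF sd_edges_verts[of p N]]) (simp_all add: finite_sd_verts)
        ultimately have "big (\<lambda>n. (\<forall>x\<in>D. h (fst x) n \<noteq> h (snd x) n) \<and>
            (\<forall>x\<in>edges ?K. (h (fst x) n, h (snd x) n) \<in> edges (G n)))"
          by (simp only: big_conj)
        from big_ex[OF this] obtain n where n: "\<forall>x\<in>D. h (fst x) n \<noteq> h (snd x) n"
          "\<forall>x\<in>edges ?K. (h (fst x) n, h (snd x) n) \<in> edges (G n)"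
          by (elim exE conjE)
        have "sd_embeds p N (edges (G n))"
          unfolding sd_embeds_def
        proof (intro exI[of _ "\<lambda>u. h u n"] conjI)
          show "inj_on (\<lambda>u. h u n) (verts ?K)"
          proof (rule inj_onI, rule ccontr)
            fix u v assume "u \<in> verts ?K" "v \<in> verts ?K" "h u n = h v n" "u \<noteq> v"
            then show False using n(1)[rule_format, of "(u, v)"] by (simp add: D_def)
          qed
          show "\<forall>(u, v)\<in>edges ?K. (h u n, h v n) \<in> edges (G n)" using n(2) by auto
        qed
        then show False using N(2) by blast
      qed
      then show ?thesis by blast
    qed
    fix m and X :: "nat set" assume X: "X \<subseteq> {..<m}"
    define \<sigma> where "\<sigma> i = (\<lambda>x n. if x < k then a n i x else b n X (x - k))" for i
    have "sat uprod (\<lambda>x. if x < k then rep (\<lambda>n. a n i x) else rep (\<lambda>n. b n X (x - k))) \<phi> \<longleftrightarrow> i \<in> X" if "i < m" for i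
    proof -
      have eq: "(\<lambda>x. rep (\<sigma> i x)) = (\<lambda>x. if x < k then rep (\<lambda>n. a n i x) else rep (\<lambda>n. b n X (x - k)))"
        by (auto simp: \<sigma>_def)
      have s: "sat (G n) (\<lambda>x. \<sigma> i x n) \<phi> \<longleftrightarrow> i \<in> X" if "n \<ge> m" for n
      proof -
        have "i < n" "X \<subseteq> {..<n}" using X \<open>i < m\<close> that by auto
        then show ?thesis unfolding \<sigma>_def by (rule ab)
      qed
      show ?thesis
      proof (cases "i \<in> X")
        case True
        then have "big (\<lambda>n. sat (G n) (\<lambda>x. \<sigma> i x n) \<phi>)" using s by (intro big_cofinite[of m]) auto
        then show ?thesis using True Los[of "\<sigma> i" \<phi>] eq by simp
      next
        case False
        then have "big (\<lambda>n. \<not> sat (G n) (\<lambda>x. \<sigma> i x n) \<phi>)" using s by (intro big_cofinite[of m]) auto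
        then show ?thesis using False Los[of "\<sigma> i" \<phi>] eq by (simp add: big_not)
      qed
    qed
    then show "\<exists>b. \<forall>i<m. sat uprod (\<lambda>x. if x < k then rep (\<lambda>n. a n i x) else b (x - k)) \<phi> \<longleftrightarrow> i \<in> X"
      by (intro exI[of _ "\<lambda>l. rep (\<lambda>n. b n X l)"]) auto
  qed
qed

section \<open>Patterns in graphons that are not random-free\<close>

lemma bipartite_density_pos:
  fixes g :: "'a \<Rightarrow> 'a \<Rightarrow> ennreal"
  assumes "sigma_finite_measure N" and [measurable]: "case_prod g \<in> borel_measurable (N \<Otimes>\<^sub>M N)"
    and pos: "(\<integral>\<^sup>+ v. \<integral>\<^sup>+ u. g u v \<partial>N \<partial>N) \<noteq> 0"
    and IJ: "finite I" "finite J" "I \<inter> J = {}"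
  shows "(\<integral>\<^sup>+ z. (\<Prod>j\<in>J. \<Prod>i\<in>I. g (z i) (z j)) \<partial>Pi\<^sub>M (I \<union> J) (\<lambda>_. N)) \<noteq> 0"
proof
  interpret N: sigma_finite_measure N by fact
  interpret P: product_sigma_finite "\<lambda>_. N" ..
  interpret I: sigma_finite_measure "Pi\<^sub>M I (\<lambda>_. N)" by (rule P.sigma_finite[OF IJ(1)])
  interpret IN: pair_sigma_finite "Pi\<^sub>M I (\<lambda>_. N)" N ..
  define G where "G x = (\<integral>\<^sup>+ v. (\<Prod>i\<in>I. g (x i) v) \<partial>N)" for x
  have [measurable]: "G \<in> borel_measurable (Pi\<^sub>M I (\<lambda>_. N))" unfolding G_def by measurable
  assume "(\<integral>\<^sup>+ z. (\<Prod>j\<in>J. \<Prod>i\<in>I. g (z i) (z j)) \<partial>Pi\<^sub>M (I \<union> J) (\<lambda>_. N)) = 0"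
  also have "(\<integral>\<^sup>+ z. (\<Prod>j\<in>J. \<Prod>i\<in>I. g (z i) (z j)) \<partial>Pi\<^sub>M (I \<union> J) (\<lambda>_. N)) =
     (\<integral>\<^sup>+ x. \<integral>\<^sup>+ y. (\<Prod>j\<in>J. \<Prod>i\<in>I. g (merge I J (x, y) i) (merge I J (x, y) j)) \<partial>Pi\<^sub>M J (\<lambda>_. N) \<partial>Pi\<^sub>M I (\<lambda>_. N))"
    using IJ by (intro P.product_nn_integral_fold) measurable
  also have "\<dots> = (\<integral>\<^sup>+ x. G x ^ card J \<partial>Pi\<^sub>M I (\<lambda>_. N))"
  proof (rule nn_integral_cong)
    fix x assume x: "x \<in> space (Pi\<^sub>M I (\<lambda>_. N))"
    have "(\<integral>\<^sup>+ y. (\<Prod>j\<in>J. \<Prod>i\<in>I. g (merge I J (x, y) i) (merge I J (x, y) j)) \<partial>Pi\<^sub>M J (\<lambda>_. N)) =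
       (\<integral>\<^sup>+ y. (\<Prod>j\<in>J. \<Prod>i\<in>I. g (x i) (y j)) \<partial>Pi\<^sub>M J (\<lambda>_. N))"
      using IJ(3) by (intro nn_integral_cong prod.cong refl) (auto simp: merge_def)
    also have "\<dots> = (\<Prod>j\<in>J. \<integral>\<^sup>+ v. (\<Prod>i\<in>I. g (x i) v) \<partial>N)"
    proof (rule P.product_nn_integral_prod[OF IJ(2)])
      have "x i \<in> space N" if "i \<in> I" for i using x that by (auto simp: space_PiM PiE_mem)
      then show "(\<lambda>v. \<Prod>i\<in>I. g (x i) v) \<in> borel_measurable N"
        by (intro borel_measurable_prod_ennreal) measurable
    qed
    finally show "(\<integral>\<^sup>+ y. (\<Prod>j\<in>J. \<Prod>i\<in>I. g (merge I J (x, y) i) (merge I J (x, y) j)) \<partial>Pi\<^sub>M J (\<lambda>_. N)) = G x ^ card J"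
      by (simp add: G_def)
  qed
  finally have "AE x in Pi\<^sub>M I (\<lambda>_. N). G x ^ card J = 0"
    by (subst (asm) nn_integral_0_iff_AE) auto
  then have "AE x in Pi\<^sub>M I (\<lambda>_. N). G x = 0"
    by (rule AE_mp) (auto simp: power_eq_0_iff)
  then have "(\<integral>\<^sup>+ x. G x \<partial>Pi\<^sub>M I (\<lambda>_. N)) = 0"
    by (subst nn_integral_0_iff_AE) auto
  also have "(\<integral>\<^sup>+ x. G x \<partial>Pi\<^sub>M I (\<lambda>_. N)) = (\<integral>\<^sup>+ v. \<integral>\<^sup>+ x. (\<Prod>i\<in>I. g (x i) v) \<partial>Pi\<^sub>M I (\<lambda>_. N) \<partial>N)"
    unfolding G_def by (rule IN.Fubini'[symmetric]) measurable
  also have "\<dots> = (\<integral>\<^sup>+ v. (\<integral>\<^sup>+ u. g u v \<partial>N) ^ card I \<partial>N)"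
  proof (rule nn_integral_cong)
    fix v assume "v \<in> space N"
    then have "(\<integral>\<^sup>+ x. (\<Prod>i\<in>I. g (x i) v) \<partial>Pi\<^sub>M I (\<lambda>_. N)) = (\<Prod>i\<in>I. \<integral>\<^sup>+ u. g u v \<partial>N)"
      by (intro P.product_nn_integral_prod[OF IJ(1)]) measurable
    then show "(\<integral>\<^sup>+ x. (\<Prod>i\<in>I. g (x i) v) \<partial>Pi\<^sub>M I (\<lambda>_. N)) = (\<integral>\<^sup>+ u. g u v \<partial>N) ^ card I" by simp
  qed
  finally have "AE v in N. (\<integral>\<^sup>+ u. g u v \<partial>N) ^ card I = 0"
    by (subst (asm) nn_integral_0_iff_AE) auto
  then have "AE v in N. (\<integral>\<^sup>+ u. g u v \<partial>N) = 0"
    by (rule AE_mp) (auto simp: power_eq_0_iff)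
  then have "(\<integral>\<^sup>+ v. \<integral>\<^sup>+ u. g u v \<partial>N \<partial>N) = 0"
    by (subst nn_integral_0_iff_AE) auto
  then show False using pos by simp
qed

lemma prob_space_M01: "prob_space M01"
  unfolding M01_def by (rule prob_space_restrict_space) auto

lemma space_M01: "space M01 = {0..1}"
  by (simp add: M01_def space_restrict_space)

lemma W_proj_measurable:
  assumes "graphon W" "i \<in> V" "j \<in> V"
  shows "(\<lambda>x. W (x i) (x j)) \<in> borel_measurable (Pi\<^sub>M V (\<lambda>_. M01))"
proof -
  have W: "(\<lambda>z. W (fst z) (snd z)) \<in> borel_measurable (M01 \<Otimes>\<^sub>M M01)"
    using assms(1) by (simp add: graphon_def)
  have "(\<lambda>x. (x i, x j)) \<in> Pi\<^sub>M V (\<lambda>_. M01) \<rightarrow>\<^sub>M M01 \<Otimes>\<^sub>M M01"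
    using assms(2,3) by measurable
  from measurable_compose[OF this W] show ?thesis by simp
qed

lemma W_bounds:
  assumes "graphon W" "i \<in> V" "j \<in> V" "x \<in> space (Pi\<^sub>M V (\<lambda>_. M01))"
  shows "0 \<le> W (x i) (x j)" "W (x i) (x j) \<le> 1"
proof -
  have "x i \<in> {0..1}" "x j \<in> {0..1}" using assms(2-4) by (auto simp: space_PiM space_M01 PiE_iff)
  then show "0 \<le> W (x i) (x j)" "W (x i) (x j) \<le> 1" using assms(1) unfolding graphon_def by blast+
qed

lemma prob_PiM_M01: "prob_space (Pi\<^sub>M V (\<lambda>_. M01))"
  by (rule prob_space_PiM) (rule prob_space_M01)

lemma W_prod_integrable:
  assumes W: "graphon W" and T: "finite T" "T \<subseteq> V \<times> V"
  shows "integrable (Pi\<^sub>M V (\<lambda>_. M01)) (\<lambda>x. \<Prod>e\<in>T. W (x (fst e)) (x (snd e)))"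
proof -
  interpret prob_space "Pi\<^sub>M V (\<lambda>_. M01)" by (rule prob_PiM_M01)
  show ?thesis
  proof (rule integrable_const_bound[where B = 1])
    show "(\<lambda>x. \<Prod>e\<in>T. W (x (fst e)) (x (snd e))) \<in> borel_measurable (Pi\<^sub>M V (\<lambda>_. M01))"
      using T by (intro borel_measurable_prod W_proj_measurable[OF W]) auto
    show "AE x in Pi\<^sub>M V (\<lambda>_. M01). norm (\<Prod>e\<in>T. W (x (fst e)) (x (snd e))) \<le> 1"
    proof (rule AE_I2)
      fix x assume x: "x \<in> space (Pi\<^sub>M V (\<lambda>_. M01))"
      have "0 \<le> W (x (fst e)) (x (snd e))" "W (x (fst e)) (x (snd e)) \<le> 1" if "e \<in> T" for e
        using W_bounds[OF W _ _ x, of "fst e" "snd e"] T(2) that by auto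
      then show "norm (\<Prod>e\<in>T. W (x (fst e)) (x (snd e))) \<le> 1"
        by (auto simp: abs_prod intro!: prod_le_1)
    qed
  qed
qed

text \<open>The weight \<open>min W (1 - W)\<close> vanishes only where \<open>W\<close> is
  \<open>0\<close> or \<open>1\<close>, so its integral is not zero. Where the pattern product
  vanishes, the weight of some pair vanishes too, so a single bipartite density controls all
  patterns \<open>M\<close>.\<close>

lemma pattern_density_pos:
  assumes W: "graphon W" "\<not> random_free_graphon W" and IJ: "finite I" "finite J" "I \<inter> J = {}"
    and V: "V = I \<union> J" and M: "M \<subseteq> I \<times> J"
  shows "integral\<^sup>L (Pi\<^sub>M V (\<lambda>_. M01))
     (\<lambda>x. \<Prod>e\<in>I \<times> J. if e \<in> M then W (x (fst e)) (x (snd e)) else 1 - W (x (fst e)) (x (snd e))) > 0"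
proof -
  let ?P = "Pi\<^sub>M V (\<lambda>_. M01)"
  let ?\<Phi> = "\<lambda>x. \<Prod>e\<in>I \<times> J. if e \<in> M then W (x (fst e)) (x (snd e)) else 1 - W (x (fst e)) (x (snd e))"
  interpret P: prob_space ?P by (rule prob_PiM_M01)
  interpret N: prob_space M01 by (rule prob_space_M01)
  interpret NN: pair_sigma_finite M01 M01 ..
  have fin: "finite (I \<times> J)" using IJ by simp
  have sub: "fst e \<in> V" "snd e \<in> V" if "e \<in> I \<times> J" for e using that V by auto
  note Wm = W_proj_measurable[OF W(1)]
  have nonneg: "0 \<le> ?\<Phi> x" "?\<Phi> x \<le> 1" if x: "x \<in> space ?P" for x
    using W_bounds[OF W(1) sub x] by (auto intro!: prod_nonneg prod_le_1)
  have m: "?\<Phi> \<in> borel_measurable ?P"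
  proof (rule borel_measurable_prod)
    fix e assume e: "e \<in> I \<times> J"
    show "(\<lambda>x. if e \<in> M then W (x (fst e)) (x (snd e)) else 1 - W (x (fst e)) (x (snd e))) \<in> borel_measurable ?P"
      using Wm[OF sub[OF e]] by (cases "e \<in> M") auto
  qed
  have int: "integrable ?P ?\<Phi>"
    using m nonneg by (intro P.integrable_const_bound[where B = 1]) auto
  have Wmeas: "(\<lambda>z. W (fst z) (snd z)) \<in> borel_measurable (M01 \<Otimes>\<^sub>M M01)"
    using W(1) by (simp add: graphon_def)
  define g where "g u v = ennreal (min (W u v) (1 - W u v))" for u v
  have gm: "case_prod g \<in> borel_measurable (M01 \<Otimes>\<^sub>M M01)"
    unfolding g_def case_prod_beta' using Wmeas by measurable
  have gpos: "(\<integral>\<^sup>+ v. \<integral>\<^sup>+ u. g u v \<partial>M01 \<partial>M01) \<noteq> 0"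
  proof
    assume "(\<integral>\<^sup>+ v. \<integral>\<^sup>+ u. g u v \<partial>M01 \<partial>M01) = 0"
    then have "integral\<^sup>N (M01 \<Otimes>\<^sub>M M01) (case_prod g) = 0"
      using NN.nn_integral_snd[OF gm] by simp
    then have "AE z in M01 \<Otimes>\<^sub>M M01. case_prod g z = 0"
      using gm by (simp add: nn_integral_0_iff_AE)
    then have "AE z in M01 \<Otimes>\<^sub>M M01. W (fst z) (snd z) \<in> {0, 1}"
    proof (rule AE_mp, intro AE_I2 impI)
      fix z assume z: "z \<in> space (M01 \<Otimes>\<^sub>M M01)" "case_prod g z = 0"
      then have "fst z \<in> {0..1}" "snd z \<in> {0..1}" by (auto simp: space_pair_measure space_M01)
      then have "0 \<le> W (fst z) (snd z)" "W (fst z) (snd z) \<le> 1" using W(1) unfolding graphon_def by blast+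
      then show "W (fst z) (snd z) \<in> {0, 1}" using z(2) by (auto simp: g_def split_beta ennreal_eq_0_iff min_def split: if_splits)
    qed
    then show False using W(2) by (simp add: random_free_graphon_def)
  qed
  have "integral\<^sup>L ?P ?\<Phi> \<noteq> 0"
  proof
    assume "integral\<^sup>L ?P ?\<Phi> = 0"
    then have "AE x in ?P. ?\<Phi> x = 0"
      using integral_nonneg_eq_0_iff_AE[OF int] nonneg by auto
    then have "AE x in ?P. (\<Prod>j\<in>J. \<Prod>i\<in>I. g (x i) (x j)) = 0"
    proof (rule AE_mp, intro AE_I2 impI)
      fix x assume x: "x \<in> space ?P" "?\<Phi> x = 0"
      then obtain e where e: "e \<in> I \<times> J"
        "(if e \<in> M then W (x (fst e)) (x (snd e)) else 1 - W (x (fst e)) (x (snd e))) = 0"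
        using fin by (auto simp: prod_zero_iff)
      then have "g (x (fst e)) (x (snd e)) = 0" using W_bounds[OF W(1) sub[OF e(1)] x(1)]
        by (auto simp: g_def ennreal_eq_0_iff split: if_splits)
      then show "(\<Prod>j\<in>J. \<Prod>i\<in>I. g (x i) (x j)) = 0"
        using e(1) IJ by (intro prod_zero bexI[of _ "snd e"] bexI[of _ "fst e"]) auto
    qed
    then have "(\<integral>\<^sup>+ x. (\<Prod>j\<in>J. \<Prod>i\<in>I. g (x i) (x j)) \<partial>?P) = 0"
      by (subst nn_integral_cong_AE[of _ "\<lambda>_. 0"]) auto
    with bipartite_density_pos[OF N.sigma_finite_measure_axioms gm gpos IJ] show False
      unfolding V by simp
  qed
  moreover have "integral\<^sup>L ?P ?\<Phi> \<ge> 0" using nonneg by (intro integral_nonneg_AE) auto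
  ultimately show ?thesis by linarith
qed

section \<open>From densities of patterns to patterns in finite graphs\<close>

definition bip_graph :: "nat \<Rightarrow> (nat \<times> nat) set \<Rightarrow> nat graph" where
  "bip_graph n T = \<lparr> verts = {..<n}, edges = T \<union> T\<inverse> \<rparr>"

lemma hom_bip_graph:
  assumes "is_graph G" "finite T"
  shows "real (hom (bip_graph n T) G) =
    (\<Sum>f\<in>{..<n} \<rightarrow>\<^sub>E verts G. \<Prod>e\<in>T. of_bool ((f (fst e), f (snd e)) \<in> edges G))"
proof -
  have "{f \<in> {..<n} \<rightarrow>\<^sub>E verts G. \<forall>(u, v)\<in>T \<union> T\<inverse>. (f u, f v) \<in> edges G} =
     {f \<in> {..<n} \<rightarrow>\<^sub>E verts G. \<forall>e\<in>T. (f (fst e), f (snd e)) \<in> edges G}"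
    using assms(1) unfolding is_graph_def by fastforce
  moreover have "finite ({..<n} \<rightarrow>\<^sub>E verts G)"
    using assms(1) by (intro finite_PiE) (auto simp: is_graph_def)
  moreover have "(\<Prod>e\<in>T. of_bool ((f (fst e), f (snd e)) \<in> edges G)) =
      (of_bool (\<forall>e\<in>T. (f (fst e), f (snd e)) \<in> edges G) :: real)" for f
    using assms(2) by (induction T rule: finite_induct) auto
  ultimately show ?thesis
    by (simp add: hom_def bip_graph_def sum.If_cases of_bool_def Int_def flip: Collect_conj_eq)
qed

text \<open>Inclusion-exclusion over the non-edges. Convergence speaks of homomorphism counts only,
  and this expresses prescribed non-edges through prescribed edges.\<close>

lemma pattern_expand:
  fixes A :: "'e \<Rightarrow> real"
  assumes "finite B" "M \<subseteq> B"
  shows "(\<Prod>e\<in>B. if e \<in> M then A e else 1 - A e) = (\<Sum>X\<in>Pow (B - M). (-1) ^ card X * (\<Prod>e\<in>M \<union> X. A e))"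
proof -
  have fin: "finite M" "finite (B - M)" using assms finite_subset by auto
  have "(\<Prod>e\<in>B. if e \<in> M then A e else 1 - A e) = (\<Prod>e\<in>M. A e) * (\<Prod>e\<in>B - M. 1 - A e)"
    using assms by (subst prod.subset_diff[OF assms(2,1)]) (simp add: mult.commute)
  also have "(\<Prod>e\<in>B - M. 1 - A e) = (\<Sum>X\<in>Pow (B - M). (-1) ^ card X * (\<Prod>e\<in>X. A e))"
    by (subst prod_diff_conv_sum[OF fin(2)]) simp
  also have "(\<Prod>e\<in>M. A e) * (\<Sum>X\<in>Pow (B - M). (-1) ^ card X * (\<Prod>e\<in>X. A e)) =
     (\<Sum>X\<in>Pow (B - M). (-1) ^ card X * (\<Prod>e\<in>M \<union> X. A e))"
    unfolding sum_distrib_left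
  proof (rule sum.cong[OF refl])
    fix X assume "X \<in> Pow (B - M)"
    then have "(\<Prod>e\<in>M \<union> X. A e) = (\<Prod>e\<in>M. A e) * (\<Prod>e\<in>X. A e)"
      using fin finite_subset[of X "B - M"] by (intro prod.union_disjoint) auto
    then show "(\<Prod>e\<in>M. A e) * ((-1) ^ card X * (\<Prod>e\<in>X. A e)) = (-1) ^ card X * (\<Prod>e\<in>M \<union> X. A e)" by simp
  qed
  finally show ?thesis .
qed

lemma limit_contains_pattern:
  fixes k m :: nat
  assumes W: "graphon W" "\<not> random_free_graphon W" and conv: "L_convergent Gs W"
    and Gs: "\<And>n. is_graph (Gs n)" and M: "M \<subseteq> {..<k} \<times> {k..<k + m}"
  shows "\<exists>n f. (\<forall>x<k + m. f x \<in> verts (Gs n)) \<and>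
    (\<forall>i<k. \<forall>j\<in>{k..<k + m}. (f i, f j) \<in> edges (Gs n) \<longleftrightarrow> (i, j) \<in> M)"
proof -
  let ?B = "{..<k} \<times> {k..<k + m}"
  let ?V = "{..<k + m}"
  let ?P = "Pi\<^sub>M ?V (\<lambda>_. M01)"
  let ?J = "integral\<^sup>L ?P (\<lambda>x. \<Prod>e\<in>?B. if e \<in> M then W (x (fst e)) (x (snd e)) else 1 - W (x (fst e)) (x (snd e)))"
  have V: "?V = {..<k} \<union> {k..<k + m}" by auto
  have B: "finite ?B" by simp
  have BV: "X \<subseteq> ?B \<Longrightarrow> X \<subseteq> ?V \<times> ?V" for X by auto
  have Jpos: "?J > 0"
    by (rule pattern_density_pos[OF W _ _ _ V M]) auto
  have dens: "hom_density (bip_graph (k + m) T) W = integral\<^sup>L ?P (\<lambda>x. \<Prod>e\<in>T. W (x (fst e)) (x (snd e)))"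
    if "T \<subseteq> ?B" for T
  proof -
    have "{(i, j) \<in> T \<union> T\<inverse>. i < j} = T" using that by force
    then show ?thesis by (simp add: hom_density_def bip_graph_def)
  qed
  have J: "?J = (\<Sum>X\<in>Pow (?B - M). (-1) ^ card X * hom_density (bip_graph (k + m) (M \<union> X)) W)"
  proof -
    have "?J = integral\<^sup>L ?P (\<lambda>x. \<Sum>X\<in>Pow (?B - M). (-1) ^ card X * (\<Prod>e\<in>M \<union> X. W (x (fst e)) (x (snd e))))"
      by (simp only: pattern_expand[OF B M])
    also have "\<dots> = (\<Sum>X\<in>Pow (?B - M). integral\<^sup>L ?P (\<lambda>x. (-1) ^ card X * (\<Prod>e\<in>M \<union> X. W (x (fst e)) (x (snd e)))))"
    proof (rule Bochner_Integration.integral_sum)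
      fix X assume "X \<in> Pow (?B - M)"
      then have "M \<union> X \<subseteq> ?B" using M by auto
      then have "integrable ?P (\<lambda>x. \<Prod>e\<in>M \<union> X. W (x (fst e)) (x (snd e)))"
        using finite_subset[OF _ B] BV by (intro W_prod_integrable[OF W(1)]) auto
      then show "integrable ?P (\<lambda>x. (-1) ^ card X * (\<Prod>e\<in>M \<union> X. W (x (fst e)) (x (snd e))))" by simp
    qed
    also have "\<dots> = (\<Sum>X\<in>Pow (?B - M). (-1) ^ card X * hom_density (bip_graph (k + m) (M \<union> X)) W)"
      using M by (intro sum.cong refl) (subst dens, auto)
    finally show ?thesis .
  qed
  have graph: "is_graph (bip_graph (k + m) T)" if "T \<subseteq> ?B" for T
    using that by (auto simp: is_graph_def bip_graph_def)
  define c where "c n = real (card (verts (Gs n))) ^ (k + m)" for n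
  have lim: "(\<lambda>n. \<Sum>X\<in>Pow (?B - M). (-1) ^ card X * (real (hom (bip_graph (k + m) (M \<union> X)) (Gs n)) / c n)) \<longlonglongrightarrow> ?J"
    unfolding J
  proof (intro tendsto_sum tendsto_mult tendsto_const)
    fix X assume "X \<in> Pow (?B - M)"
    then have "is_graph (bip_graph (k + m) (M \<union> X))" using M by (intro graph) auto
    then have "(\<lambda>n. real (hom (bip_graph (k + m) (M \<union> X)) (Gs n)) / real (card (verts (Gs n))) ^ card (verts (bip_graph (k + m) (M \<union> X))))
       \<longlonglongrightarrow> hom_density (bip_graph (k + m) (M \<union> X)) W"
      using conv unfolding L_convergent_def by blast
    then show "(\<lambda>n. real (hom (bip_graph (k + m) (M \<union> X)) (Gs n)) / c n) \<longlonglongrightarrow> hom_density (bip_graph (k + m) (M \<union> X)) W"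
      by (simp add: c_def bip_graph_def)
  qed
  have "eventually (\<lambda>n. (\<Sum>X\<in>Pow (?B - M). (-1) ^ card X * (real (hom (bip_graph (k + m) (M \<union> X)) (Gs n)) / c n)) > 0) sequentially"
    using order_tendstoD(1)[OF lim Jpos] .
  then obtain n where n: "(\<Sum>X\<in>Pow (?B - M). (-1) ^ card X * (real (hom (bip_graph (k + m) (M \<union> X)) (Gs n)) / c n)) > 0"
    by (auto simp: eventually_sequentially)
  let ?F = "?V \<rightarrow>\<^sub>E verts (Gs n)"
  have "(\<Sum>X\<in>Pow (?B - M). (-1) ^ card X * (real (hom (bip_graph (k + m) (M \<union> X)) (Gs n)) / c n)) =
    (\<Sum>X\<in>Pow (?B - M). (-1) ^ card X * real (hom (bip_graph (k + m) (M \<union> X)) (Gs n))) / c n"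
    by (simp add: sum_divide_distrib)
  also have "(\<Sum>X\<in>Pow (?B - M). (-1) ^ card X * real (hom (bip_graph (k + m) (M \<union> X)) (Gs n))) =
    (\<Sum>X\<in>Pow (?B - M). \<Sum>f\<in>?F. (-1) ^ card X * (\<Prod>e\<in>M \<union> X. of_bool ((f (fst e), f (snd e)) \<in> edges (Gs n))))"
  proof (rule sum.cong[OF refl])
    fix X assume "X \<in> Pow (?B - M)"
    then have "M \<union> X \<subseteq> ?B" using M by auto
    then have "finite (M \<union> X)" using B by (rule finite_subset)
    then show "(-1) ^ card X * real (hom (bip_graph (k + m) (M \<union> X)) (Gs n)) =
       (\<Sum>f\<in>?F. (-1) ^ card X * (\<Prod>e\<in>M \<union> X. of_bool ((f (fst e), f (snd e)) \<in> edges (Gs n))))"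
      by (simp add: hom_bip_graph[OF Gs] sum_distrib_left)
  qed
  also have "\<dots> = (\<Sum>f\<in>?F. \<Sum>X\<in>Pow (?B - M). (-1) ^ card X * (\<Prod>e\<in>M \<union> X. of_bool ((f (fst e), f (snd e)) \<in> edges (Gs n))))"
    by (rule sum.swap)
  also have "\<dots> = (\<Sum>f\<in>?F. \<Prod>e\<in>?B. if e \<in> M then of_bool ((f (fst e), f (snd e)) \<in> edges (Gs n)) else 1 - of_bool ((f (fst e), f (snd e)) \<in> edges (Gs n)))"
    by (simp only: pattern_expand[OF B M])
  finally have "(\<Sum>f\<in>?F. \<Prod>e\<in>?B. if e \<in> M then of_bool ((f (fst e), f (snd e)) \<in> edges (Gs n)) else 1 - of_bool ((f (fst e), f (snd e)) \<in> edges (Gs n)) :: real) \<noteq> 0"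
    using n by auto
  \<comment> \<open>The summands are indicators of the pattern, so a non-zero sum provides a map
    that realises it.\<close>
  then obtain f where f: "f \<in> ?F" and
    "(\<Prod>e\<in>?B. if e \<in> M then of_bool ((f (fst e), f (snd e)) \<in> edges (Gs n)) else 1 - of_bool ((f (fst e), f (snd e)) \<in> edges (Gs n)) :: real) \<noteq> 0"
    by (rule sum.not_neutral_contains_not_neutral)
  then have nz: "\<forall>e\<in>?B. (if e \<in> M then of_bool ((f (fst e), f (snd e)) \<in> edges (Gs n)) else 1 - of_bool ((f (fst e), f (snd e)) \<in> edges (Gs n)) :: real) \<noteq> 0"
    using B by (simp only: prod_zero_iff) simp
  have "(f i, f j) \<in> edges (Gs n) \<longleftrightarrow> (i, j) \<in> M" if "i < k" "j \<in> {k..<k + m}" for i j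
    using bspec[OF nz, of "(i, j)"] that by (auto split: if_splits)
  then show ?thesis using f by (intro exI[of _ n] exI[of _ f]) (auto simp: PiE_iff)
qed

lemma limit_shatters:
  fixes d :: nat
  assumes W: "graphon W" "\<not> random_free_graphon W" and conv: "L_convergent Gs W"
    and Gs: "\<And>n. is_graph (Gs n)"
  shows "\<exists>n a b. (\<forall>i<d. a i \<in> verts (Gs n)) \<and> (\<forall>X\<subseteq>{..<d}. b X \<in> verts (Gs n)) \<and>
    (\<forall>i<d. \<forall>X\<subseteq>{..<d}. (a i, b X) \<in> edges (Gs n) \<longleftrightarrow> i \<in> X)"
proof -
  \<comment> \<open>The \<open>2 ^ d\<close> vertices of the second side stand for the subsets of
    \<open>{..<d}\<close> through their binary codes.\<close>
  define M where "M = {(i, j). i < d \<and> j \<in> {d..<d + 2 ^ d} \<and> i \<in> set_decode (j - d)}"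
  have "M \<subseteq> {..<d} \<times> {d..<d + 2 ^ d}" by (auto simp: M_def)
  from limit_contains_pattern[OF W conv Gs this] obtain n f where
    f: "\<forall>x<d + 2 ^ d. f x \<in> verts (Gs n)" and
    fM: "\<forall>i<d. \<forall>j\<in>{d..<d + 2 ^ d}. (f i, f j) \<in> edges (Gs n) \<longleftrightarrow> (i, j) \<in> M"
    by (elim exE conjE)
  have enc: "set_encode X < 2 ^ d \<and> set_decode (set_encode X) = X" if "X \<subseteq> {..<d}" for X
  proof -
    have "finite X" using that finite_subset by auto
    have "set_encode X \<le> set_encode {..<d}" unfolding set_encode_def using that by (intro sum_mono2) auto
    also have "set_encode {..<d} = 2 ^ d - 1" unfolding set_encode_def by (induction d) auto
    finally have "set_encode X < 2 ^ d" by (simp add: le_less_trans)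
    then show ?thesis using \<open>finite X\<close> by simp
  qed
  show ?thesis
  proof (intro exI conjI allI impI)
    show "f i \<in> verts (Gs n)" if "i < d" for i using f that by simp
    show "f (d + set_encode X) \<in> verts (Gs n)" if "X \<subseteq> {..<d}" for X using f enc[OF that] by simp
    show "(f i, f (d + set_encode X)) \<in> edges (Gs n) \<longleftrightarrow> i \<in> X" if "i < d" "X \<subseteq> {..<d}" for i X
      using fM[rule_format, of i "d + set_encode X"] enc[OF that(2)] that by (auto simp: M_def)
  qed
qed

section \<open>From nowhere dense classes to random-free interpretations\<close>

lemma sat_cong: "\<forall>x\<in>fv \<phi>. \<sigma> x = \<tau> x \<Longrightarrow> sat G \<sigma> \<phi> \<longleftrightarrow> sat G \<tau> \<phi>"
proof (induction \<phi> arbitrary: \<sigma> \<tau>)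
  case (Conj \<phi> \<psi>)
  have "sat G \<sigma> \<phi> \<longleftrightarrow> sat G \<tau> \<phi>" by (rule Conj.IH(1)) (use Conj.prems in auto)
  moreover have "sat G \<sigma> \<psi> \<longleftrightarrow> sat G \<tau> \<psi>" by (rule Conj.IH(2)) (use Conj.prems in auto)
  ultimately show ?case by simp
next
  case (Neg \<phi>)
  have "sat G \<sigma> \<phi> \<longleftrightarrow> sat G \<tau> \<phi>" by (rule Neg.IH) (use Neg.prems in auto)
  then show ?case by simp
next
  case (Ex x \<phi>)
  have "sat G (\<sigma>(x := v)) \<phi> \<longleftrightarrow> sat G (\<tau>(x := v)) \<phi>" for v
    by (rule Ex.IH) (use Ex.prems in auto)
  then show ?case by simp
qed simp_all

text \<open>An edge of the interpretation is witnessed by some pair of representatives; invariance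
  under the equivalence lets every pair decide.\<close>

lemma interp_edge_iff:
  fixes G :: "nat graph"
  assumes I: "interp_scheme I" and G: "is_graph G"
    and xs: "xs \<in> tuples (sk I) (verts G)" "sat0 I G xs" and ys: "ys \<in> tuples (sk I) (verts G)" "sat0 I G ys"
  shows "(eclass I G xs, eclass I G ys) \<in> edges (interp I G) \<longleftrightarrow> sat1 I G xs ys"
proof
  let ?T = "tuples (sk I) (verts G)"
  have refl: "\<forall>xs\<in>?T. satE I G xs xs"
    and inv: "\<forall>xs\<in>?T. \<forall>xs'\<in>?T. \<forall>ys\<in>?T. \<forall>ys'\<in>?T. satE I G xs xs' \<and> satE I G ys ys' \<longrightarrow>
               (sat1 I G xs ys \<longleftrightarrow> sat1 I G xs' ys')"
    using I G unfolding interp_scheme_def Let_def by blast+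
  assume "(eclass I G xs, eclass I G ys) \<in> edges (interp I G)"
  then obtain xs' ys' where *: "eclass I G xs = eclass I G xs'" "eclass I G ys = eclass I G ys'"
    "xs' \<in> ?T" "ys' \<in> ?T" "sat1 I G xs' ys'"
    unfolding interp_def by auto
  have "xs' \<in> eclass I G xs'" "ys' \<in> eclass I G ys'" using *(3,4) refl by (auto simp: eclass_def)
  then have "satE I G xs xs'" "satE I G ys ys'" using *(1,2) by (auto simp: eclass_def)
  then show "sat1 I G xs ys" using inv xs(1) ys(1) *(3-5) by blast
qed (use assms in \<open>auto simp: interp_def\<close>)

lemma nowhere_dense_interp:
  assumes C: "monotone_class C" and nd: "nowhere_dense C" and I: "interp_scheme I"
  shows "random_free_class (interp_class I C)"
  unfolding random_free_class_def
proof (intro allI impI, rule ccontr)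
  fix Gs W assume *: "(\<forall>n. Gs n \<in> interp_class I C) \<and> graphon W \<and> L_convergent Gs W" "\<not> random_free_graphon W"
  let ?k = "sk I"
  have "fv (s_th1 I) \<subseteq> {..<2 * ?k}" using I unfolding interp_scheme_def by blast
  from nowhere_dense_bounded_shattering[OF C nd this] obtain d :: nat where
    d: "\<forall>G\<in>C. \<forall>a b. \<exists>i<d. \<exists>X\<subseteq>{..<d}. \<not> (sat G (\<lambda>x. if x < ?k then a i x else b X (x - ?k)) (s_th1 I) \<longleftrightarrow> i \<in> X)" ..
  have graph: "is_graph (Gs n)" for n using *(1) by (auto simp: interp_class_def)
  obtain n a b where a: "\<forall>i<d. a i \<in> verts (Gs n)" and b: "\<forall>X\<subseteq>{..<d}. b X \<in> verts (Gs n)"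
    and ab: "\<forall>i<d. \<forall>X\<subseteq>{..<d}. (a i, b X) \<in> edges (Gs n) \<longleftrightarrow> i \<in> X"
    using limit_shatters[of W Gs d] *(1,2) graph by blast
  obtain G where G: "G \<in> C" "graph_iso (Gs n) (interp I G)" using *(1) by (auto simp: interp_class_def)
  have gG: "is_graph G" using C G(1) unfolding monotone_class_def by blast
  obtain h where h: "bij_betw h (verts (Gs n)) (verts (interp I G))"
    "\<forall>u\<in>verts (Gs n). \<forall>v\<in>verts (Gs n). (u, v) \<in> edges (Gs n) \<longleftrightarrow> (h u, h v) \<in> edges (interp I G)"
    using G(2) unfolding graph_iso_def by blast
  \<comment> \<open>Tuples representing the shattered vertices are shattered by \<open>s_th1\<close>
    in \<open>G\<close> itself.\<close>
  have "\<forall>v\<in>verts (Gs n). \<exists>xs. h v = eclass I G xs \<and> xs \<in> tuples ?k (verts G) \<and> sat0 I G xs"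
  proof
    fix v assume "v \<in> verts (Gs n)"
    then have "h v \<in> verts (interp I G)" using h(1) by (auto simp: bij_betw_def)
    then show "\<exists>xs. h v = eclass I G xs \<and> xs \<in> tuples ?k (verts G) \<and> sat0 I G xs" by (auto simp: interp_def)
  qed
  from bchoice[OF this] obtain r where
    r: "\<forall>v\<in>verts (Gs n). h v = eclass I G (r v) \<and> r v \<in> tuples ?k (verts G) \<and> sat0 I G (r v)" ..
  have edge: "sat G (\<lambda>x. if x < ?k then r u ! x else r v ! (x - ?k)) (s_th1 I) \<longleftrightarrow> (u, v) \<in> edges (Gs n)"
    if "u \<in> verts (Gs n)" "v \<in> verts (Gs n)" for u v
  proof -
    have "(\<lambda>x. if x < ?k then r u ! x else r v ! (x - ?k)) = asg ?k (r u) (r v)" by (auto simp: asg_def)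
    then show ?thesis
      using interp_edge_iff[OF I gG, of "r u" "r v"] r h(2) that by (simp add: sat1_def)
  qed
  obtain i X where iX: "i < d" "X \<subseteq> {..<d}"
    "\<not> (sat G (\<lambda>x. if x < ?k then r (a i) ! x else r (b X) ! (x - ?k)) (s_th1 I) \<longleftrightarrow> i \<in> X)"
    using d[rule_format, OF G(1), of "\<lambda>i l. r (a i) ! l" "\<lambda>X l. r (b X) ! l"] by blast
  then show False using edge[of "a i" "b X"] a b ab by blast
qed

section \<open>Basic schemes as a special case of interpretation schemes\<close>

lemma random_free_class_mono: "random_free_class D \<Longrightarrow> C \<subseteq> D \<Longrightarrow> random_free_class C"
  unfolding random_free_class_def by blast

lemma graph_iso_trans:
  assumes "graph_iso F G" "graph_iso G H"
  shows "graph_iso F H"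
proof -
  obtain f where f: "bij_betw f (verts F) (verts G)"
    "\<forall>u\<in>verts F. \<forall>v\<in>verts F. (u, v) \<in> edges F \<longleftrightarrow> (f u, f v) \<in> edges G"
    using assms(1) unfolding graph_iso_def by blast
  obtain g where g: "bij_betw g (verts G) (verts H)"
    "\<forall>u\<in>verts G. \<forall>v\<in>verts G. (u, v) \<in> edges G \<longleftrightarrow> (g u, g v) \<in> edges H"
    using assms(2) unfolding graph_iso_def by blast
  have "f u \<in> verts G" if "u \<in> verts F" for u using f(1) that by (auto simp: bij_betw_def)
  then show ?thesis unfolding graph_iso_def
    using f g by (intro exI[of _ "g \<circ> f"]) (auto intro: bij_betw_trans)
qed

definition scheme_of :: "fo \<Rightarrow> scheme" where
  "scheme_of \<theta> = \<lparr> sk = 1, s_eq = Eq 0 1, s_th0 = Tru, s_th1 = \<theta> \<rparr>"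

lemma tuples_1: "tuples (Suc 0) A = (\<lambda>v. [v]) ` A"
  by (auto simp: tuples_def length_Suc_conv)

lemma scheme_of_sat1:
  assumes "basic_scheme \<theta>"
  shows "sat1 (scheme_of \<theta>) G [u] [v] \<longleftrightarrow> sat G ((\<lambda>_. u)(1 := v)) \<theta>"
  unfolding sat1_def scheme_of_def
  by (simp, rule sat_cong) (use assms in \<open>auto simp: basic_scheme_def asg_def\<close>)

lemma scheme_of_satE: "satE (scheme_of \<theta>) G [u] [v] \<longleftrightarrow> u = v"
  by (simp add: satE_def scheme_of_def asg_def)

lemma scheme_of_sat0: "sat0 (scheme_of \<theta>) G xs"
  by (simp add: sat0_def scheme_of_def)

lemma interp_scheme_scheme_of:
  assumes "basic_scheme \<theta>"
  shows "interp_scheme (scheme_of \<theta>)"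
proof -
  note b = assms[unfolded basic_scheme_def]
  have fv: "fv \<theta> \<subseteq> {0, 1}" by (rule conjunct1[OF b])
  have sk: "sk (scheme_of \<theta>) = Suc 0" by (simp add: scheme_of_def)
  have "fv \<theta> \<subseteq> {..<2}" using fv by auto
  then have fvs: "fv (s_eq (scheme_of \<theta>)) \<subseteq> {..<2 * Suc 0}" "fv (s_th0 (scheme_of \<theta>)) \<subseteq> {..<Suc 0}"
    "fv (s_th1 (scheme_of \<theta>)) \<subseteq> {..<2 * Suc 0}"
    by (auto simp: scheme_of_def)
  have upd: "(\<lambda>_. u)(1 := u) = (\<lambda>_. u)" for u :: nat by auto
  show ?thesis
    unfolding interp_scheme_def Let_def sk tuples_1 Set.ball_simps(9) scheme_of_satE scheme_of_sat1[OF assms] eqTrueI[OF scheme_of_sat0] upd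
  proof (intro conjI allI impI)
    fix G :: "nat graph" assume "is_graph G"
    then show "\<forall>u\<in>verts G. \<forall>v\<in>verts G. True \<and> True \<and> sat G ((\<lambda>_. u)(1 := v)) \<theta> \<longrightarrow> sat G ((\<lambda>_. v)(1 := u)) \<theta>"
      "\<forall>u\<in>verts G. True \<longrightarrow> \<not> sat G (\<lambda>_. u) \<theta>" using conjunct2[OF b] by simp_all
  qed (use fvs in simp_all)
qed

text \<open>The equivalence of \<open>scheme_of\<close> is equality, so classes are singletons and
  \<open>v\<close> corresponds to \<open>{[v]}\<close>.\<close>

lemma basic_interp_iso:
  fixes G :: "nat graph"
  assumes "basic_scheme \<theta>" "is_graph G"
  shows "graph_iso (basic_interp \<theta> G) (interp (scheme_of \<theta>) G)"
proof -
  let ?I = "scheme_of \<theta>"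
  have sk: "sk ?I = Suc 0" by (simp add: scheme_of_def)
  have cl: "eclass ?I G [v] = {[v]}" if "v \<in> verts G" for v
    using that by (auto simp: eclass_def sk tuples_1 scheme_of_satE)
  have V: "verts (interp ?I G) = (\<lambda>v. {[v]}) ` verts G"
  proof -
    have "verts (interp ?I G) = (\<lambda>v. eclass ?I G [v]) ` verts G"
      by (auto simp: interp_def sk tuples_1 scheme_of_sat0)
    also have "\<dots> = (\<lambda>v. {[v]}) ` verts G" by (rule image_cong[OF refl]) (rule cl)
    finally show ?thesis .
  qed
  show ?thesis
    unfolding graph_iso_def
  proof (intro exI[of _ "\<lambda>v. {[v]}"] conjI ballI)
    show "bij_betw (\<lambda>v. {[v]}) (verts (basic_interp \<theta> G)) (verts (interp ?I G))"
      unfolding V by (simp add: bij_betw_def basic_interp_def inj_on_def)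
    fix u v assume "u \<in> verts (basic_interp \<theta> G)" "v \<in> verts (basic_interp \<theta> G)"
    then have uv: "u \<in> verts G" "v \<in> verts G" by (simp_all add: basic_interp_def)
    have "(eclass ?I G [u], eclass ?I G [v]) \<in> edges (interp ?I G) \<longleftrightarrow> sat1 ?I G [u] [v]"
      using uv by (intro interp_edge_iff interp_scheme_scheme_of assms scheme_of_sat0) (simp_all add: sk tuples_1)
    then show "(u, v) \<in> edges (basic_interp \<theta> G) \<longleftrightarrow> ({[u]}, {[v]}) \<in> edges (interp ?I G)"
      using uv by (simp add: cl scheme_of_sat1[OF assms(1)] basic_interp_def)
  qed
qed

lemma basic_interp_class_subset:
  assumes "monotone_class C" "basic_scheme \<theta>"
  shows "basic_interp_class \<theta> C \<subseteq> interp_class (scheme_of \<theta>) C"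
proof
  fix H assume "H \<in> basic_interp_class \<theta> C"
  then obtain G where "is_graph H" "G \<in> C" "graph_iso H (basic_interp \<theta> G)"
    by (auto simp: basic_interp_class_def)
  moreover have "is_graph G" using assms(1) \<open>G \<in> C\<close> unfolding monotone_class_def by blast
  ultimately show "H \<in> interp_class (scheme_of \<theta>) C"
    using graph_iso_trans[OF _ basic_interp_iso[OF assms(2)]] by (auto simp: interp_class_def)
qed

section \<open>Parity graphs and blow-ups\<close>

text \<open>A sum of signs is smaller in absolute value than their number once two signs differ.
  Here \<open>c = {}\<close> gives \<open>1\<close>, and the two ends of a pair in \<open>X\<close>
  give \<open>-1\<close>, since \<open>X\<close> contains that pair in one orientation only.\<close>

lemma card_pow_sign_sum:
  fixes X :: "(nat \<times> nat) set"
  assumes V: "finite V" and X: "X \<subseteq> {(i, j) \<in> V \<times> V. i < j}" "X \<noteq> {}"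
  shows "\<bar>\<Sum>c\<in>Pow V. \<Prod>e\<in>X. if fst e \<in> c \<and> snd e \<in> c then -1 else (1::real)\<bar> < 2 ^ card V"
proof -
  define \<phi> where "\<phi> c = (\<Prod>e\<in>X. if fst e \<in> c \<and> snd e \<in> c then -1 else (1::real))" for c
  obtain u v where uv: "(u, v) \<in> X" "u \<in> V" "v \<in> V" "u < v" using X by auto
  have fX: "finite X" using X(1) V finite_subset[of X "V \<times> V"] by auto
  have 0: "\<phi> {} = 1" by (simp add: \<phi>_def)
  have "\<phi> {u, v} = (\<Prod>e\<in>X. if e = (u, v) then -1 else 1)"
    unfolding \<phi>_def using X(1) uv(4) by (intro prod.cong refl) auto
  also have "\<dots> = -1" using fX uv(1) by simp
  finally have 1: "\<phi> {u, v} = -1" .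
  have abs: "\<bar>\<phi> c\<bar> = 1" for c unfolding \<phi>_def abs_prod by (rule prod.neutral) auto
  have sub: "{{}, {u, v}} \<subseteq> Pow V" using uv by auto
  have "(\<Sum>c\<in>Pow V. \<phi> c) = (\<Sum>c\<in>Pow V - {{}, {u, v}}. \<phi> c) + (\<Sum>c\<in>{{}, {u, v}}. \<phi> c)"
    using V sub by (intro sum.subset_diff) auto
  also have "(\<Sum>c\<in>{{}, {u, v}}. \<phi> c) = 0" by (simp add: 0 1)
  finally have "\<bar>\<Sum>c\<in>Pow V. \<phi> c\<bar> \<le> (\<Sum>c\<in>Pow V - {{}, {u, v}}. \<bar>\<phi> c\<bar>)" by simp
  also have "\<dots> = real (card (Pow V - {{}, {u, v}}))" by (simp add: abs)
  also have "\<dots> < real (card (Pow V))"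
    using V sub by (intro of_nat_less_iff[THEN iffD2] psubset_card_mono) auto
  also have "\<dots> = 2 ^ card V" using V by (simp add: card_Pow)
  finally show ?thesis by (simp add: \<phi>_def)
qed

lemma transpose_bij:
  "bij_betw (\<lambda>c. \<lambda>u\<in>V. {l \<in> D. u \<in> c l}) (D \<rightarrow>\<^sub>E Pow V) (V \<rightarrow>\<^sub>E Pow D)"
proof (rule bij_betw_byWitness[where f' = "\<lambda>r. \<lambda>l\<in>D. {u \<in> V. l \<in> r u}"])
  show "\<forall>c\<in>D \<rightarrow>\<^sub>E Pow V. (\<lambda>l\<in>D. {u \<in> V. l \<in> (\<lambda>u\<in>V. {l \<in> D. u \<in> c l}) u}) = c"
  proof
    fix c assume c: "c \<in> D \<rightarrow>\<^sub>E Pow V"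
    show "(\<lambda>l\<in>D. {u \<in> V. l \<in> (\<lambda>u\<in>V. {l \<in> D. u \<in> c l}) u}) = c"
    proof
      fix l show "(\<lambda>l\<in>D. {u \<in> V. l \<in> (\<lambda>u\<in>V. {l \<in> D. u \<in> c l}) u}) l = c l"
      proof (cases "l \<in> D")
        case True
        then have "c l \<subseteq> V" using PiE_mem[OF c] by blast
        with True show ?thesis by (auto simp: restrict_def)
      next
        case False
        then show ?thesis using PiE_arb[OF c] by simp
      qed
    qed
  qed
  show "\<forall>r\<in>V \<rightarrow>\<^sub>E Pow D. (\<lambda>u\<in>V. {l \<in> D. u \<in> (\<lambda>l\<in>D. {u \<in> V. l \<in> r u}) l}) = r"
  proof
    fix r assume r: "r \<in> V \<rightarrow>\<^sub>E Pow D"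
    show "(\<lambda>u\<in>V. {l \<in> D. u \<in> (\<lambda>l\<in>D. {u \<in> V. l \<in> r u}) l}) = r"
    proof
      fix u show "(\<lambda>u\<in>V. {l \<in> D. u \<in> (\<lambda>l\<in>D. {u \<in> V. l \<in> r u}) l}) u = r u"
      proof (cases "u \<in> V")
        case True
        then have "r u \<subseteq> D" using PiE_mem[OF r] by blast
        with True show ?thesis by (auto simp: restrict_def)
      next
        case False
        then show ?thesis using PiE_arb[OF r] by simp
      qed
    qed
  qed
qed auto

text \<open>Transposing the incidence matrix of a tuple of subsets makes the coordinates independent.\<close>
lemma character_sum:
  fixes X :: "(nat \<times> nat) set"
  assumes V: "finite V" and X: "X \<subseteq> V \<times> V"
  shows "(\<Sum>r\<in>V \<rightarrow>\<^sub>E Pow {..<d}. \<Prod>e\<in>X. (-1) ^ card (r (fst e) \<inter> r (snd e))) =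
    (\<Sum>c\<in>Pow V. \<Prod>e\<in>X. if fst e \<in> c \<and> snd e \<in> c then -1 else (1::real)) ^ d"
proof -
  define \<phi> where "\<phi> c = (\<Prod>e\<in>X. if fst e \<in> c \<and> snd e \<in> c then -1 else (1::real))" for c
  have fX: "finite X" using X V finite_subset[of X "V \<times> V"] by auto
  have "(\<Sum>r\<in>V \<rightarrow>\<^sub>E Pow {..<d}. \<Prod>e\<in>X. (-1) ^ card (r (fst e) \<inter> r (snd e)) :: real) =
    (\<Sum>c\<in>{..<d} \<rightarrow>\<^sub>E Pow V. \<Prod>e\<in>X. (-1) ^ card ((\<lambda>u\<in>V. {l \<in> {..<d}. u \<in> c l}) (fst e) \<inter> (\<lambda>u\<in>V. {l \<in> {..<d}. u \<in> c l}) (snd e)))"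
    by (rule sum.reindex_bij_betw[OF transpose_bij, symmetric])
  also have "\<dots> = (\<Sum>c\<in>{..<d} \<rightarrow>\<^sub>E Pow V. \<Prod>l<d. \<phi> (c l))"
  proof (rule sum.cong[OF refl])
    fix c
    have "(-1) ^ card ((\<lambda>u\<in>V. {l \<in> {..<d}. u \<in> c l}) (fst e) \<inter> (\<lambda>u\<in>V. {l \<in> {..<d}. u \<in> c l}) (snd e)) =
       (\<Prod>l<d. if fst e \<in> c l \<and> snd e \<in> c l then -1 else (1::real))" if "e \<in> X" for e
    proof -
      have "(\<lambda>u\<in>V. {l \<in> {..<d}. u \<in> c l}) (fst e) \<inter> (\<lambda>u\<in>V. {l \<in> {..<d}. u \<in> c l}) (snd e) =
         {l \<in> {..<d}. fst e \<in> c l \<and> snd e \<in> c l}"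
        using that X by (auto simp: restrict_def)
      then show ?thesis by (simp add: prod.If_cases Int_def)
    qed
    then have "(\<Prod>e\<in>X. (-1) ^ card ((\<lambda>u\<in>V. {l \<in> {..<d}. u \<in> c l}) (fst e) \<inter> (\<lambda>u\<in>V. {l \<in> {..<d}. u \<in> c l}) (snd e))) =
      (\<Prod>e\<in>X. \<Prod>l<d. if fst e \<in> c l \<and> snd e \<in> c l then -1 else (1::real))"
      by (rule prod.cong[OF refl])
    also have "\<dots> = (\<Prod>l<d. \<phi> (c l))" unfolding \<phi>_def by (rule prod.swap)
    finally show "(\<Prod>e\<in>X. (-1) ^ card ((\<lambda>u\<in>V. {l \<in> {..<d}. u \<in> c l}) (fst e) \<inter> (\<lambda>u\<in>V. {l \<in> {..<d}. u \<in> c l}) (snd e))) = (\<Prod>l<d. \<phi> (c l))" .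
  qed
  also have "\<dots> = (\<Prod>l<d. \<Sum>c\<in>Pow V. \<phi> c)"
    by (rule prod_sum_PiE[symmetric]) (use V in auto)
  also have "\<dots> = (\<Sum>c\<in>Pow V. \<phi> c) ^ d" by simp
  finally show ?thesis by (simp add: \<phi>_def)
qed

text \<open>Oddness of \<open>c\<close> has the indicator \<open>(1 - (-1) ^ c) / 2\<close>.
  Multiplying out over the edges gives one character sum for each set \<open>X\<close> of edges, a
  \<open>d\<close>-th power whose normalised base has absolute value below \<open>1\<close> unless
  \<open>X = {}\<close>. Only that term survives.\<close>

lemma parity_hom_limit:
  assumes F: "is_graph (F :: nat graph)"
  shows "(\<lambda>d. real (card {r \<in> verts F \<rightarrow>\<^sub>E Pow {..<d}. \<forall>(u, v)\<in>edges F. odd (card (r u \<inter> r v))}) / (2 ^ d) ^ card (verts F))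
    \<longlonglongrightarrow> (1 / 2) ^ card {(i, j) \<in> edges F. i < j}"
proof -
  let ?V = "verts F"
  define T where "T = {(i, j) \<in> edges F. i < j}"
  have V: "finite ?V" using F by (simp add: is_graph_def)
  have TV: "T \<subseteq> {(i, j) \<in> ?V \<times> ?V. i < j}" using F by (auto simp: T_def is_graph_def)
  have fT: "finite T" using TV V finite_subset[of T "?V \<times> ?V"] by auto
  define s where "s X = (\<Sum>c\<in>Pow ?V. \<Prod>e\<in>X. if fst e \<in> c \<and> snd e \<in> c then -1 else (1::real))" for X
  have count: "real (card {r \<in> ?V \<rightarrow>\<^sub>E Pow {..<d}. \<forall>(u, v)\<in>edges F. odd (card (r u \<inter> r v))}) =
     (1 / 2) ^ card T * (\<Sum>X\<in>Pow T. (-1) ^ card X * s X ^ d)" for d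
  proof -
    let ?R = "?V \<rightarrow>\<^sub>E Pow {..<d}"
    have fR: "finite ?R" using V by (intro finite_PiE) auto
    have "{r \<in> ?R. \<forall>(u, v)\<in>edges F. odd (card (r u \<inter> r v))} = {r \<in> ?R. \<forall>e\<in>T. odd (card (r (fst e) \<inter> r (snd e)))}"
    proof -
      have "(\<forall>(u, v)\<in>edges F. odd (card (r u \<inter> r v))) \<longleftrightarrow> (\<forall>e\<in>T. odd (card (r (fst e) \<inter> r (snd e))))" for r :: "nat \<Rightarrow> nat set"
      proof
        assume T: "\<forall>e\<in>T. odd (card (r (fst e) \<inter> r (snd e)))"
        show "\<forall>(u, v)\<in>edges F. odd (card (r u \<inter> r v))"
        proof (intro ballI, clarify)
          fix u v assume uv: "(u, v) \<in> edges F" "even (card (r u \<inter> r v))"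
          then have "(v, u) \<in> edges F" "u \<noteq> v" using F by (auto simp: is_graph_def)
          then have "(u, v) \<in> T \<or> (v, u) \<in> T" using uv by (auto simp: T_def)
          then show False using T uv(2) by (auto simp: Int_commute)
        qed
      qed (auto simp: T_def)
      then show ?thesis by simp
    qed
    then have "real (card {r \<in> ?R. \<forall>(u, v)\<in>edges F. odd (card (r u \<inter> r v))}) =
       (\<Sum>r\<in>?R. of_bool (\<forall>e\<in>T. odd (card (r (fst e) \<inter> r (snd e)))))"
      using fR by (simp add: of_bool_def sum.If_cases Int_def)
    also have "\<dots> = (\<Sum>r\<in>?R. (1 / 2) ^ card T * (\<Sum>X\<in>Pow T. (-1) ^ card X * (\<Prod>e\<in>X. (-1) ^ card (r (fst e) \<inter> r (snd e)))))"
    proof (rule sum.cong[OF refl])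
      fix r
      have "of_bool (\<forall>e\<in>T. odd (card (r (fst e) \<inter> r (snd e)))) = (\<Prod>e\<in>T. (1 / 2) * (1 - (-1) ^ card (r (fst e) \<inter> r (snd e))) :: real)"
      proof (cases "\<forall>e\<in>T. odd (card (r (fst e) \<inter> r (snd e)))")
        case True
        then show ?thesis by simp
      next
        case False
        then obtain e where "e \<in> T" "even (card (r (fst e) \<inter> r (snd e)))" by blast
        then have "(\<Prod>e\<in>T. (1 / 2) * (1 - (-1) ^ card (r (fst e) \<inter> r (snd e))) :: real) = 0"
          using fT by (intro prod_zero bexI[of _ e]) auto
        then show ?thesis using False by simp
      qed
      also have "\<dots> = (1 / 2) ^ card T * (\<Prod>e\<in>T. 1 - (-1) ^ card (r (fst e) \<inter> r (snd e)))"
        by (simp only: prod.distrib prod_constant)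
      also have "(\<Prod>e\<in>T. 1 - (-1) ^ card (r (fst e) \<inter> r (snd e)) :: real) = (\<Sum>X\<in>Pow T. (-1) ^ card X * (\<Prod>e\<in>X. (-1) ^ card (r (fst e) \<inter> r (snd e))))"
        by (subst prod_diff_conv_sum[OF fT]) simp
      finally show "of_bool (\<forall>e\<in>T. odd (card (r (fst e) \<inter> r (snd e)))) = (1 / 2) ^ card T * (\<Sum>X\<in>Pow T. (-1) ^ card X * (\<Prod>e\<in>X. (-1) ^ card (r (fst e) \<inter> r (snd e))) :: real)" .
    qed
    also have "\<dots> = (1 / 2) ^ card T * (\<Sum>X\<in>Pow T. (-1) ^ card X * (\<Sum>r\<in>?R. \<Prod>e\<in>X. (-1) ^ card (r (fst e) \<inter> r (snd e))))"
      unfolding sum_distrib_left by (rule sum.swap)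
    also have "(\<Sum>X\<in>Pow T. (-1) ^ card X * (\<Sum>r\<in>?R. \<Prod>e\<in>X. (-1) ^ card (r (fst e) \<inter> r (snd e)))) = (\<Sum>X\<in>Pow T. (-1) ^ card X * s X ^ d)"
      using TV unfolding s_def by (intro sum.cong refl arg_cong2[where f = "(*)"] character_sum[OF V]) auto
    finally show ?thesis .
  qed
  have lim: "(\<lambda>d. (s X / 2 ^ card ?V) ^ d) \<longlonglongrightarrow> of_bool (X = {})" if "X \<subseteq> T" for X
  proof (cases "X = {}")
    case True
    then have "s X = 2 ^ card ?V" using V by (simp add: s_def card_Pow)
    then show ?thesis using True by simp
  next
    case False
    have "\<bar>s X\<bar> < 2 ^ card ?V" unfolding s_def using TV that False by (intro card_pow_sign_sum[OF V]) auto
    then have "\<bar>s X / 2 ^ card ?V\<bar> < 1" by simp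
    then show ?thesis using False LIMSEQ_power_zero[of "s X / 2 ^ card ?V"] by simp
  qed
  have "(\<lambda>d. (1 / 2) ^ card T * (\<Sum>X\<in>Pow T. (-1) ^ card X * (s X / 2 ^ card ?V) ^ d)) \<longlonglongrightarrow> (1 / 2) ^ card T * (\<Sum>X\<in>Pow T. (-1) ^ card X * of_bool (X = {}))"
    by (intro tendsto_intros lim) auto
  also have "(\<Sum>X\<in>Pow T. (-1) ^ card X * of_bool (X = {}) :: real) = (\<Sum>X\<in>Pow T. if X = {} then 1 else 0)"
    by (rule sum.cong) auto
  also have "\<dots> = 1" using fT by (subst sum.delta) auto
  finally show ?thesis
    unfolding count T_def[symmetric] power_divide sum_distrib_left sum_divide_distrib
    by (simp add: power_mult[symmetric] mult.commute[of "card ?V"])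
qed

section \<open>Perturbations and balanced blow-ups\<close>

lemma card_PiE_two_le:
  assumes "finite I" "finite V" "u \<in> I" "v \<in> I" "u \<noteq> v" "finite \<Delta>"
  shows "card {f \<in> I \<rightarrow>\<^sub>E V. (f u, f v) \<in> \<Delta>} \<le> card \<Delta> * card V ^ (card I - 2)"
proof -
  let ?I = "I - {u, v}"
  let ?g = "\<lambda>f. ((f u, f v), restrict f ?I)"
  have "inj_on ?g {f \<in> I \<rightarrow>\<^sub>E V. (f u, f v) \<in> \<Delta>}"
  proof (rule inj_onI, rule ext)
    fix f g x assume f: "f \<in> {f \<in> I \<rightarrow>\<^sub>E V. (f u, f v) \<in> \<Delta>}" and g: "g \<in> {f \<in> I \<rightarrow>\<^sub>E V. (f u, f v) \<in> \<Delta>}"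
      and eq: "?g f = ?g g"
    have r: "restrict f ?I = restrict g ?I" "f u = g u" "f v = g v" using eq by auto
    consider "x \<in> {u, v}" | "x \<in> ?I" | "x \<notin> I" by auto
    then show "f x = g x"
    proof cases
      case 2
      then show ?thesis using fun_cong[OF r(1), of x] by simp
    next
      case 3
      have "f \<in> I \<rightarrow>\<^sub>E V" "g \<in> I \<rightarrow>\<^sub>E V" using f g by blast+
      then show ?thesis using PiE_arb[of f I _ x] PiE_arb[of g I _ x] 3 by simp
    qed (use r in auto)
  qed
  moreover have "?g ` {f \<in> I \<rightarrow>\<^sub>E V. (f u, f v) \<in> \<Delta>} \<subseteq> \<Delta> \<times> (?I \<rightarrow>\<^sub>E V)"
    by (auto simp: PiE_iff extensional_def split: if_splits)
  moreover have "finite (\<Delta> \<times> (?I \<rightarrow>\<^sub>E V))" using assms by (intro finite_cartesian_product finite_PiE) auto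
  ultimately have "card {f \<in> I \<rightarrow>\<^sub>E V. (f u, f v) \<in> \<Delta>} \<le> card (\<Delta> \<times> (?I \<rightarrow>\<^sub>E V))"
    by (rule card_inj_on_le)
  also have "\<dots> = card \<Delta> * card V ^ card ?I"
    using assms by (simp add: card_cartesian_product card_PiE)
  also have "card ?I = card I - 2" using assms by (simp add: card_Diff_subset)
  finally show ?thesis .
qed

text \<open>A map is counted differently only if it sends some edge of \<open>F\<close> into
  \<open>\<Delta>\<close>. Two of its values are then confined to \<open>\<Delta>\<close> and the
  others are free.\<close>

lemma edit_distance:
  assumes F: "is_graph (F :: nat graph)" and V: "finite V" and \<Delta>: "\<Delta> = {(x, y) \<in> V \<times> V. R x y \<noteq> R' x y}"
  shows "\<bar>real (card {f \<in> verts F \<rightarrow>\<^sub>E V. \<forall>(u, v)\<in>edges F. R (f u) (f v)}) -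
      real (card {f \<in> verts F \<rightarrow>\<^sub>E V. \<forall>(u, v)\<in>edges F. R' (f u) (f v)})\<bar> / real (card V) ^ card (verts F)
     \<le> real (card (edges F)) * (real (card \<Delta>) / real (card V) ^ 2)"
\<comment> \<open>An edge of \<open>F\<close> forces two vertices, so that \<open>?k - 2\<close> is
  a genuine difference; a non-empty \<open>V\<close> keeps the denominators positive.\<close>
proof (cases "edges F = {} \<or> V = {}")
  case True
  then show ?thesis
  proof
    assume "V = {}"
    then show ?thesis
    proof (cases "verts F = {}")
      case True
      then have "edges F = {}" using F by (auto simp: is_graph_def)
      then show ?thesis by simp
    qed (auto simp: PiE_eq_empty_iff)
  qed simp
next
  case False
  let ?k = "card (verts F)"
  define P where "P = verts F \<rightarrow>\<^sub>E V"
  define S where "S = {f \<in> P. \<forall>(u, v)\<in>edges F. R (f u) (f v)}"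
  define S' where "S' = {f \<in> P. \<forall>(u, v)\<in>edges F. R' (f u) (f v)}"
  define D where "D e = {f \<in> P. (f (fst e), f (snd e)) \<in> \<Delta>}" for e
  have fV: "finite (verts F)" and eV: "edges F \<subseteq> verts F \<times> verts F" and irr: "\<And>u. (u, u) \<notin> edges F"
    using F by (auto simp: is_graph_def)
  have fE: "finite (edges F)" using eV fV finite_subset by blast
  have fP: "finite P" unfolding P_def using fV V by (intro finite_PiE) auto
  have f\<Delta>: "finite \<Delta>" unfolding \<Delta> using V finite_subset[of "{(x, y) \<in> V \<times> V. R x y \<noteq> R' x y}" "V \<times> V"] by auto
  have fS: "finite S" "finite S'" using fP by (auto simp: S_def S'_def)
  have D: "card (D e) \<le> card \<Delta> * card V ^ (?k - 2)" if "e \<in> edges F" for e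
    unfolding D_def P_def by (rule card_PiE_two_le) (use that eV irr[of "fst e"] fV V f\<Delta> in auto)
  have inD: "(S - S') \<union> (S' - S) \<subseteq> (\<Union>e\<in>edges F. D e)"
  proof
    fix f assume f: "f \<in> (S - S') \<union> (S' - S)"
    then have fP: "f \<in> P" by (auto simp: S_def S'_def)
    from f obtain u v where uv: "(u, v) \<in> edges F" "R (f u) (f v) \<noteq> R' (f u) (f v)"
      by (auto simp: S_def S'_def)
    moreover have "f u \<in> V" "f v \<in> V" using fP uv(1) eV by (auto simp: P_def PiE_iff)
    ultimately have "f \<in> D (u, v)" using fP by (simp add: D_def \<Delta>)
    then show "f \<in> (\<Union>e\<in>edges F. D e)" using uv(1) by blast
  qed
  have "card ((S - S') \<union> (S' - S)) \<le> card (\<Union>e\<in>edges F. D e)"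
    using inD fP fE by (intro card_mono) (auto simp: D_def)
  also have "\<dots> \<le> (\<Sum>e\<in>edges F. card (D e))" by (rule card_UN_le[OF fE])
  also have "\<dots> \<le> card (edges F) * (card \<Delta> * card V ^ (?k - 2))"
    using sum_mono[of "edges F" "\<lambda>e. card (D e)" "\<lambda>_. card \<Delta> * card V ^ (?k - 2)"] D by simp
  finally have A: "card ((S - S') \<union> (S' - S)) \<le> card (edges F) * (card \<Delta> * card V ^ (?k - 2))" .
  have "card S \<le> card (S' \<union> ((S - S') \<union> (S' - S)))" "card S' \<le> card (S \<union> ((S - S') \<union> (S' - S)))"
    using fS by (auto intro!: card_mono)
  then have "card S \<le> card S' + card ((S - S') \<union> (S' - S))" "card S' \<le> card S + card ((S - S') \<union> (S' - S))"
    using card_Un_le[of S' "(S - S') \<union> (S' - S)"] card_Un_le[of S "(S - S') \<union> (S' - S)"] by linarith+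
  then have "\<bar>real (card S) - real (card S')\<bar> \<le> real (card ((S - S') \<union> (S' - S)))" by linarith
  also have "\<dots> \<le> real (card (edges F) * (card \<Delta> * card V ^ (?k - 2)))" using A by (rule of_nat_mono)
  finally have B: "\<bar>real (card S) - real (card S')\<bar> \<le> real (card (edges F)) * (real (card \<Delta>) * real (card V) ^ (?k - 2))" by simp
  have "?k \<ge> 2"
  proof -
    obtain u v where "(u, v) \<in> edges F" using False by auto
    then have "{u, v} \<subseteq> verts F" "u \<noteq> v" using eV irr by auto
    then show ?thesis using card_mono[OF fV, of "{u, v}"] by simp
  qed
  then have pw: "real (card V) ^ ?k = real (card V) ^ 2 * real (card V) ^ (?k - 2)"
    by (metis le_add_diff_inverse power_add)
  have cV: "real (card V) > 0" using False V by (simp add: card_gt_0_iff)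
  show ?thesis
    unfolding S_def[unfolded P_def, symmetric] S'_def[unfolded P_def, symmetric] pw
    using B cV by (simp add: divide_simps mult.assoc)
qed

text \<open>Maps into \<open>V\<close> are grouped by their composition with \<open>rt\<close>; over
  each admissible map into \<open>{..<n}\<close> there are \<open>L\<close> independent choices per
  vertex.\<close>

lemma blowup_hom:
  assumes VF: "finite VF" and V: "finite V" and rt: "rt ` V \<subseteq> {..<n}"
    and fib: "\<And>a. a < n \<Longrightarrow> card {x \<in> V. rt x = a} = L"
    and EF: "EF \<subseteq> VF \<times> VF"
  shows "card {f \<in> VF \<rightarrow>\<^sub>E V. \<forall>(u, v)\<in>EF. B (rt (f u)) (rt (f v))} =
     card {r \<in> VF \<rightarrow>\<^sub>E {..<n::nat}. \<forall>(u, v)\<in>EF. B (r u) (r v)} * L ^ card VF"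
proof -
  define S where "S = {f \<in> VF \<rightarrow>\<^sub>E V. \<forall>(u, v)\<in>EF. B (rt (f u)) (rt (f v))}"
  define T where "T = {r \<in> VF \<rightarrow>\<^sub>E {..<n::nat}. \<forall>(u, v)\<in>EF. B (r u) (r v)}"
  define g where "g f = (\<lambda>u\<in>VF. rt (f u))" for f
  have fS: "finite S" using finite_PiE[of VF "\<lambda>_. V"] VF V by (simp add: S_def)
  have fT: "finite T" using finite_PiE[of VF "\<lambda>_. {..<n}"] VF by (simp add: T_def)
  have gST: "g ` S \<subseteq> T"
  proof
    fix r assume "r \<in> g ` S"
    then obtain f where f: "f \<in> S" "r = g f" by blast
    have "\<forall>(u, v)\<in>EF. B (r u) (r v)" using f EF by (auto simp: S_def g_def)
    moreover have "r \<in> VF \<rightarrow>\<^sub>E {..<n}" using f rt by (auto simp: S_def g_def PiE_iff)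
    ultimately show "r \<in> T" by (simp add: T_def)
  qed
  have fiber: "card {f \<in> S. g f = r} = L ^ card VF" if r: "r \<in> T" for r
  proof -
    have "{f \<in> S. g f = r} = (\<Pi>\<^sub>E u\<in>VF. {x \<in> V. rt x = r u})"
    proof (intro equalityI subsetI)
      fix f assume "f \<in> {f \<in> S. g f = r}"
      then show "f \<in> (\<Pi>\<^sub>E u\<in>VF. {x \<in> V. rt x = r u})" by (auto simp: S_def g_def PiE_iff)
    next
      fix f assume f: "f \<in> (\<Pi>\<^sub>E u\<in>VF. {x \<in> V. rt x = r u})"
      then have 1: "f \<in> VF \<rightarrow>\<^sub>E V" "\<And>u. u \<in> VF \<Longrightarrow> rt (f u) = r u" by (auto simp: PiE_iff)
      have "g f = r"
      proof
        have "r \<in> VF \<rightarrow>\<^sub>E {..<n}" using r unfolding T_def by blast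
        then show "g f u = r u" for u using 1(2)[of u] PiE_arb[of r VF _ u] by (simp add: g_def restrict_def)
      qed
      moreover have "\<forall>(u, v)\<in>EF. B (rt (f u)) (rt (f v))" 
      proof (intro ballI, clarify)
        fix u v assume uv: "(u, v) \<in> EF"
        then have "rt (f u) = r u" "rt (f v) = r v" using EF 1(2) by auto
        moreover have "B (r u) (r v)" using r uv unfolding T_def by blast
        ultimately show "B (rt (f u)) (rt (f v))" by simp
      qed
      ultimately show "f \<in> {f \<in> S. g f = r}" using 1(1) by (simp add: S_def)
    qed
    moreover have "card {x \<in> V. rt x = r u} = L" if "u \<in> VF" for u
      using r that by (intro fib) (auto simp: T_def PiE_iff)
    ultimately show ?thesis using VF by (simp add: card_PiE)
  qed
  have "card S = (\<Sum>r\<in>T. card {f \<in> S. g f = r})"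
    using sum.group[OF fS fT gST, of "\<lambda>_. 1::nat"] by simp
  also have "\<dots> = card T * L ^ card VF" using fiber by simp
  finally show ?thesis by (simp add: S_def T_def)
qed

lemma blowup_density:
  assumes F: "is_graph (F :: nat graph)" and V: "finite V" and rt: "rt ` V \<subseteq> {..<n::nat}"
    and fib: "\<And>a. a < n \<Longrightarrow> card {x \<in> V. rt x = a} = L" and L: "L > 0" "n > 0"
    and \<Delta>: "\<Delta> = {(x, y) \<in> V \<times> V. R x y \<noteq> B (rt x) (rt y)}"
  shows "card V = n * L"
    "\<bar>real (card {f \<in> verts F \<rightarrow>\<^sub>E V. \<forall>(u, v)\<in>edges F. R (f u) (f v)}) / real (card V) ^ card (verts F) -
      real (card {r \<in> verts F \<rightarrow>\<^sub>E {..<n}. \<forall>(u, v)\<in>edges F. B (r u) (r v)}) / real n ^ card (verts F)\<bar>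
     \<le> real (card (edges F)) * (real (card \<Delta>) / real (card V) ^ 2)"
proof -
  have "card V = (\<Sum>a<n. card {x \<in> V. rt x = a})"
    using sum.group[OF V finite_lessThan rt, of "\<lambda>_. 1::nat"] by simp
  then show cV: "card V = n * L" using fib by simp
  have fV: "finite (verts F)" and eV: "edges F \<subseteq> verts F \<times> verts F" using F by (auto simp: is_graph_def)
  note h = blowup_hom[OF fV V rt fib eV, of B]
  have "real (card {r \<in> verts F \<rightarrow>\<^sub>E {..<n}. \<forall>(u, v)\<in>edges F. B (r u) (r v)}) / real n ^ card (verts F) =
    real (card {f \<in> verts F \<rightarrow>\<^sub>E V. \<forall>(u, v)\<in>edges F. B (rt (f u)) (rt (f v))}) / real (card V) ^ card (verts F)"
    using L by (simp add: h cV power_mult_distrib)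
  moreover note edit_distance[OF F V \<Delta>]
  ultimately show "\<bar>real (card {f \<in> verts F \<rightarrow>\<^sub>E V. \<forall>(u, v)\<in>edges F. R (f u) (f v)}) / real (card V) ^ card (verts F) -
      real (card {r \<in> verts F \<rightarrow>\<^sub>E {..<n}. \<forall>(u, v)\<in>edges F. B (r u) (r v)}) / real n ^ card (verts F)\<bar>
     \<le> real (card (edges F)) * (real (card \<Delta>) / real (card V) ^ 2)"
    by (simp add: diff_divide_distrib[symmetric])
qed

section \<open>A gadget inside subdivided cliques\<close>

lemma relpow_reverse: "sym R \<Longrightarrow> (x, y) \<in> R ^^ m \<Longrightarrow> (y, x) \<in> R ^^ m"
  by (rule symD[OF sym_relpow])

lemma relpow_image:
  assumes "inj_on h V" "E \<subseteq> V \<times> V" "x \<in> V" "y \<in> V"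
  shows "(h x, h y) \<in> (map_prod h h ` E) ^^ m \<longleftrightarrow> (x, y) \<in> E ^^ m"
  using assms(4)
proof (induction m arbitrary: y)
  case 0
  then show ?case using assms by (auto dest: inj_onD)
next
  case (Suc m)
  show ?case
  proof
    assume "(h x, h y) \<in> (map_prod h h ` E) ^^ Suc m"
    then obtain z where z: "(h x, z) \<in> (map_prod h h ` E) ^^ m" "(z, h y) \<in> map_prod h h ` E"
      by (rule relpow_Suc_E)
    then obtain z' y' where zy: "z = h z'" "h y = h y'" "(z', y') \<in> E" by auto
    then have "z' \<in> V" "y' = y" using assms(1,2) Suc.prems by (auto dest: inj_onD)
    then show "(x, y) \<in> E ^^ Suc m" using Suc.IH[of z'] z(1) zy by auto
  next
    assume "(x, y) \<in> E ^^ Suc m"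
    then obtain z where z: "(x, z) \<in> E ^^ m" "(z, y) \<in> E" by auto
    then have "z \<in> V" using assms(2) by auto
    then have "(h x, h z) \<in> (map_prod h h ` E) ^^ m" using Suc.IH z(1) by blast
    moreover have "(h z, h y) \<in> map_prod h h ` E" using z(2) by force
    ultimately show "(h x, h y) \<in> (map_prod h h ` E) ^^ Suc m" by (rule relpow_Suc_I)
  qed
qed

text \<open>Variable \<open>1\<close> is the end of the walk. The bound variable
  \<open>v + 2\<close> differs from \<open>v\<close> and from \<open>1\<close>, so nothing is
  captured.\<close>

fun walk_fo :: "nat \<Rightarrow> nat \<Rightarrow> fo" where
  "walk_fo 0 v = Eq v 1"
| "walk_fo (Suc m) v = Ex (v + 2) (Conj (Adj v (v + 2)) (walk_fo m (v + 2)))"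

lemma fv_walk_fo: "fv (walk_fo m v) \<subseteq> {v, 1}"
  by (induction m v rule: walk_fo.induct) auto

lemma sat_walk_fo:
  assumes "edges G \<subseteq> verts G \<times> verts G"
  shows "sat G \<sigma> (walk_fo m v) \<longleftrightarrow> (\<sigma> v, \<sigma> 1) \<in> edges G ^^ m"
proof (induction m arbitrary: v \<sigma>)
  case 0
  then show ?case by simp
next
  case (Suc m)
  have "sat G \<sigma> (walk_fo (Suc m) v) \<longleftrightarrow> (\<exists>w\<in>verts G. (\<sigma> v, w) \<in> edges G \<and> (w, \<sigma> 1) \<in> edges G ^^ m)"
    using Suc.IH by simp
  also have "\<dots> \<longleftrightarrow> (\<exists>w. (\<sigma> v, w) \<in> edges G \<and> (w, \<sigma> 1) \<in> edges G ^^ m)"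
    using assms by blast
  also have "\<dots> \<longleftrightarrow> (\<sigma> v, \<sigma> 1) \<in> edges G ^^ Suc m"
    unfolding relpow.simps(2) relpow_commute[symmetric] by auto
  finally show ?case .
qed

text \<open>A subdivided edge contributes \<open>p + 1\<close> steps and the pendant edges at its
  ends one each. The inequation makes the formula irreflexive in every graph; it is symmetric
  because walks can be reversed.\<close>

definition link_fo :: "nat \<Rightarrow> fo" where
  "link_fo p = Conj (Neg (Eq 0 1)) (walk_fo (p + 3) 0)"

lemma sat_link_fo:
  assumes "is_graph G"
  shows "sat G ((\<lambda>_. u)(1 := v)) (link_fo p) \<longleftrightarrow> u \<noteq> v \<and> (u, v) \<in> edges G ^^ (p + 3)"
  using assms unfolding link_fo_def by (simp add: sat_walk_fo is_graph_def del: walk_fo.simps relpow.simps)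

lemma basic_scheme_link_fo: "basic_scheme (link_fo p)"
  unfolding basic_scheme_def
proof (intro conjI allI impI ballI)
  show "fv (link_fo p) \<subseteq> {0, 1}" using fv_walk_fo[of "p + 3" 0] by (auto simp: link_fo_def)
  fix G :: "nat graph" assume G: "is_graph G"
  have "sym (edges G)" using G by (auto simp: is_graph_def sym_def)
  then show "sat G ((\<lambda>_. v)(1 := u)) (link_fo p)" if "sat G ((\<lambda>_. u)(1 := v)) (link_fo p)" for u v
    using that relpow_reverse unfolding sat_link_fo[OF G] by metis
  show "\<not> sat G (\<lambda>_. u) (link_fo p)" for u by (simp add: link_fo_def)
qed

section \<open>The gadget: a subdivided graph with pendant vertices\<close>

datatype vertex = Pr nat | Sub nat nat nat | Pend nat nat

text \<open>The root names the class of a vertex in the blow-up. Subdivision vertices are assigned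
  to their first end so that they have some class; pairs involving them are counted as
  errors.\<close>

fun rt :: "vertex \<Rightarrow> nat" where
  "rt (Pr a) = a"
| "rt (Sub a j t) = a"
| "rt (Pend a s) = a"

text \<open>\<open>L\<close> is the common size of the root classes. Being at least
  \<open>n + n ^ 2 * p\<close>, it bounds the number of all vertices that are not pendant, which
  therefore make up at most one in \<open>n\<close> of the \<open>n * L\<close> vertices.
  \<open>B\<close> may hold on the diagonal; pairs with equal roots are counted as errors.\<close>

locale gadget =
  fixes p n L :: nat and B :: "nat \<Rightarrow> nat \<Rightarrow> bool"
  assumes B_sym: "\<And>i j. B i j \<Longrightarrow> B j i" and n_pos: "n > 0" and L_def: "L = (p + 1) * n ^ 2"
begin

definition pt :: "nat \<Rightarrow> nat \<Rightarrow> nat \<Rightarrow> vertex" where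
  "pt i j t = (if t = 0 then Pr i else if t = Suc p then Pr j else Sub i j t)"

text \<open>The number of pendant vertices is chosen so that exactly \<open>L\<close> vertices have root \<open>a\<close>.\<close>
definition pend_num :: "nat \<Rightarrow> nat" where
  "pend_num a = L - (1 + (n - Suc a) * p)"

text \<open>All subdivision vertices are kept, and those of pairs not related by \<open>B\<close>
  are isolated; thus class sizes do not depend on \<open>B\<close>.\<close>

definition KV :: "vertex set" where
  "KV = Pr ` {..<n} \<union> {Sub a j t | a j t. a < j \<and> j < n \<and> 1 \<le> t \<and> t \<le> p} \<union> {Pend a s | a s. a < n \<and> s < pend_num a}"

definition KB :: "(vertex \<times> vertex) set" where
  "KB = {(pt i j t, pt i j (Suc t)) | i j t. i < j \<and> j < n \<and> B i j \<and> t \<le> p} \<union>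
     {(Pr a, Pend a s) | a s. a < n \<and> s < pend_num a}"

definition KE :: "(vertex \<times> vertex) set" where
  "KE = KB \<union> KB\<inverse>"

lemma sym_KE: "sym KE"
  by (auto simp: KE_def sym_def)

lemma KE_KV: "KE \<subseteq> KV \<times> KV"
  by (auto simp: KE_def KB_def KV_def pt_def)

text \<open>Ensures that the subtraction in \<open>pend_num\<close> is not cut off at zero.\<close>

lemma L_ge: "1 + (n - Suc a) * p \<le> L"
proof -
  have "(n - Suc a) * p \<le> n * p" by simp
  also have "n * p \<le> n ^ 2 * p" using n_pos by (simp add: power2_eq_square)
  finally have "1 + (n - Suc a) * p \<le> 1 + n ^ 2 * p" by simp
  also have "\<dots> \<le> n ^ 2 + n ^ 2 * p" using n_pos by simp
  finally show ?thesis by (simp add: L_def algebra_simps)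
qed

lemma L_pos: "L > 0"
  using L_ge[of 0] by simp

lemma fiber_eq: "a < n \<Longrightarrow> {x \<in> KV. rt x = a} =
  {Pr a} \<union> (\<lambda>(j, t). Sub a j t) ` ({a<..<n} \<times> {1..p}) \<union> Pend a ` {..<pend_num a}"
  by (auto simp: KV_def image_iff)

lemma card_fiber:
  assumes "a < n"
  shows "card {x \<in> KV. rt x = a} = L"
proof -
  have "card ((\<lambda>(j, t). Sub a j t) ` ({a<..<n} \<times> {1..p})) = (n - Suc a) * p"
    by (subst card_image) (auto simp: inj_on_def)
  moreover have "card (Pend a ` {..<pend_num a}) = pend_num a"
    by (subst card_image) (auto simp: inj_on_def)
  ultimately have "card {x \<in> KV. rt x = a} = 1 + (n - Suc a) * p + pend_num a"
    unfolding fiber_eq[OF assms] by (subst card_Un_disjoint, simp, simp, force)+ simp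
  then show ?thesis using L_ge[of a] by (simp add: pend_num_def)
qed

lemma rt_KV: "rt ` KV \<subseteq> {..<n}"
  by (auto simp: KV_def)

lemma finite_KV: "finite KV"
proof -
  have "KV = (\<Union>a<n. {x \<in> KV. rt x = a})" using rt_KV by auto
  moreover have "finite {x \<in> KV. rt x = a}" if "a < n" for a
    using card_fiber[OF that] L_pos by (simp add: card_ge_0_finite)
  ultimately show ?thesis by (metis (no_types, lifting) finite_UN_I finite_lessThan lessThan_iff)
qed

definition nonpend :: "vertex set" where
  "nonpend = {x \<in> KV. \<forall>a s. x \<noteq> Pend a s}"

lemma card_nonpend: "card nonpend \<le> L"
proof -
  have "nonpend \<subseteq> Pr ` {..<n} \<union> (\<lambda>(a, j, t). Sub a j t) ` ({..<n} \<times> {..<n} \<times> {1..p})"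
    by (auto simp: nonpend_def KV_def image_iff)
  then have "card nonpend \<le> card (Pr ` {..<n} \<union> (\<lambda>(a, j, t). Sub a j t) ` ({..<n} \<times> {..<n} \<times> {1..p}))"
    by (intro card_mono) auto
  also have "\<dots> \<le> card (Pr ` {..<n}) + card ((\<lambda>(a, j, t). Sub a j t) ` ({..<n} \<times> {..<n} \<times> {1..p}))"
    by (rule card_Un_le)
  also have "\<dots> \<le> card {..<n} + card ({..<n} \<times> {..<n} \<times> {1..p})"
    by (intro add_mono card_image_le) auto
  also have "\<dots> = n + n * n * p" by simp
  also have "\<dots> \<le> n * n + n * n * p" using n_pos by simp
  also have "\<dots> = L" by (simp add: L_def power2_eq_square algebra_simps)
  finally show ?thesis .
qed

text \<open>A lower bound for the distance from the branch vertex \<open>a\<close>, capped at two subdivided edges.\<close>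
definition pot0 :: "nat \<Rightarrow> nat \<Rightarrow> nat" where
  "pot0 a i = (if i = a then 0 else if B a i then p + 1 else 2 * (p + 1))"

fun pot :: "nat \<Rightarrow> vertex \<Rightarrow> nat" where
  "pot a (Pr i) = pot0 a i"
| "pot a (Sub i j t) = min (pot0 a i + t) (pot0 a j + (p + 1 - t))"
| "pot a (Pend c s) = pot0 a c + 1"

lemma pot0_edge:
  assumes "B i j"
  shows "pot0 a i \<le> pot0 a j + (p + 1)" "pot0 a j \<le> pot0 a i + (p + 1)"
  using assms B_sym[OF assms] by (auto simp: pot0_def)

text \<open>One formula covers the ends of a subdivided edge as well: values at branch vertices
  related by \<open>B\<close> differ by at most \<open>p + 1\<close>, so the minimum at an end is
  its own value.\<close>

lemma pot_pt:
  assumes "B i j" "t \<le> Suc p"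
  shows "pot a (pt i j t) = min (pot0 a i + t) (pot0 a j + (p + 1 - t))"
  using pot0_edge[OF assms(1), of a] assms(2) by (auto simp: pt_def min_def)

lemma pot_step:
  assumes "(x, y) \<in> KE"
  shows "pot a y \<le> pot a x + 1"
proof -
  have "pot a y \<le> pot a x + 1 \<and> pot a x \<le> pot a y + 1" if "(x, y) \<in> KB" for x y
  proof -
    from that consider i j t where "x = pt i j t" "y = pt i j (Suc t)" "B i j" "t \<le> p"
      | c s where "x = Pr c" "y = Pend c s" by (auto simp: KB_def)
    then show ?thesis
    proof cases
      case 1
      then show ?thesis using pot_pt[of i j t a] pot_pt[of i j "Suc t" a] by (auto simp: min_def)
    qed simp
  qed
  then show ?thesis using assms by (auto simp: KE_def)
qed

lemma pot_walk: "(x, y) \<in> KE ^^ m \<Longrightarrow> pot a y \<le> pot a x + m"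
proof (induction m arbitrary: y)
  case (Suc m)
  then obtain z where "(x, z) \<in> KE ^^ m" "(z, y) \<in> KE" by auto
  then show ?case using Suc.IH[of z] pot_step[of z y a] by linarith
qed simp

text \<open>\<open>p + 1\<close> steps from \<open>Pr a\<close> raise the potential from
  \<open>0\<close> to at most \<open>p + 1\<close>, whereas distinct unrelated branch vertices have
  potential \<open>2 * (p + 1)\<close>.\<close>

lemma branch_walk:
  assumes "a \<noteq> b" "(Pr a, Pr b) \<in> KE ^^ (p + 1)"
  shows "B a b"
  using pot_walk[OF assms(2), of a] assms(1) by (auto simp: pot0_def split: if_splits)

lemma walk_branch:
  assumes "a < b" "b < n" "B a b"
  shows "(Pr a, Pr b) \<in> KE ^^ (p + 1)"
proof -
  have "(pt a b 0, pt a b t) \<in> KE ^^ t" if "t \<le> Suc p" for t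
    using that
  proof (induction t)
    case (Suc t)
    then have "(pt a b t, pt a b (Suc t)) \<in> KE" using assms by (auto simp: KE_def KB_def)
    then show ?case using Suc by auto
  qed simp
  from this[of "Suc p"] show ?thesis by (simp add: pt_def)
qed

lemma Pend_nbr: "(Pend a s, y) \<in> KE \<Longrightarrow> y = Pr a" "(y, Pend a s) \<in> KE \<Longrightarrow> y = Pr a"
  by (auto simp: KE_def KB_def pt_def split: if_splits)

text \<open>The only possible neighbour of a pendant vertex is the branch vertex at its root, so the
  first and last steps are forced and a walk with \<open>p + 1\<close> edges between branch vertices
  remains.\<close>

lemma pendant_walk:
  assumes x: "Pend a s \<in> KV" and y: "Pend b s' \<in> KV" and ab: "a \<noteq> b"
  shows "(Pend a s, Pend b s') \<in> KE ^^ (p + 3) \<longleftrightarrow> B a b"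
proof
  assume "(Pend a s, Pend b s') \<in> KE ^^ (p + 3)"
  then have "(Pend a s, Pend b s') \<in> KE ^^ Suc (Suc (p + 1))" by (simp add: numeral_3_eq_3 del: relpow.simps)
  then obtain z where z: "(Pend a s, z) \<in> KE ^^ Suc (p + 1)" "(z, Pend b s') \<in> KE" by auto
  have zb: "z = Pr b" using Pend_nbr(2)[OF z(2)] .
  from z(1) obtain w where w: "(Pend a s, w) \<in> KE" "(w, z) \<in> KE ^^ (p + 1)" by (rule relpow_Suc_E2)
  have "w = Pr a" using Pend_nbr(1)[OF w(1)] .
  then show "B a b" using branch_walk[OF ab] w(2) zb by simp
next
  assume B: "B a b"
  have an: "a < n" "b < n" using x y by (auto simp: KV_def)
  have m: "(Pr a, Pr b) \<in> KE ^^ (p + 1)"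
  proof (cases "a < b")
    case True
    then show ?thesis using walk_branch an B by simp
  next
    case False
    then have "(Pr b, Pr a) \<in> KE ^^ (p + 1)" using walk_branch[of b a] an B_sym[OF B] ab by simp
    then show ?thesis by (rule relpow_reverse[OF sym_KE])
  qed
  have "(Pend a s, Pr a) \<in> KE" "(Pr b, Pend b s') \<in> KE" using x y by (auto simp: KE_def KB_def KV_def)
  with m have "(Pend a s, Pend b s') \<in> KE ^^ Suc (Suc (p + 1))"
    by (intro relpow_Suc_I[of _ "Pr b"] relpow_Suc_I2)
  then show "(Pend a s, Pend b s') \<in> KE ^^ (p + 3)" by (simp add: numeral_3_eq_3 del: relpow.simps)
qed

text \<open>Each pendant vertex gets a spare branch vertex \<open>n + a * L + s\<close> of its own,
  and \<open>n * L\<close> of them suffice as \<open>s < L\<close>. It becomes the first vertex on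
  the subdivided edge leading there; for \<open>p = 0\<close> this is the spare branch vertex
  itself.\<close>

fun emb :: "vertex \<Rightarrow> nat \<times> nat \<times> nat" where
  "emb (Pr a) = (a, a, 0)"
| "emb (Sub a j t) = (a, j, t)"
| "emb (Pend a s) = sd_pt p a (n + a * L + s) 1"

lemma pend_lt: "a < n \<Longrightarrow> s < pend_num a \<Longrightarrow> n + a * L + s < n + n * L"
proof -
  assume "a < n" "s < pend_num a"
  then have "s < L" by (simp add: pend_num_def)
  then have "a * L + s < Suc a * L" by simp
  also have "\<dots> \<le> n * L" using \<open>a < n\<close> by (intro mult_right_mono) auto
  finally show ?thesis by simp
qed

lemma pend_inj:
  assumes "s < pend_num a" "s' < pend_num a'" "a * L + s = a' * L + s'"
  shows "a = a' \<and> s = s'"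
proof -
  have "s < L" "s' < L" using assms(1,2) by (simp_all add: pend_num_def)
  then have "(a * L + s) div L = a" "(a' * L + s') div L = a'" using L_pos by simp_all
  then show ?thesis using assms(3) by simp
qed

lemma emb_Pend: "emb (Pend a s) = (if p = 0 then (n + a * L + s, n + a * L + s, 0) else (a, n + a * L + s, 1))"
  by (simp add: sd_pt_def)

lemma KV_cases:
  assumes "x \<in> KV"
  obtains a where "x = Pr a" "a < n" | a j t where "x = Sub a j t" "a < j" "j < n" "1 \<le> t" "t \<le> p"
    | a s where "x = Pend a s" "a < n" "s < pend_num a"
  using assms by (auto simp: KV_def)

lemma inj_emb: "inj_on emb KV"
proof (rule inj_onI)
  fix x y assume x: "x \<in> KV" and y: "y \<in> KV" and eq: "emb x = emb y"
  have pend: "False" if "emb (Pend a s) = emb z" "z \<in> KV" "\<forall>b s'. z \<noteq> Pend b s'" for a s z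
    using that(2)
  proof (cases rule: KV_cases)
    case (1 b)
    then show False using that(1) by (simp add: emb_Pend del: emb.simps(3) split: if_splits)
  next
    case (2 b j t)
    then show False using that(1) by (simp add: emb_Pend del: emb.simps(3) split: if_splits)
  next
    case (3 b s')
    then show False using that(3) by simp
  qed
  show "x = y"
  proof (cases "\<exists>a s. x = Pend a s")
    case True
    then obtain a s where xa: "x = Pend a s" by blast
    show ?thesis
    proof (cases "\<exists>b s'. y = Pend b s'")
      case True
      then obtain b s' where yb: "y = Pend b s'" by blast
      have "a * L + s = b * L + s'"
        using eq unfolding xa yb emb_Pend by (auto split: if_splits)
      moreover have "s < pend_num a" "s' < pend_num b" using x y by (auto simp: xa yb KV_def)
      ultimately show ?thesis using pend_inj[of s a s' b] by (simp add: xa yb)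
    next
      case False
      then show ?thesis using pend[of a s y] eq y xa by auto
    qed
  next
    case False
    then have np: "\<forall>b s'. y \<noteq> Pend b s'" using pend[of _ _ x] eq x by metis
    show ?thesis using x
    proof (cases rule: KV_cases)
      case x1: (1 a)
      show ?thesis using y by (cases rule: KV_cases) (use eq x1 np in simp_all)
    next
      case x2: (2 a j t)
      show ?thesis using y by (cases rule: KV_cases) (use eq x2 np in simp_all)
    qed (use False in simp)
  qed
qed

lemma emb_verts: "emb ` KV \<subseteq> verts (subdivided_clique p (n + n * L))"
proof -
  have "emb (Pend a s) \<in> verts (subdivided_clique p (n + n * L))" if "a < n" "s < pend_num a" for a s
    using pend_lt[OF that] that by (auto simp: subdivided_clique_def sd_pt_def)
  moreover have "emb (Pr a) \<in> verts (subdivided_clique p (n + n * L))" if "a < n" for a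
    using that by (auto simp: subdivided_clique_def)
  moreover have "emb (Sub a j t) \<in> verts (subdivided_clique p (n + n * L))" if "a < j" "j < n" "1 \<le> t" "t \<le> p" for a j t
    using that by (auto simp: subdivided_clique_def)
  ultimately show ?thesis by (auto simp: KV_def simp del: emb.simps)
qed

lemma emb_edges:
  assumes "(x, y) \<in> KE"
  shows "(emb x, emb y) \<in> edges (subdivided_clique p (n + n * L))"
proof -
  have e: "(sd_pt p i j t, sd_pt p i j (Suc t)) \<in> edges (subdivided_clique p (n + n * L))"
      "(sd_pt p i j (Suc t), sd_pt p i j t) \<in> edges (subdivided_clique p (n + n * L))"
    if "i < j" "j < n + n * L" "t \<le> p" for i j t
    using that by (auto simp: subdivided_clique_def)
  have "emb (pt i j t) = sd_pt p i j t" for i j t by (simp add: pt_def sd_pt_def)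
  moreover have "emb (Pr a) = sd_pt p a (n + a * L + s) 0" "emb (Pend a s) = sd_pt p a (n + a * L + s) (Suc 0)" for a s
    by (simp_all add: sd_pt_def)
  ultimately have "(emb x, emb y) \<in> edges (subdivided_clique p (n + n * L)) \<and> (emb y, emb x) \<in> edges (subdivided_clique p (n + n * L))"
    if "(x, y) \<in> KB" for x y
  proof -
    from that consider i j t where "x = pt i j t" "y = pt i j (Suc t)" "i < j" "j < n" "t \<le> p"
      | c s where "x = Pr c" "y = Pend c s" "c < n" "s < pend_num c" by (auto simp: KB_def)
    then show ?thesis
    proof cases
      case 1
      then show ?thesis using e[of i j t] \<open>\<And>i j t. emb (pt i j t) = sd_pt p i j t\<close> by simp
    next
      case 2
      have "c < n + c * L + s" using 2(3) by simp
      from e[OF this pend_lt[OF 2(3,4)], of 0] show ?thesis using 2(1,2)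
          \<open>\<And>a s. emb (Pr a) = sd_pt p a (n + a * L + s) 0\<close>[of c s] \<open>\<And>a s. emb (Pend a s) = sd_pt p a (n + a * L + s) (Suc 0)\<close>[of c s] by simp
    qed
  qed
  then show ?thesis using assms by (auto simp: KE_def)
qed

text \<open>Linking and \<open>B\<close> can disagree only on pairs with a vertex that is not
  pendant, at most \<open>2 * n * L ^ 2\<close> ordered pairs, or with equal roots, at most
  \<open>n * L ^ 2\<close>. Among \<open>(n * L) ^ 2\<close> pairs this is a share of at most
  \<open>3 / n\<close>.\<close>

lemma gadget_interp:
  assumes C: "monotone_class C" and G: "G \<in> C" "graph_iso (subdivided_clique p (n + n * L)) G"
  shows "\<exists>H\<in>basic_interp_class (link_fo p) C. \<forall>F :: nat graph. is_graph F \<longrightarrow>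
    \<bar>real (hom F H) / real (card (verts H)) ^ card (verts F) -
      real (card {r \<in> verts F \<rightarrow>\<^sub>E {..<n}. \<forall>(u, v)\<in>edges F. B (r u) (r v)}) / real n ^ card (verts F)\<bar>
    \<le> real (card (edges F)) * (3 / real n)"
proof -
  let ?S = "subdivided_clique p (n + n * L)"
  obtain f where f: "bij_betw f (verts ?S) (verts G)"
    "\<forall>u\<in>verts ?S. \<forall>v\<in>verts ?S. (u, v) \<in> edges ?S \<longleftrightarrow> (f u, f v) \<in> edges G"
    using G(2) unfolding graph_iso_def by blast
  have gG: "is_graph G" using C G(1) unfolding monotone_class_def by blast
  define h where "h = f \<circ> emb"
  have inj: "inj_on h KV"
    unfolding h_def using inj_emb emb_verts f(1)
    by (auto simp: bij_betw_def intro: comp_inj_on inj_on_subset)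
  \<comment> \<open>Edges outside the gadget are dropped, as monotonicity permits, so that walks in
    \<open>G'\<close> are exactly those along \<open>KE\<close>.\<close>
  define G' where "G' = \<lparr> verts = h ` KV, edges = map_prod h h ` KE \<rparr>"
  have hV: "h ` KV \<subseteq> verts G" using emb_verts f(1) by (auto simp: h_def bij_betw_def)
  have eG: "edges G' \<subseteq> edges G"
  proof
    fix e assume "e \<in> edges G'"
    then obtain x y where xy: "e = (h x, h y)" "(x, y) \<in> KE" by (auto simp: G'_def)
    have "emb x \<in> verts ?S" "emb y \<in> verts ?S" using xy(2) KE_KV emb_verts by auto
    then show "e \<in> edges G" using f(2) emb_edges[OF xy(2)] by (simp add: xy(1) h_def)
  qed
  have gG': "is_graph G'"
    unfolding is_graph_def
  proof (intro conjI allI impI)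
    show "finite (verts G')" by (simp add: G'_def finite_KV)
    show "edges G' \<subseteq> verts G' \<times> verts G'" using KE_KV by (auto simp: G'_def)
    show "(v, u) \<in> edges G'" if "(u, v) \<in> edges G'" for u v
      using that symD[OF sym_KE] by (force simp: G'_def)
    show "(u, u) \<notin> edges G'" for u using eG gG by (auto simp: is_graph_def)
  qed
  have "subgraph G' G" using eG hV by (auto simp: subgraph_def G'_def)
  moreover have "graph_iso G' G'" unfolding graph_iso_def by (intro exI[of _ id]) auto
  ultimately have G'C: "G' \<in> C" using C G(1) gG' unfolding monotone_class_def by blast
  define H where "H = basic_interp (link_fo p) G'"
  have eH: "edges H = {(u, v). u \<in> verts G' \<and> v \<in> verts G' \<and> u \<noteq> v \<and> (u, v) \<in> edges G' ^^ (p + 3)}"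
    unfolding H_def basic_interp_def sat_link_fo[OF gG'] by simp
  have "sym (edges G')" using gG' by (auto simp: is_graph_def sym_def)
  then have gH: "is_graph H"
    using gG' relpow_reverse[of "edges G'"] unfolding is_graph_def eH
    by (auto simp: H_def basic_interp_def simp del: relpow.simps)
  have "graph_iso H H" unfolding graph_iso_def by (intro exI[of _ id]) auto
  then have HC: "H \<in> basic_interp_class (link_fo p) C"
    using gH G'C unfolding basic_interp_class_def H_def by blast
  let ?V = "h ` KV"
  have VH: "verts H = ?V" by (simp add: H_def basic_interp_def G'_def)
  have edgeH: "(h x, h y) \<in> edges H \<longleftrightarrow> x \<noteq> y \<and> (x, y) \<in> KE ^^ (p + 3)" if "x \<in> KV" "y \<in> KV" for x y
  proof -
    have "(h x, h y) \<in> edges H \<longleftrightarrow> h x \<noteq> h y \<and> (h x, h y) \<in> edges G' ^^ (p + 3)"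
      using that unfolding eH by (simp add: G'_def del: relpow.simps)
    then show ?thesis using relpow_image[OF inj KE_KV that, of "p + 3"] inj that
      by (auto simp: G'_def inj_on_eq_iff simp del: relpow.simps)
  qed
  define r' where "r' v = rt (the_inv_into KV h v)" for v
  have r': "r' (h x) = rt x" if "x \<in> KV" for x using that by (simp add: r'_def the_inv_into_f_f[OF inj])
  have fV: "finite ?V" using finite_KV by simp
  have r'V: "r' ` ?V \<subseteq> {..<n}" using rt_KV by (auto simp: r')
  have fib: "card {v \<in> ?V. r' v = a} = L" if "a < n" for a
  proof -
    have "{v \<in> ?V. r' v = a} = h ` {x \<in> KV. rt x = a}" by (auto simp: r')
    moreover have "inj_on h {x \<in> KV. rt x = a}" using inj by (rule inj_on_subset) auto
    ultimately show ?thesis using card_fiber[OF that] by (simp add: card_image)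
  qed
  define \<Delta> where "\<Delta> = {(u, v) \<in> ?V \<times> ?V. ((u, v) \<in> edges H) \<noteq> B (r' u) (r' v)}"
  have cV: "card ?V = n * L"
    using blowup_density(1)[OF gH fV r'V fib L_pos n_pos \<Delta>_def] .
  have sub: "\<Delta> \<subseteq> (h ` nonpend \<times> ?V \<union> ?V \<times> h ` nonpend) \<union> (\<Union>a<n. {v \<in> ?V. r' v = a} \<times> {v \<in> ?V. r' v = a})"
  proof
    fix z assume "z \<in> \<Delta>"
    then obtain u v where uv: "z = (u, v)" "u \<in> ?V" "v \<in> ?V" "((u, v) \<in> edges H) \<noteq> B (r' u) (r' v)"
      unfolding \<Delta>_def by blast
    from uv(2,3) obtain x y where xy': "x \<in> KV" "y \<in> KV" "u = h x" "v = h y" by blast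
    have xy: "x \<in> KV" "y \<in> KV" "z = (h x, h y)" "((h x, h y) \<in> edges H) \<noteq> B (rt x) (rt y)"
      using uv xy' r'[OF xy'(1)] r'[OF xy'(2)] by simp_all
    show "z \<in> (h ` nonpend \<times> ?V \<union> ?V \<times> h ` nonpend) \<union> (\<Union>a<n. {v \<in> ?V. r' v = a} \<times> {v \<in> ?V. r' v = a})"
    proof (cases "x \<in> nonpend \<or> y \<in> nonpend \<or> rt x = rt y")
      case True
      have "rt x < n" using rt_KV xy(1) by auto
      then show ?thesis using True xy(1-3) r' by auto
    next
      case False
      then obtain a s b s' where "x = Pend a s" "y = Pend b s'" "a \<noteq> b" using xy(1,2) by (auto simp: nonpend_def)
      then show ?thesis using xy(4) pendant_walk[of a s b s'] xy(1,2) edgeH[OF xy(1,2)] by auto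
    qed
  qed
  have finI: "finite nonpend" using finite_KV by (simp add: nonpend_def)
  have "card \<Delta> \<le> card ((h ` nonpend \<times> ?V \<union> ?V \<times> h ` nonpend) \<union> (\<Union>a<n. {v \<in> ?V. r' v = a} \<times> {v \<in> ?V. r' v = a}))"
    using sub fV finI by (intro card_mono) auto
  also have "\<dots> \<le> card (h ` nonpend \<times> ?V) + card (?V \<times> h ` nonpend) + card (\<Union>a<n. {v \<in> ?V. r' v = a} \<times> {v \<in> ?V. r' v = a})"
    by (meson add_le_mono1 card_Un_le order_trans)
  also have "\<dots> \<le> L * (n * L) + (n * L) * L + n * L ^ 2"
  proof (intro add_mono)
    have "card (h ` nonpend) \<le> L" using card_image_le[OF finI, of h] card_nonpend by linarith
    then show "card (h ` nonpend \<times> ?V) \<le> L * (n * L)" "card (?V \<times> h ` nonpend) \<le> (n * L) * L"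
      unfolding card_cartesian_product cV by (auto intro: mult_le_mono)
    have "card (\<Union>a<n. {v \<in> ?V. r' v = a} \<times> {v \<in> ?V. r' v = a}) \<le> (\<Sum>a<n. card ({v \<in> ?V. r' v = a} \<times> {v \<in> ?V. r' v = a}))"
      by (rule card_UN_le) simp
    also have "\<dots> = (\<Sum>a<n. L ^ 2)" using fib by (intro sum.cong) (auto simp: card_cartesian_product power2_eq_square)
    finally show "card (\<Union>a<n. {v \<in> ?V. r' v = a} \<times> {v \<in> ?V. r' v = a}) \<le> n * L ^ 2" by simp
  qed
  also have "\<dots> = 3 * (n * L ^ 2)" by (simp add: power2_eq_square)
  finally have "real (card \<Delta>) \<le> real (3 * (n * L ^ 2))" by (rule of_nat_mono)
  then have "real (card \<Delta>) / real (card ?V) ^ 2 \<le> real (3 * (n * L ^ 2)) / real (card ?V) ^ 2"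
    by (rule divide_right_mono) simp
  also have "\<dots> = 3 / real n" using n_pos L_pos unfolding cV by (simp add: power2_eq_square)
  finally have \<Delta>: "real (card \<Delta>) / real (card ?V) ^ 2 \<le> 3 / real n" .
  show ?thesis
  proof (intro bexI[OF _ HC] allI impI)
    fix F :: "nat graph" assume F: "is_graph F"
    have "\<bar>real (hom F H) / real (card (verts H)) ^ card (verts F) -
      real (card {r \<in> verts F \<rightarrow>\<^sub>E {..<n}. \<forall>(u, v)\<in>edges F. B (r u) (r v)}) / real n ^ card (verts F)\<bar>
      \<le> real (card (edges F)) * (real (card \<Delta>) / real (card ?V) ^ 2)"
      unfolding hom_def VH by (rule blowup_density(2)[OF F fV r'V fib L_pos n_pos \<Delta>_def])
    also have "\<dots> \<le> real (card (edges F)) * (3 / real n)" using \<Delta> by (intro mult_left_mono) auto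
    finally show "\<bar>real (hom F H) / real (card (verts H)) ^ card (verts F) -
      real (card {r \<in> verts F \<rightarrow>\<^sub>E {..<n}. \<forall>(u, v)\<in>edges F. B (r u) (r v)}) / real n ^ card (verts F)\<bar>
      \<le> real (card (edges F)) * (3 / real n)" .
  qed
qed

end

section \<open>The equivalence\<close>

lemma hom_density_const:
  assumes "is_graph F"
  shows "hom_density F (\<lambda>_ _. c) = c ^ card {(i, j) \<in> edges F. i < j}"
proof -
  interpret prob_space "Pi\<^sub>M (verts F) (\<lambda>_. M01)" by (rule prob_PiM_M01)
  show ?thesis by (simp add: hom_density_def prob_space)
qed

lemma half_not_random_free: "graphon (\<lambda>_ _. 1 / 2)" "\<not> random_free_graphon (\<lambda>_ _. 1 / 2)"
proof -
  show "graphon (\<lambda>_ _. 1 / 2)" by (simp add: graphon_def)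
  interpret N: prob_space M01 by (rule prob_space_M01)
  interpret NN: pair_prob_space M01 M01 ..
  show "\<not> random_free_graphon (\<lambda>_ _. 1 / 2)"
    unfolding random_free_graphon_def by simp
qed

text \<open>The branch vertices of the \<open>d\<close>-th gadget stand for the subsets of
  \<open>{..<d}\<close>. With \<open>n = 2 ^ d\<close> the error \<open>3 / n\<close> tends to zero,
  while the parity densities tend to those of the constant \<open>1 / 2\<close>.\<close>

lemma somewhere_dense_interp:
  assumes C: "monotone_class C" and sd: "\<not> nowhere_dense C"
  shows "\<exists>\<theta>. basic_scheme \<theta> \<and> \<not> random_free_class (basic_interp_class \<theta> C)"
proof -
  obtain p where p: "\<And>N. \<exists>G\<in>C. graph_iso (subdivided_clique p N) G"
    using sd unfolding nowhere_dense_def by blast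
  define par where "par d F = real (card {r \<in> verts F \<rightarrow>\<^sub>E Pow {..<d}. \<forall>(u, v)\<in>edges F. odd (card (r u \<inter> r v))}) / (2 ^ d) ^ card (verts F)"
    for d and F :: "nat graph"
  have "\<exists>H\<in>basic_interp_class (link_fo p) C. \<forall>F :: nat graph. is_graph F \<longrightarrow>
    \<bar>real (hom F H) / real (card (verts H)) ^ card (verts F) - par d F\<bar> \<le> real (card (edges F)) * (3 / 2 ^ d)" for d
  proof -
    let ?n = "2 ^ d :: nat"
    have "card (Pow {..<d}) = ?n" by (simp add: card_Pow)
    then obtain \<iota> :: "nat set \<Rightarrow> nat" where \<iota>: "bij_betw \<iota> (Pow {..<d}) {..<?n}"
      by (metis card_lessThan finite_Pow_iff finite_lessThan finite_same_card_bij)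
    define e where "e = the_inv_into (Pow {..<d}) \<iota>"
    have e: "e (\<iota> X) = X" if "X \<subseteq> {..<d}" for X
      using \<iota> that by (simp add: e_def bij_betw_def the_inv_into_f_f)
    define B where "B i j \<longleftrightarrow> odd (card (e i \<inter> e j))" for i j
    interpret gadget p ?n "(p + 1) * ?n ^ 2" B
      by unfold_locales (auto simp: B_def Int_commute)
    obtain G where G: "G \<in> C" "graph_iso (subdivided_clique p (?n + ?n * ((p + 1) * ?n ^ 2))) G" using p by blast
    obtain H where H: "H \<in> basic_interp_class (link_fo p) C" and
      hom: "\<And>F :: nat graph. is_graph F \<Longrightarrow>
        \<bar>real (hom F H) / real (card (verts H)) ^ card (verts F) -
          real (card {r \<in> verts F \<rightarrow>\<^sub>E {..<?n}. \<forall>(u, v)\<in>edges F. B (r u) (r v)}) / real ?n ^ card (verts F)\<bar>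
        \<le> real (card (edges F)) * (3 / real ?n)"
      using gadget_interp[OF C G] by blast
    have "real (card {r \<in> verts F \<rightarrow>\<^sub>E {..<?n}. \<forall>(u, v)\<in>edges F. B (r u) (r v)}) / real ?n ^ card (verts F) = par d F"
      if F: "is_graph F" for F :: "nat graph"
    proof -
      have fF: "finite (verts F)" "edges F \<subseteq> verts F \<times> verts F" using F by (auto simp: is_graph_def)
      \<comment> \<open>A bijection is a blow-up with classes of size \<open>1\<close>, so
        \<open>blowup_hom\<close> also serves to rename numbers to subsets.\<close>
      have fib: "card {X \<in> Pow {..<d}. \<iota> X = a} = 1" if "a < ?n" for a
      proof -
        have "a \<in> \<iota> ` Pow {..<d}" using \<iota> that by (simp add: bij_betw_def)
        then obtain X where "X \<in> Pow {..<d}" "\<iota> X = a" by (elim imageE) simp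
        then have "{X \<in> Pow {..<d}. \<iota> X = a} = {X}" using \<iota> by (auto simp: bij_betw_def inj_on_def)
        then show ?thesis by simp
      qed
      have \<iota>V: "\<iota> ` Pow {..<d} \<subseteq> {..<?n}" using \<iota> by (auto simp: bij_betw_def)
      have "{f \<in> verts F \<rightarrow>\<^sub>E Pow {..<d}. \<forall>(u, v)\<in>edges F. B (\<iota> (f u)) (\<iota> (f v))} =
         {f \<in> verts F \<rightarrow>\<^sub>E Pow {..<d}. \<forall>(u, v)\<in>edges F. odd (card (f u \<inter> f v))}"
      proof (rule Collect_cong, rule conj_cong[OF refl], rule ball_cong[OF refl], clarify)
        fix f u v assume "f \<in> verts F \<rightarrow>\<^sub>E Pow {..<d}" "(u, v) \<in> edges F"
        then have "f u \<subseteq> {..<d}" "f v \<subseteq> {..<d}" using fF(2) by (auto simp: PiE_iff)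
        then show "B (\<iota> (f u)) (\<iota> (f v)) \<longleftrightarrow> odd (card (f u \<inter> f v))" by (simp add: B_def e)
      qed
      then have "card {r \<in> verts F \<rightarrow>\<^sub>E {..<?n}. \<forall>(u, v)\<in>edges F. B (r u) (r v)} =
        card {f \<in> verts F \<rightarrow>\<^sub>E Pow {..<d}. \<forall>(u, v)\<in>edges F. odd (card (f u \<inter> f v))}"
        using blowup_hom[OF fF(1) _ \<iota>V fib fF(2), of B] by simp
      then show ?thesis by (simp add: par_def)
    qed
    then show ?thesis using hom by (intro bexI[OF _ H]) auto
  qed
  then obtain Gs where Gs: "\<And>d. Gs d \<in> basic_interp_class (link_fo p) C" and
    bound: "\<And>d F. is_graph (F :: nat graph) \<Longrightarrow>
      \<bar>real (hom F (Gs d)) / real (card (verts (Gs d))) ^ card (verts F) - par d F\<bar> \<le> real (card (edges F)) * (3 / 2 ^ d)"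
    by metis
  have "L_convergent Gs (\<lambda>_ _. 1 / 2)"
    unfolding L_convergent_def
  proof (intro allI impI)
    fix F :: "nat graph" assume F: "is_graph F"
    have "(\<lambda>d. 3 * (1 / 2 :: real) ^ d) \<longlonglongrightarrow> 3 * 0"
      by (intro tendsto_intros LIMSEQ_power_zero) auto
    then have lim: "(\<lambda>d. real (card (edges F)) * (3 / 2 ^ d)) \<longlonglongrightarrow> 0"
      using tendsto_mult_left[of "\<lambda>d. 3 / 2 ^ d" 0 sequentially "real (card (edges F))"] by (simp add: power_one_over)
    have "(\<lambda>d. real (hom F (Gs d)) / real (card (verts (Gs d))) ^ card (verts F) - par d F) \<longlonglongrightarrow> 0"
      by (rule Lim_null_comparison[OF always_eventually lim]) (simp only: real_norm_def, intro allI bound[OF F])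
    from tendsto_add[OF this parity_hom_limit[OF F, folded par_def]]
    show "(\<lambda>d. real (hom F (Gs d)) / real (card (verts (Gs d))) ^ card (verts F)) \<longlonglongrightarrow> hom_density F (\<lambda>_ _. 1 / 2)"
      by (simp add: hom_density_const[OF F])
  qed
  then have "\<not> random_free_class (basic_interp_class (link_fo p) C)"
    unfolding random_free_class_def using Gs half_not_random_free by blast
  then show ?thesis using basic_scheme_link_fo by blast
qed

theorem theorem8p33:
  fixes C :: "nat graph set"
  assumes "monotone_class C"
  shows "((\<forall>I. interp_scheme I \<longrightarrow> random_free_class (interp_class I C)) \<longleftrightarrow>
          (\<forall>\<theta>. basic_scheme \<theta> \<longrightarrow> random_free_class (basic_interp_class \<theta> C)))
       \<and> ((\<forall>\<theta>. basic_scheme \<theta> \<longrightarrow> random_free_class (basic_interp_class \<theta> C)) \<longleftrightarrow>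
          nowhere_dense C)"
proof -
  have basic: "random_free_class (basic_interp_class \<theta> C)"
    if "\<forall>I. interp_scheme I \<longrightarrow> random_free_class (interp_class I C)" "basic_scheme \<theta>" for \<theta>
  proof -
    have "random_free_class (interp_class (scheme_of \<theta>) C)"
      using that(1) interp_scheme_scheme_of[OF that(2)] by simp
    then show ?thesis using basic_interp_class_subset[OF assms that(2)] by (rule random_free_class_mono)
  qed
  have nd: "nowhere_dense C" if rf: "\<forall>\<theta>. basic_scheme \<theta> \<longrightarrow> random_free_class (basic_interp_class \<theta> C)"
  proof (rule ccontr)
    assume "\<not> nowhere_dense C"
    from somewhere_dense_interp[OF assms this]
    obtain \<theta> where "basic_scheme \<theta>" "\<not> random_free_class (basic_interp_class \<theta> C)"
      by (elim exE conjE)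
    with rf show False by simp
  qed
  have interp: "\<forall>I. interp_scheme I \<longrightarrow> random_free_class (interp_class I C)" if "nowhere_dense C"
    using nowhere_dense_interp[OF assms that] by simp
  show ?thesis
  proof (intro conjI iffI)
    assume "\<forall>I. interp_scheme I \<longrightarrow> random_free_class (interp_class I C)"
    from basic[OF this] show "\<forall>\<theta>. basic_scheme \<theta> \<longrightarrow> random_free_class (basic_interp_class \<theta> C)" by simp
  next
    assume "\<forall>\<theta>. basic_scheme \<theta> \<longrightarrow> random_free_class (basic_interp_class \<theta> C)"
    then show "\<forall>I. interp_scheme I \<longrightarrow> random_free_class (interp_class I C)" by (rule interp[OF nd])
  next
    assume "nowhere_dense C"
    from basic[OF interp[OF this]] show "\<forall>\<theta>. basic_scheme \<theta> \<longrightarrow> random_free_class (basic_interp_class \<theta> C)" by simp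
  qed (rule nd)
qed

end
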